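(* Let $(A,G,\alpha)$ be a $C^*$-dynamical system, where the group $G$ is discrete, $A$ is a unital $C^*$-algebra with a faithful tracial state $\tau$, and $\alpha$ is $\tau$-preserving. The following are equivalent: (i) $(A,G,\alpha, \tau)$ has the Haagerup property; (ii) $(A \rtimes_{\alpha ,r} G, \tau')$ has the $C^*$-algebra Haagerup property.
   Context: A $C^*$-dynamical system $(A,G,\alpha)$ consists of a $C^*$-algebra $A$ (taken non-degenerately and faithfully represented, $A\subseteq\mathcal{B}(H)$), a discrete group $G$ with unit $e$, and a homomorphism $\alpha:G\to\mathrm{Aut}(A)$; $\tau$-preserving means $\tau\circ\alpha_t=\tau$ for all $t\in G$. Reduced crossed product: on $\ell^2(G,H)$ let $(\lambda_t\xi)(s)=\xi(t^{-1}s)$ and $(\pi(a)\xi)(s)=\alpha_{s^{-1}}(a)(\xi(s))$. For $f\in\ell^1(G,A)$ let $\tilde\pi(f)=\sum_{s\in G}\pi(f(s))\lambda_s$; $A\rtimes_{\alpha,r}G$ is the norm closure of $\tilde\pi(\ell^1(G,A))$. $\mathcal{E}:A\rtimes_{\alpha,r}G\to A$ is the canonical conditional expectation, determined by $\mathcal{E}(\pi(a)\lambda_s)=a$ if $s=e$ and $0$ otherwise, and $\tau'=\tau\circ\mathcal{E}$ is the induced faithful tracial state on $A\rtimes_{\alpha,r}G$. Herz-Schur multipliers: let $CB(A)$ be the space of completely bounded linear maps on $A$. A bounded map $F:G\to CB(A)$ is a Herz-Schur $(A,G,\alpha)$-multiplier if $S_F(\tilde\pi(f))=\tilde\pi(F\cdot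 f)$, $(F\cdot f)(t)=F(t)(f(t))$, $f\in\ell^1(G,A)$, defines a completely bounded map; $S_F$ then denotes also its extension to $A\rtimes_{\alpha,r}G$. It is completely positive if $S_F$ is a completely positive map on $A\rtimes_{\alpha,r}G$. $L^2$ notions: for a unital $C^*$-algebra $B$ with faithful tracial state $\sigma$, $\|b\|_{2,\sigma}=\sigma(b^*b)^{1/2}$ and $L^2(B,\sigma)$ is the completion of $B$ in this norm. A linear map $\Phi:B\to B$ is $L^2$-bounded if there is $C>0$ with $\|\Phi(b)\|_{2,\sigma}\le C\|b\|_{2,\sigma}$ for all $b\in B$; then $T_\Phi$ is the unique bounded operator on $L^2(B,\sigma)$ extending $\Phi$. $\Phi$ is $L^2$-compact if it is $L^2$-bounded and $T_\Phi$ is compact. For positive maps, $\sigma\circ\Phi\le\sigma$ means $\sigma(\Phi(b))\le\sigma(b)$ for all $b\in B^+$. $C^*$-algebra Haagerup property: $(B,\sigma)$ has it if there is a net $(\Phi_i)_{i\in I}$ of unital completely positive maps on $B$ such that (1) $\sigma\circ\Phi_i\le\sigma$ for all $i$; (2) $\Phi_i$ is $L^2$-compact for all $i$; (3) $\|\Phi_i(x)-x\|_{2,\sigma}\to0$ for all $x\in B$. Haagerup property of the system: $(A,G,\alpha,\tau)$ has the Haagerup property if there is a net $(F_i)_{i\in I}$ of completely positive Herz-Schur $(A,G,\alpha)$-multipliers such that (1) $F_i(e)$ is unital and $\tau\circ F_i(e)\le\tau$ for all $i$ (it is a fact that this makes each $F_i(t)$ $L^2$-bounded); (2) $F_i(t)$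 is $L^2$-compact for all $t\in G$ and all $i$; (3) for each $i$ the function $s\mapsto\|T_{F_i(s)}\|$ on $G$ vanishes at infinity; (4) $\|F_i(t)(a)-a\|_{2,\tau}\to0$ for all $t\in G$ and $a\in A$. *)

theory Defs
  imports "HOL-Analysis.Analysis"
begin

section \<open>Complex Hilbert spaces\<close>

class complex_vector = real_vector +
  fixes scaleC :: "complex \<Rightarrow> 'a \<Rightarrow> 'a"  (infixr \<open>*\<^sub>C\<close> 75)
  assumes scaleC_add_right: "c *\<^sub>C (x + y) = c *\<^sub>C x + c *\<^sub>C y"
    and scaleC_add_left: "(c + d) *\<^sub>C x = c *\<^sub>C x + d *\<^sub>C x"
    and scaleC_scaleC: "c *\<^sub>C d *\<^sub>C x = (c * d) *\<^sub>C x"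
    and scaleR_scaleC: "r *\<^sub>R x = complex_of_real r *\<^sub>C x"

text \<open>The inner product is linear in the first argument.\<close>

class complex_inner = complex_vector + real_normed_vector +
  fixes cinner :: "'a \<Rightarrow> 'a \<Rightarrow> complex"
  assumes cinner_commute: "cinner x y = cnj (cinner y x)"
    and cinner_add_left: "cinner (x + y) z = cinner x z + cinner y z"
    and cinner_scaleC_left: "cinner (c *\<^sub>C x) y = c * cinner x y"
    and norm_eq_sqrt_cinner: "norm x = sqrt (Re (cinner x x))"

class chilbert_space = complex_inner + banach

lemma cinner_self: "cinner x (x :: 'h :: complex_inner) = complex_of_real ((norm x)\<^sup>2)"
proof -
  have im: "Im (cinner x x) = 0"
    using cinner_commute[of x x] by (simp add: complex_eq_iff)
  have "0 \<le> Re (cinner x x)"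
    using norm_ge_zero[of x] by (simp add: norm_eq_sqrt_cinner)
  then show ?thesis
    using im by (simp add: complex_eq_iff norm_eq_sqrt_cinner)
qed

lemma cinner_add_right: "cinner (x :: 'h :: complex_inner) (y + z) = cinner x y + cinner x z"
  using arg_cong[OF cinner_add_left[of y z x], of cnj]
  by (simp only: complex_cnj_add cinner_commute[symmetric])

lemma cinner_scaleC_right: "cinner (x :: 'h :: complex_inner) (c *\<^sub>C y) = cnj c * cinner x y"
  using arg_cong[OF cinner_scaleC_left[of c y x], of cnj]
  by (simp only: complex_cnj_mult cinner_commute[symmetric])

lemma norm_scaleC: "norm (c *\<^sub>C (x :: 'h :: complex_inner)) = cmod c * norm x"
proof -
  have "complex_of_real ((norm (c *\<^sub>C x))\<^sup>2) = (c * cnj c) * complex_of_real ((norm x)\<^sup>2)"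
    unfolding cinner_self[symmetric] by (simp add: cinner_scaleC_left cinner_scaleC_right)
  also have "\<dots> = complex_of_real ((cmod c * norm x)\<^sup>2)"
    by (simp only: complex_norm_square[symmetric] of_real_mult[symmetric] power_mult_distrib
        of_real_power[symmetric])
  finally have "(norm (c *\<^sub>C x))\<^sup>2 = (cmod c * norm x)\<^sup>2"
    using of_real_eq_iff by blast
  then show ?thesis by simp
qed

lemma cinner_Cauchy_Schwarz: "cmod (cinner x (y :: 'h :: complex_inner)) \<le> norm x * norm y"
proof (cases "norm y = 0")
  case True
  then have "y = 0" by simp
  then have "y = 0 *\<^sub>C y"
    using scaleR_scaleC[of 0 y] by simp
  then have "cinner x y = 0"
    by (metis cinner_scaleC_right complex_cnj_zero mult_zero_left)
  then show ?thesis by simp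
next
  case False
  define n where "n = (norm y)\<^sup>2"
  define w where "w = cinner x y"
  define c where "c = - (w / complex_of_real n)"
  have n: "n > 0" using False by (simp add: n_def)
  have "complex_of_real ((norm (x + c *\<^sub>C y))\<^sup>2) = cinner (x + c *\<^sub>C y) (x + c *\<^sub>C y)"
    by (rule cinner_self[symmetric])
  also have "\<dots> = cinner x x + cnj c * cinner x y + c * cinner y x + c * cnj c * cinner y y"
    by (simp add: cinner_add_left cinner_add_right cinner_scaleC_left cinner_scaleC_right
        algebra_simps)
  also have "\<dots> = complex_of_real ((norm x)\<^sup>2) + cnj c * w + c * cnj w + c * cnj c * complex_of_real n"
    unfolding cinner_commute[of y x] cinner_self w_def n_def ..
  also have "\<dots> = complex_of_real ((norm x)\<^sup>2) - w * cnj w / complex_of_real n"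
    using n by (simp add: c_def field_simps)
  also have "\<dots> = complex_of_real ((norm x)\<^sup>2 - (cmod w)\<^sup>2 / n)"
    by (simp only: complex_norm_square[symmetric] of_real_diff of_real_divide of_real_power)
  finally have "(norm (x + c *\<^sub>C y))\<^sup>2 = (norm x)\<^sup>2 - (cmod w)\<^sup>2 / n"
    using of_real_eq_iff by blast
  then have "(cmod w)\<^sup>2 / n \<le> (norm x)\<^sup>2"
    using zero_le_power2[of "norm (x + c *\<^sub>C y)"] by linarith
  then have "(cmod w)\<^sup>2 \<le> (norm x * norm y)\<^sup>2"
    using n by (simp add: field_simps n_def)
  then show ?thesis
    unfolding w_def by (rule power2_le_imp_le) simp
qed

section \<open>The Hilbert space of square-summable functions\<close>

typedef (overloaded) ('g, 'h :: complex_inner) ell2 =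
  "{f :: 'g \<Rightarrow> 'h. (\<lambda>s. (norm (f s))\<^sup>2) summable_on UNIV}"
  morphisms ell2_apply Abs_ell2
  by (rule exI[of _ "\<lambda>_. 0"]) simp

setup_lifting type_definition_ell2

lemma sqsum_bound:
  fixes f :: "'g \<Rightarrow> 'h :: complex_inner"
  assumes "\<And>K. finite K \<Longrightarrow> L2_set (\<lambda>s. norm (f s)) K \<le> C"
  shows "(\<lambda>s. (norm (f s))\<^sup>2) summable_on UNIV" "sqrt (\<Sum>\<^sub>\<infinity>s. (norm (f s))\<^sup>2) \<le> C"
proof -
  have C: "0 \<le> C" using assms[of "{}"] by simp
  have le: "(\<Sum>s\<in>K. (norm (f s))\<^sup>2) \<le> C\<^sup>2" if "finite K" for K
    using assms[OF that] C by (simp add: L2_set_def sqrt_le_D)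
  show "(\<lambda>s. (norm (f s))\<^sup>2) summable_on UNIV"
    by (rule nonneg_bdd_above_summable_on) (auto intro!: bdd_aboveI[of _ "C\<^sup>2"] le)
  then have "(\<Sum>\<^sub>\<infinity>s. (norm (f s))\<^sup>2) \<le> C\<^sup>2"
    by (rule infsum_le_finite_sums) (use le in auto)
  then show "sqrt (\<Sum>\<^sub>\<infinity>s. (norm (f s))\<^sup>2) \<le> C"
    using C real_le_lsqrt infsum_nonneg by (metis zero_le_power2)
qed

lemma L2_set_le_sqsum:
  fixes f :: "'g \<Rightarrow> 'h :: complex_inner"
  assumes "(\<lambda>s. (norm (f s))\<^sup>2) summable_on UNIV" "finite K"
  shows "L2_set (\<lambda>s. norm (f s)) K \<le> sqrt (\<Sum>\<^sub>\<infinity>s. (norm (f s))\<^sup>2)"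
  unfolding L2_set_def
  by (rule real_sqrt_le_mono, rule finite_sum_le_infsum) (use assms in auto)

lemma L2_set_norm_add:
  fixes f g :: "'g \<Rightarrow> 'h :: complex_inner"
  shows "L2_set (\<lambda>s. norm (f s + g s)) K \<le> L2_set (\<lambda>s. norm (f s)) K + L2_set (\<lambda>s. norm (g s)) K"
  by (rule order_trans[OF L2_set_mono L2_set_triangle_ineq]) (auto intro: norm_triangle_ineq)

lemma sqsum_add:
  fixes f g :: "'g \<Rightarrow> 'h :: complex_inner"
  assumes "(\<lambda>s. (norm (f s))\<^sup>2) summable_on UNIV" "(\<lambda>s. (norm (g s))\<^sup>2) summable_on UNIV"
  shows "(\<lambda>s. (norm (f s + g s))\<^sup>2) summable_on UNIV"
    "sqrt (\<Sum>\<^sub>\<infinity>s. (norm (f s + g s))\<^sup>2) \<le> sqrt (\<Sum>\<^sub>\<infinity>s. (norm (f s))\<^sup>2) + sqrt (\<Sum>\<^sub>\<infinity>s. (norm (g s))\<^sup>2)"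
proof -
  have *: "L2_set (\<lambda>s. norm (f s + g s)) K
      \<le> sqrt (\<Sum>\<^sub>\<infinity>s. (norm (f s))\<^sup>2) + sqrt (\<Sum>\<^sub>\<infinity>s. (norm (g s))\<^sup>2)" if "finite K" for K
    using L2_set_norm_add[of f g K] L2_set_le_sqsum[OF assms(1) that] L2_set_le_sqsum[OF assms(2) that]
    by linarith
  from sqsum_bound[of "\<lambda>s. f s + g s", OF *]
  show "(\<lambda>s. (norm (f s + g s))\<^sup>2) summable_on UNIV"
    "sqrt (\<Sum>\<^sub>\<infinity>s. (norm (f s + g s))\<^sup>2) \<le> sqrt (\<Sum>\<^sub>\<infinity>s. (norm (f s))\<^sup>2) + sqrt (\<Sum>\<^sub>\<infinity>s. (norm (g s))\<^sup>2)"
    by auto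
qed

lemma sqsum_scaleC:
  fixes f :: "'g \<Rightarrow> 'h :: complex_inner"
  assumes "(\<lambda>s. (norm (f s))\<^sup>2) summable_on UNIV"
  shows "(\<lambda>s. (norm (c *\<^sub>C f s))\<^sup>2) summable_on UNIV"
  using summable_on_cmult_right[OF assms, of "(cmod c)\<^sup>2"]
  by (simp add: norm_scaleC power_mult_distrib)

lemma summable_cinner:
  fixes f g :: "'g \<Rightarrow> 'h :: complex_inner"
  assumes "(\<lambda>s. (norm (f s))\<^sup>2) summable_on UNIV" "(\<lambda>s. (norm (g s))\<^sup>2) summable_on UNIV"
  shows "(\<lambda>s. cinner (f s) (g s)) summable_on UNIV"
proof -
  have "(\<lambda>s. (norm (f s))\<^sup>2 + (norm (g s))\<^sup>2) summable_on UNIV"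
    by (rule summable_on_add[OF assms])
  then have "(\<lambda>s. norm (cinner (f s) (g s))) summable_on UNIV"
  proof (rule summable_on_comparison_test)
    fix s
    have "cmod (cinner (f s) (g s)) \<le> norm (f s) * norm (g s)"
      by (rule cinner_Cauchy_Schwarz)
    also have "\<dots> \<le> (norm (f s))\<^sup>2 + (norm (g s))\<^sup>2"
      using sum_squares_bound[of "norm (f s)" "norm (g s)"]
        mult_nonneg_nonneg[of "norm (f s)" "norm (g s)"] norm_ge_zero[of "f s"] norm_ge_zero[of "g s"] 
      by linarith
    finally show "cmod (cinner (f s) (g s)) \<le> (norm (f s))\<^sup>2 + (norm (g s))\<^sup>2" .
  qed auto
  then show ?thesis by (rule abs_summable_summable)
qed

lemma scaleC_minus1: "(- 1) *\<^sub>C x = - (x :: 'h :: complex_vector)"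
  using scaleR_scaleC[of "- 1" x] by simp

instantiation ell2 :: (type, complex_inner) complex_inner
begin

lift_definition zero_ell2 :: "('a, 'b) ell2" is "\<lambda>_. 0" by simp
lift_definition plus_ell2 :: "('a, 'b) ell2 \<Rightarrow> ('a, 'b) ell2 \<Rightarrow> ('a, 'b) ell2"
  is "\<lambda>f g s. f s + g s" by (rule sqsum_add)
lift_definition uminus_ell2 :: "('a, 'b) ell2 \<Rightarrow> ('a, 'b) ell2" is "\<lambda>f s. - f s" by simp
lift_definition minus_ell2 :: "('a, 'b) ell2 \<Rightarrow> ('a, 'b) ell2 \<Rightarrow> ('a, 'b) ell2"
  is "\<lambda>f g s. f s - g s"
  using sqsum_add(1)[of _ "\<lambda>s. - _ s"] by simp
lift_definition scaleC_ell2 :: "complex \<Rightarrow> ('a, 'b) ell2 \<Rightarrow> ('a, 'b) ell2"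
  is "\<lambda>c f s. c *\<^sub>C f s" by (rule sqsum_scaleC)
lift_definition scaleR_ell2 :: "real \<Rightarrow> ('a, 'b) ell2 \<Rightarrow> ('a, 'b) ell2"
  is "\<lambda>r f s. r *\<^sub>R f s" unfolding scaleR_scaleC by (rule sqsum_scaleC)
lift_definition norm_ell2 :: "('a, 'b) ell2 \<Rightarrow> real"
  is "\<lambda>f. sqrt (\<Sum>\<^sub>\<infinity>s. (norm (f s))\<^sup>2)" .
lift_definition cinner_ell2 :: "('a, 'b) ell2 \<Rightarrow> ('a, 'b) ell2 \<Rightarrow> complex"
  is "\<lambda>f g. \<Sum>\<^sub>\<infinity>s. cinner (f s) (g s)" .

definition sgn_ell2 :: "('a, 'b) ell2 \<Rightarrow> ('a, 'b) ell2" where "sgn_ell2 x = scaleR (inverse (norm x)) x"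
definition dist_ell2 :: "('a, 'b) ell2 \<Rightarrow> ('a, 'b) ell2 \<Rightarrow> real" where "dist_ell2 x y = norm (x - y)"
definition [code del]:
  "(uniformity :: (('a, 'b) ell2 \<times> ('a, 'b) ell2) filter) = (INF e\<in>{0 <..}. principal {(x, y). dist x y < e})"
definition open_ell2 :: "('a, 'b) ell2 set \<Rightarrow> bool" where [code del]:
  "open_ell2 S = (\<forall>x\<in>S. \<forall>\<^sub>F (x', y) in uniformity. x' = x \<longrightarrow> y \<in> S)"

instance
proof
  fix a b c :: "('a, 'b) ell2" and r q :: real and z w :: complex
  show "a + b + c = a + (b + c)" "a + b = b + a" "0 + a = a" "- a + a = 0" "a - b = a + - b"
    by (transfer; simp add: fun_eq_iff algebra_simps)+
  show "r *\<^sub>R (a + b) = r *\<^sub>R a + r *\<^sub>R b" "(r + q) *\<^sub>R a = r *\<^sub>R a + q *\<^sub>R a"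
    "r *\<^sub>R q *\<^sub>R a = (r * q) *\<^sub>R a" "1 *\<^sub>R a = a"
    by (transfer; simp add: fun_eq_iff algebra_simps)+
  show "z *\<^sub>C (a + b) = z *\<^sub>C a + z *\<^sub>C b" "(z + w) *\<^sub>C a = z *\<^sub>C a + w *\<^sub>C a"
    "z *\<^sub>C w *\<^sub>C a = (z * w) *\<^sub>C a" "r *\<^sub>R a = complex_of_real r *\<^sub>C a"
    by (transfer; simp add: fun_eq_iff scaleC_add_right scaleC_add_left scaleC_scaleC scaleR_scaleC)+
  show "dist a b = norm (a - b)" by (rule dist_ell2_def)
  show "sgn a = scaleR (inverse (norm a)) a" by (rule sgn_ell2_def)
  show "(uniformity :: (('a, 'b) ell2 \<times> ('a, 'b) ell2) filter) = (INF e\<in>{0 <..}. principal {(x, y). dist x y < e})"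
    by (rule uniformity_ell2_def)
  show "open S = (\<forall>x\<in>S. \<forall>\<^sub>F (x', y) in uniformity. x' = x \<longrightarrow> y \<in> S)" for S :: "('a, 'b) ell2 set"
    by (rule open_ell2_def)
  show "norm (a + b) \<le> norm a + norm b"
    by transfer (rule sqsum_add)
  show "norm a = 0 \<longleftrightarrow> a = 0"
  proof transfer
    fix f :: "'a \<Rightarrow> 'b" assume f: "(\<lambda>s. (norm (f s))\<^sup>2) summable_on UNIV"
    show "sqrt (\<Sum>\<^sub>\<infinity>s. (norm (f s))\<^sup>2) = 0 \<longleftrightarrow> f = (\<lambda>_. 0)"
    proof
      assume "sqrt (\<Sum>\<^sub>\<infinity>s. (norm (f s))\<^sup>2) = 0"
      then have "L2_set (\<lambda>s. norm (f s)) {s} \<le> 0" for s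
        using L2_set_le_sqsum[OF f, of "{s}"] by simp
      then show "f = (\<lambda>_. 0)" by (auto simp: fun_eq_iff)
    qed simp
  qed
  show "norm (r *\<^sub>R a) = \<bar>r\<bar> * norm a"
    by transfer (simp add: power_mult_distrib infsum_cmult_right' real_sqrt_mult)
  show "cinner a b = cnj (cinner b a)"
    by transfer (simp only: infsum_cnj[symmetric] cinner_commute[symmetric])
  show "cinner (a + b) c = cinner a c + cinner b c"
    by transfer (simp add: cinner_add_left infsum_add summable_cinner)
  show "cinner (z *\<^sub>C a) b = z * cinner a b"
    by transfer (simp add: cinner_scaleC_left infsum_cmult_right')
  show "norm a = sqrt (Re (cinner a a))"
  proof transfer
    fix f :: "'a \<Rightarrow> 'b" assume f: "(\<lambda>s. (norm (f s))\<^sup>2) summable_on UNIV"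
    show "sqrt (\<Sum>\<^sub>\<infinity>s. (norm (f s))\<^sup>2) = sqrt (Re (\<Sum>\<^sub>\<infinity>s. cinner (f s) (f s)))"
      using infsum_Re[OF summable_cinner[OF f f]] by (simp add: cinner_self)
  qed
qed

end

lemma norm_ell2_apply_le:
  fixes \<xi> :: "('g, 'h :: complex_inner) ell2"
  shows "norm (ell2_apply \<xi> s) \<le> norm \<xi>"
proof transfer
  fix f :: "'g \<Rightarrow> 'h" and s assume f: "(\<lambda>s. (norm (f s))\<^sup>2) summable_on UNIV"
  show "norm (f s) \<le> sqrt (\<Sum>\<^sub>\<infinity>s. (norm (f s))\<^sup>2)"
    using L2_set_le_sqsum[OF f, of "{s}"] by simp
qed

instance ell2 :: (type, chilbert_space) chilbert_space
proof
  fix X :: "nat \<Rightarrow> ('a, 'b) ell2"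
  assume X: "Cauchy X"
  have "Cauchy (\<lambda>n. ell2_apply (X n) s)" for s
  proof (rule metric_CauchyI)
    fix e :: real assume "0 < e"
    then obtain M where M: "\<And>m n. m \<ge> M \<Longrightarrow> n \<ge> M \<Longrightarrow> dist (X m) (X n) < e"
      using X unfolding Cauchy_def by blast
    have "dist (ell2_apply (X m) s) (ell2_apply (X n) s) < e" if "m \<ge> M" "n \<ge> M" for m n
    proof -
      have "ell2_apply (X m) s - ell2_apply (X n) s = ell2_apply (X m - X n) s"
        by (simp add: minus_ell2.rep_eq)
      then show ?thesis
        using norm_ell2_apply_le[of "X m - X n" s] M[OF that] by (simp add: dist_norm)
    qed
    then show "\<exists>M. \<forall>m\<ge>M. \<forall>n\<ge>M. dist (ell2_apply (X m) s) (ell2_apply (X n) s) < e" by blast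
  qed
  then have "\<forall>s. \<exists>l. (\<lambda>n. ell2_apply (X n) s) \<longlonglongrightarrow> l"
    using Cauchy_convergent convergent_def by blast
  then obtain f where f: "\<And>s. (\<lambda>n. ell2_apply (X n) s) \<longlonglongrightarrow> f s" by metis
  have close: "\<exists>M. \<forall>n\<ge>M. \<forall>K. finite K \<longrightarrow> L2_set (\<lambda>s. norm (ell2_apply (X n) s - f s)) K \<le> e"
    if e: "0 < e" for e
  proof -
    obtain M where M: "\<And>m n. m \<ge> M \<Longrightarrow> n \<ge> M \<Longrightarrow> dist (X m) (X n) < e"
      using X e unfolding Cauchy_def by blast
    have "L2_set (\<lambda>s. norm (ell2_apply (X n) s - f s)) K \<le> e" if n: "n \<ge> M" and K: "finite K" for n K
    proof (rule LIMSEQ_le_const2)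
      show "(\<lambda>m. L2_set (\<lambda>s. norm (ell2_apply (X n) s - ell2_apply (X m) s)) K)
          \<longlonglongrightarrow> L2_set (\<lambda>s. norm (ell2_apply (X n) s - f s)) K"
        unfolding L2_set_def by (intro tendsto_intros f)
      have "L2_set (\<lambda>s. norm (ell2_apply (X n) s - ell2_apply (X m) s)) K \<le> e" if m: "m \<ge> M" for m
      proof -
        have "L2_set (\<lambda>s. norm (ell2_apply (X n - X m) s)) K \<le> norm (X n - X m)"
          unfolding norm_ell2.rep_eq
          by (rule L2_set_le_sqsum[OF _ K]) (use ell2_apply in auto)
        then show ?thesis
          using M[OF n m] by (simp add: minus_ell2.rep_eq dist_norm)
      qed
      then show "\<exists>N. \<forall>m\<ge>N. L2_set (\<lambda>s. norm (ell2_apply (X n) s - ell2_apply (X m) s)) K \<le> e" by blast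
    qed
    then show ?thesis by blast
  qed
  from close[of 1] obtain M where
    "\<And>K. finite K \<Longrightarrow> L2_set (\<lambda>s. norm (ell2_apply (X M) s - f s)) K \<le> 1" by auto
  from sqsum_bound(1)[of "\<lambda>s. ell2_apply (X M) s - f s", OF this]
  have "(\<lambda>s. (norm (f s - ell2_apply (X M) s))\<^sup>2) summable_on UNIV"
    by (simp add: norm_minus_commute)
  from sqsum_add(1)[OF this, of "ell2_apply (X M)"] ell2_apply[of "X M"]
  have fs: "(\<lambda>s. (norm (f s))\<^sup>2) summable_on UNIV" by simp
  define L where "L = Abs_ell2 f"
  have L: "ell2_apply L = f"
    unfolding L_def using fs by (simp add: Abs_ell2_inverse)
  have "X \<longlonglongrightarrow> L"
  proof (rule metric_LIMSEQ_I)
    fix e :: real assume "0 < e"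
    then obtain N where N: "\<And>n K. n \<ge> N \<Longrightarrow> finite K
        \<Longrightarrow> L2_set (\<lambda>s. norm (ell2_apply (X n) s - f s)) K \<le> e / 2"
      using close[of "e / 2"] by auto
    have "norm (X n - L) \<le> e / 2" if "n \<ge> N" for n
      unfolding norm_ell2.rep_eq minus_ell2.rep_eq L by (rule sqsum_bound(2)[OF N[OF that]])
    then show "\<exists>N. \<forall>n\<ge>N. dist (X n) L < e"
      using \<open>0 < e\<close> by (force simp: dist_norm)
  qed
  then show "convergent X" by (auto simp: convergent_def)
qed

section \<open>Operators and concrete C*-algebras\<close>

text \<open>
  Elements of \<^typ>\<open>'h \<Rightarrow>\<^sub>L 'h\<close> are bounded real-linear maps; the bounded operators of the
  complex Hilbert space are the complex-linear ones among them.
\<close>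

instantiation blinfun :: (real_normed_vector, complex_inner) complex_vector
begin

lift_definition scaleC_blinfun :: "complex \<Rightarrow> 'a \<Rightarrow>\<^sub>L 'b \<Rightarrow> 'a \<Rightarrow>\<^sub>L 'b" is "\<lambda>c f x. c *\<^sub>C f x"
proof -
  fix c :: complex and f :: "'a \<Rightarrow> 'b"
  assume f: "bounded_linear f"
  have "bounded_linear (\<lambda>y::'b. c *\<^sub>C y)"
    by (rule bounded_linear_intro[where K = "cmod c"])
      (simp_all add: scaleC_add_right scaleR_scaleC scaleC_scaleC norm_scaleC mult.commute)
  from bounded_linear_compose[OF this f] show "bounded_linear (\<lambda>x. c *\<^sub>C f x)" .
qed

instance
  by standard (transfer; simp add: fun_eq_iff scaleC_add_right scaleC_add_left scaleC_scaleC scaleR_scaleC)+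

end

definition bounded_operators :: "('h :: complex_inner \<Rightarrow>\<^sub>L 'h) set" where
  "bounded_operators = {a. \<forall>c x. blinfun_apply a (c *\<^sub>C x) = c *\<^sub>C blinfun_apply a x}"

definition is_adjoint :: "('h :: complex_inner \<Rightarrow>\<^sub>L 'h) \<Rightarrow> ('h \<Rightarrow>\<^sub>L 'h) \<Rightarrow> bool" where
  "is_adjoint b a \<longleftrightarrow>
     (\<forall>x y. cinner (blinfun_apply b x) y = cinner x (blinfun_apply a y))"

definition adj :: "('h :: complex_inner \<Rightarrow>\<^sub>L 'h) \<Rightarrow> ('h \<Rightarrow>\<^sub>L 'h)" where
  "adj a = (THE b. is_adjoint b a)"

definition complex_subspace :: "'v :: complex_vector set \<Rightarrow> bool" where
  "complex_subspace V \<longleftrightarrow>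
     0 \<in> V \<and> (\<forall>x\<in>V. \<forall>y\<in>V. x + y \<in> V) \<and> (\<forall>c. \<forall>x\<in>V. c *\<^sub>C x \<in> V)"

text \<open>
  Nondegenerate, concretely represented unital C*-algebras: for a nondegenerate representation
  the unit of the algebra is the identity operator.
\<close>

definition unital_cstar_algebra :: "('h :: chilbert_space \<Rightarrow>\<^sub>L 'h) set \<Rightarrow> bool" where
  "unital_cstar_algebra B \<longleftrightarrow>
     B \<subseteq> bounded_operators \<and> complex_subspace B \<and>
     (\<forall>a\<in>B. \<forall>b\<in>B. a o\<^sub>L b \<in> B) \<and>
     (\<forall>a\<in>B. \<exists>b\<in>B. is_adjoint b a) \<and>
     closed B \<and> id_blinfun \<in> B"

definition positive_op :: "('h :: complex_inner \<Rightarrow>\<^sub>L 'h) \<Rightarrow> bool" where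
  "positive_op a \<longleftrightarrow> (\<forall>x. cinner (blinfun_apply a x) x \<in> \<real>\<^sub>\<ge>\<^sub>0)"

definition linear_on :: "'v :: complex_vector set \<Rightarrow> ('v \<Rightarrow> 'w :: complex_vector) \<Rightarrow> bool" where
  "linear_on V \<Phi> \<longleftrightarrow>
     (\<forall>x\<in>V. \<forall>y\<in>V. \<Phi> (x + y) = \<Phi> x + \<Phi> y) \<and> (\<forall>c. \<forall>x\<in>V. \<Phi> (c *\<^sub>C x) = c *\<^sub>C \<Phi> x)"

definition faithful_tracial_state ::
    "('h :: chilbert_space \<Rightarrow>\<^sub>L 'h) set \<Rightarrow> (('h \<Rightarrow>\<^sub>L 'h) \<Rightarrow> complex) \<Rightarrow> bool" where
  "faithful_tracial_state B \<sigma> \<longleftrightarrow>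
     (\<forall>a\<in>B. \<forall>b\<in>B. \<sigma> (a + b) = \<sigma> a + \<sigma> b) \<and> (\<forall>c. \<forall>a\<in>B. \<sigma> (c *\<^sub>C a) = c * \<sigma> a) \<and>
     (\<forall>a\<in>B. positive_op a \<longrightarrow> \<sigma> a \<in> \<real>\<^sub>\<ge>\<^sub>0) \<and> \<sigma> id_blinfun = 1 \<and>
     (\<forall>a\<in>B. \<forall>b\<in>B. \<sigma> (a o\<^sub>L b) = \<sigma> (b o\<^sub>L a)) \<and>
     (\<forall>a\<in>B. \<sigma> (adj a o\<^sub>L a) = 0 \<longrightarrow> a = 0)"

section \<open>Completely bounded and completely positive maps\<close>

text \<open>
  An \<open>n \<times> n\<close> matrix of operators is given by its entries with indices below \<open>n\<close>;
  it acts on the \<open>n\<close>-fold Hilbert space sum, whose vectors are likewise given by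
  their components with index below \<open>n\<close>.
\<close>

definition opmat_in :: "nat \<Rightarrow> 'v set \<Rightarrow> (nat \<Rightarrow> nat \<Rightarrow> 'v) \<Rightarrow> bool" where
  "opmat_in n V b \<longleftrightarrow> (\<forall>i<n. \<forall>j<n. b i j \<in> V)"

definition opmat_norm :: "nat \<Rightarrow> (nat \<Rightarrow> nat \<Rightarrow> 'h :: complex_inner \<Rightarrow>\<^sub>L 'h) \<Rightarrow> real" where
  "opmat_norm n b =
     Sup {sqrt (\<Sum>i<n. (norm (\<Sum>j<n. blinfun_apply (b i j) (x j)))\<^sup>2) | x :: nat \<Rightarrow> 'h.
            (\<Sum>j<n. (norm (x j))\<^sup>2) \<le> 1}"

definition opmat_positive :: "nat \<Rightarrow> (nat \<Rightarrow> nat \<Rightarrow> 'h :: complex_inner \<Rightarrow>\<^sub>L 'h) \<Rightarrow> bool" where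
  "opmat_positive n b \<longleftrightarrow>
     (\<forall>x :: nat \<Rightarrow> 'h. (\<Sum>i<n. cinner (\<Sum>j<n. blinfun_apply (b i j) (x j)) (x i)) \<in> \<real>\<^sub>\<ge>\<^sub>0)"

definition cb_norm_le ::
    "('h :: complex_inner \<Rightarrow>\<^sub>L 'h) set \<Rightarrow> (('h \<Rightarrow>\<^sub>L 'h) \<Rightarrow> ('h \<Rightarrow>\<^sub>L 'h)) \<Rightarrow> real \<Rightarrow> bool" where
  "cb_norm_le V \<Phi> C \<longleftrightarrow>
     (\<forall>n b. opmat_in n V b \<longrightarrow> opmat_norm n (\<lambda>i j. \<Phi> (b i j)) \<le> C * opmat_norm n b)"

definition completely_bounded ::
    "('h :: complex_inner \<Rightarrow>\<^sub>L 'h) set \<Rightarrow> (('h \<Rightarrow>\<^sub>L 'h) \<Rightarrow> ('h \<Rightarrow>\<^sub>L 'h)) \<Rightarrow> bool" where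
  "completely_bounded V \<Phi> \<longleftrightarrow> \<Phi> ` V \<subseteq> V \<and> linear_on V \<Phi> \<and> (\<exists>C. cb_norm_le V \<Phi> C)"

definition completely_positive ::
    "('h :: complex_inner \<Rightarrow>\<^sub>L 'h) set \<Rightarrow> (('h \<Rightarrow>\<^sub>L 'h) \<Rightarrow> ('h \<Rightarrow>\<^sub>L 'h)) \<Rightarrow> bool" where
  "completely_positive V \<Phi> \<longleftrightarrow> \<Phi> ` V \<subseteq> V \<and> linear_on V \<Phi> \<and>
     (\<forall>n b. opmat_in n V b \<and> opmat_positive n b \<longrightarrow> opmat_positive n (\<lambda>i j. \<Phi> (b i j)))"

definition unital_map :: "(('h :: complex_inner \<Rightarrow>\<^sub>L 'h) \<Rightarrow> ('h \<Rightarrow>\<^sub>L 'h)) \<Rightarrow> bool" where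
  "unital_map \<Phi> \<longleftrightarrow> \<Phi> id_blinfun = id_blinfun"

text \<open>
  For a positive map \<open>\<Phi>\<close> and a state \<open>\<sigma>\<close> both sides of the inequality are real.
\<close>

definition trace_decreasing ::
    "('h :: complex_inner \<Rightarrow>\<^sub>L 'h) set \<Rightarrow> (('h \<Rightarrow>\<^sub>L 'h) \<Rightarrow> complex)
      \<Rightarrow> (('h \<Rightarrow>\<^sub>L 'h) \<Rightarrow> ('h \<Rightarrow>\<^sub>L 'h)) \<Rightarrow> bool" where
  "trace_decreasing B \<sigma> \<Phi> \<longleftrightarrow> (\<forall>b\<in>B. positive_op b \<longrightarrow> Re (\<sigma> (\<Phi> b)) \<le> Re (\<sigma> b))"

section \<open>The space \<open>L\<^sup>2(B, \<sigma>)\<close>\<close>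

definition norm2 :: "(('h :: complex_inner \<Rightarrow>\<^sub>L 'h) \<Rightarrow> complex) \<Rightarrow> ('h \<Rightarrow>\<^sub>L 'h) \<Rightarrow> real" where
  "norm2 \<sigma> b = sqrt (Re (\<sigma> (adj b o\<^sub>L b)))"

text \<open>The completion is realised as Cauchy sequences modulo null sequences.\<close>

definition L2_Cauchy ::
    "('h :: complex_inner \<Rightarrow>\<^sub>L 'h) set \<Rightarrow> (('h \<Rightarrow>\<^sub>L 'h) \<Rightarrow> complex) \<Rightarrow> (nat \<Rightarrow> 'h \<Rightarrow>\<^sub>L 'h) set" where
  "L2_Cauchy B \<sigma> =
     {x. range x \<subseteq> B \<and> (\<forall>e>0. \<exists>N. \<forall>m\<ge>N. \<forall>n\<ge>N. norm2 \<sigma> (x m - x n) < e)}"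

definition L2_rel ::
    "('h :: complex_inner \<Rightarrow>\<^sub>L 'h) set \<Rightarrow> (('h \<Rightarrow>\<^sub>L 'h) \<Rightarrow> complex)
      \<Rightarrow> ((nat \<Rightarrow> 'h \<Rightarrow>\<^sub>L 'h) \<times> (nat \<Rightarrow> 'h \<Rightarrow>\<^sub>L 'h)) set" where
  "L2_rel B \<sigma> =
     {(x, y). x \<in> L2_Cauchy B \<sigma> \<and> y \<in> L2_Cauchy B \<sigma> \<and> (\<lambda>n. norm2 \<sigma> (x n - y n)) \<longlonglongrightarrow> 0}"

definition L2_space ::
    "('h :: complex_inner \<Rightarrow>\<^sub>L 'h) set \<Rightarrow> (('h \<Rightarrow>\<^sub>L 'h) \<Rightarrow> complex)
      \<Rightarrow> (nat \<Rightarrow> 'h \<Rightarrow>\<^sub>L 'h) set set" where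
  "L2_space B \<sigma> = L2_Cauchy B \<sigma> // L2_rel B \<sigma>"

definition L2_norm ::
    "(('h :: complex_inner \<Rightarrow>\<^sub>L 'h) \<Rightarrow> complex) \<Rightarrow> (nat \<Rightarrow> 'h \<Rightarrow>\<^sub>L 'h) set \<Rightarrow> real" where
  "L2_norm \<sigma> X = (THE r. \<forall>x\<in>X. (\<lambda>n. norm2 \<sigma> (x n)) \<longlonglongrightarrow> r)"

text \<open>
  The value \<open>0\<close> outside the space makes \<^const>\<open>Metric_space\<close> applicable, which demands
  nonnegativity and symmetry for all arguments.
\<close>

definition L2_dist ::
    "('h :: complex_inner \<Rightarrow>\<^sub>L 'h) set \<Rightarrow> (('h \<Rightarrow>\<^sub>L 'h) \<Rightarrow> complex)
      \<Rightarrow> (nat \<Rightarrow> 'h \<Rightarrow>\<^sub>L 'h) set \<Rightarrow> (nat \<Rightarrow> 'h \<Rightarrow>\<^sub>L 'h) set \<Rightarrow> real" where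
  "L2_dist B \<sigma> X Y =
     (if X \<in> L2_space B \<sigma> \<and> Y \<in> L2_space B \<sigma>
      then THE r. \<forall>x\<in>X. \<forall>y\<in>Y. (\<lambda>n. norm2 \<sigma> (x n - y n)) \<longlonglongrightarrow> r else 0)"

definition L2_bounded ::
    "('h :: complex_inner \<Rightarrow>\<^sub>L 'h) set \<Rightarrow> (('h \<Rightarrow>\<^sub>L 'h) \<Rightarrow> complex)
      \<Rightarrow> (('h \<Rightarrow>\<^sub>L 'h) \<Rightarrow> ('h \<Rightarrow>\<^sub>L 'h)) \<Rightarrow> bool" where
  "L2_bounded B \<sigma> \<Phi> \<longleftrightarrow> (\<exists>C>0. \<forall>b\<in>B. norm2 \<sigma> (\<Phi> b) \<le> C * norm2 \<sigma> b)"

text \<open>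
  The continuous extension \<open>T\<^sub>\<Phi>\<close> of an \<open>L\<^sup>2\<close>-bounded linear map \<open>\<Phi> : B \<rightarrow> B\<close>:
  the class of \<open>(x\<^sub>n)\<close> is sent to the class of \<open>(\<Phi> x\<^sub>n)\<close>.
\<close>

definition L2_ext ::
    "('h :: complex_inner \<Rightarrow>\<^sub>L 'h) set \<Rightarrow> (('h \<Rightarrow>\<^sub>L 'h) \<Rightarrow> complex)
      \<Rightarrow> (('h \<Rightarrow>\<^sub>L 'h) \<Rightarrow> ('h \<Rightarrow>\<^sub>L 'h)) \<Rightarrow> (nat \<Rightarrow> 'h \<Rightarrow>\<^sub>L 'h) set \<Rightarrow> (nat \<Rightarrow> 'h \<Rightarrow>\<^sub>L 'h) set" where
  "L2_ext B \<sigma> \<Phi> X = (\<Union>x\<in>X. L2_rel B \<sigma> `` {\<Phi> \<circ> x})"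

definition L2_unit_ball ::
    "('h :: complex_inner \<Rightarrow>\<^sub>L 'h) set \<Rightarrow> (('h \<Rightarrow>\<^sub>L 'h) \<Rightarrow> complex)
      \<Rightarrow> (nat \<Rightarrow> 'h \<Rightarrow>\<^sub>L 'h) set set" where
  "L2_unit_ball B \<sigma> = {X \<in> L2_space B \<sigma>. L2_norm \<sigma> X \<le> 1}"

definition L2_opnorm ::
    "('h :: complex_inner \<Rightarrow>\<^sub>L 'h) set \<Rightarrow> (('h \<Rightarrow>\<^sub>L 'h) \<Rightarrow> complex)
      \<Rightarrow> (('h \<Rightarrow>\<^sub>L 'h) \<Rightarrow> ('h \<Rightarrow>\<^sub>L 'h)) \<Rightarrow> real" where
  "L2_opnorm B \<sigma> \<Phi> = (SUP X\<in>L2_unit_ball B \<sigma>. L2_norm \<sigma> (L2_ext B \<sigma> \<Phi> X))"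

definition L2_compact ::
    "('h :: complex_inner \<Rightarrow>\<^sub>L 'h) set \<Rightarrow> (('h \<Rightarrow>\<^sub>L 'h) \<Rightarrow> complex)
      \<Rightarrow> (('h \<Rightarrow>\<^sub>L 'h) \<Rightarrow> ('h \<Rightarrow>\<^sub>L 'h)) \<Rightarrow> bool" where
  "L2_compact B \<sigma> \<Phi> \<longleftrightarrow> L2_bounded B \<sigma> \<Phi> \<and>
     (let L2_top = Metric_space.mtopology (L2_space B \<sigma>) (L2_dist B \<sigma>)
      in compactin L2_top (L2_top closure_of (L2_ext B \<sigma> \<Phi> ` L2_unit_ball B \<sigma>)))"

section \<open>Nets\<close>

definition directed_set :: "'i set \<Rightarrow> ('i \<Rightarrow> 'i \<Rightarrow> bool) \<Rightarrow> bool" where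
  "directed_set I le \<longleftrightarrow> I \<noteq> {} \<and> (\<forall>i\<in>I. le i i) \<and>
     (\<forall>i\<in>I. \<forall>j\<in>I. \<forall>k\<in>I. le i j \<longrightarrow> le j k \<longrightarrow> le i k) \<and>
     (\<forall>i\<in>I. \<forall>j\<in>I. \<exists>k\<in>I. le i k \<and> le j k)"

definition net_filter :: "'i set \<Rightarrow> ('i \<Rightarrow> 'i \<Rightarrow> bool) \<Rightarrow> 'i filter" where
  "net_filter I le = (INF i\<in>I. principal {j \<in> I. le i j})"

text \<open>
  HOL cannot quantify existentially over the type of the indices of a net. For nets of elements
  of type \<^typ>\<open>'m\<close> the following index type suffices, as shown by the lemma
  \<open>net_index_universal\<close> below: every net, with indices from any type whatsoever, can be
  re-indexed over it without changing its members or its convergence.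
\<close>

type_synonym 'm net_index = "'m set \<times> 'm"

lemma eventually_net_filter:
  assumes "directed_set I le"
  shows "eventually P (net_filter I le) \<longleftrightarrow> (\<exists>i\<in>I. \<forall>j\<in>I. le i j \<longrightarrow> P j)"
proof -
  have "eventually P (net_filter I le) \<longleftrightarrow> (\<exists>i\<in>I. eventually P (principal {j \<in> I. le i j}))"
    unfolding net_filter_def
  proof (rule eventually_INF_base)
    show "I \<noteq> {}" using assms by (simp add: directed_set_def)
    fix i j assume ij: "i \<in> I" "j \<in> I"
    then obtain k where "k \<in> I" "le i k" "le j k"
      using assms unfolding directed_set_def by blast
    with ij have "{l \<in> I. le k l} \<subseteq> {l \<in> I. le i l} \<inter> {l \<in> I. le j l}"
      using assms unfolding directed_set_def by blast
    with \<open>k \<in> I\<close> show "\<exists>x\<in>I. principal {j \<in> I. le x j}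
        \<le> inf (principal {j \<in> I. le i j}) (principal {k \<in> I. le j k})"
      by (intro bexI[of _ k]) auto
  qed
  then show ?thesis by (auto simp: eventually_principal)
qed

lemma net_index_universal:
  fixes I :: "'i set" and \<Phi> :: "'i \<Rightarrow> 'm"
  assumes I: "directed_set I le"
  obtains J :: "'m net_index set" and le' \<Psi> where
    "directed_set J le'" "\<Psi> ` J = \<Phi> ` I"
    "filtermap \<Psi> (net_filter J le') = filtermap \<Phi> (net_filter I le)"
proof -
  define tail where "tail i = \<Phi> ` {j \<in> I. le i j}" for i
  define J where "J = {(T, m). \<exists>i\<in>I. T = tail i \<and> m \<in> T}"
  define le' where "le' p q \<longleftrightarrow> fst q \<subseteq> fst p" for p q :: "'m net_index"
  have refl: "le i i" if "i \<in> I" for i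
    using I that unfolding directed_set_def by blast
  have tail_mem: "\<Phi> i \<in> tail i" if "i \<in> I" for i
    using refl[OF that] that unfolding tail_def by blast
  have inJ: "(tail i, \<Phi> i) \<in> J" if "i \<in> I" for i
    using tail_mem[OF that] that unfolding J_def by blast
  have J: "directed_set J le'"
    unfolding directed_set_def
  proof (intro conjI ballI impI)
    show "J \<noteq> {}" using I inJ unfolding directed_set_def by blast
    fix p q assume pq: "p \<in> J" "q \<in> J"
    from pq obtain i j where ij: "i \<in> I" "j \<in> I" "fst p = tail i" "fst q = tail j"
      unfolding J_def by auto
    then obtain k where k: "k \<in> I" "le i k" "le j k"
      using I unfolding directed_set_def by blast
    have "tail k \<subseteq> tail i \<inter> tail j"
      using I ij k unfolding directed_set_def tail_def by blast
    then show "\<exists>r\<in>J. le' p r \<and> le' q r"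
      using inJ[OF k(1)] ij unfolding le'_def by (intro bexI[of _ "(tail k, \<Phi> k)"]) auto
  qed (auto simp: le'_def)
  have img: "snd ` J = \<Phi> ` I"
  proof
    show "snd ` J \<subseteq> \<Phi> ` I" unfolding J_def tail_def by auto
    show "\<Phi> ` I \<subseteq> snd ` J" using inJ by force
  qed
  have "filtermap snd (net_filter J le') = filtermap \<Phi> (net_filter I le)"
  proof (rule filter_eqI)
    fix P :: "'m \<Rightarrow> bool"
    have "(\<exists>p\<in>J. \<forall>q\<in>J. le' p q \<longrightarrow> P (snd q)) \<longleftrightarrow> (\<exists>i\<in>I. \<forall>j\<in>I. le i j \<longrightarrow> P (\<Phi> j))"
    proof
      assume "\<exists>p\<in>J. \<forall>q\<in>J. le' p q \<longrightarrow> P (snd q)"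
      then obtain p where p: "p \<in> J" "\<And>q. q \<in> J \<Longrightarrow> le' p q \<Longrightarrow> P (snd q)" by blast
      from p(1) obtain i where i: "i \<in> I" "fst p = tail i" unfolding J_def by auto
      have "P (\<Phi> j)" if j: "j \<in> I" "le i j" for j
      proof -
        have "tail j \<subseteq> tail i" using I i j unfolding directed_set_def tail_def by blast
        then show ?thesis using p(2)[OF inJ[OF j(1)]] i(2) by (simp add: le'_def)
      qed
      with i(1) show "\<exists>i\<in>I. \<forall>j\<in>I. le i j \<longrightarrow> P (\<Phi> j)" by blast
    next
      assume "\<exists>i\<in>I. \<forall>j\<in>I. le i j \<longrightarrow> P (\<Phi> j)"
      then obtain i where i: "i \<in> I" "\<And>j. j \<in> I \<Longrightarrow> le i j \<Longrightarrow> P (\<Phi> j)" by blast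
      have "P (snd q)" if q: "q \<in> J" "le' (tail i, \<Phi> i) q" for q
      proof -
        have "snd q \<in> tail i" using q unfolding J_def le'_def by auto
        then show ?thesis using i(2) unfolding tail_def by auto
      qed
      with inJ[OF i(1)] show "\<exists>p\<in>J. \<forall>q\<in>J. le' p q \<longrightarrow> P (snd q)" by blast
    qed
    then show "eventually P (filtermap snd (net_filter J le'))
        \<longleftrightarrow> eventually P (filtermap \<Phi> (net_filter I le))"
      by (simp add: eventually_filtermap eventually_net_filter[OF J] eventually_net_filter[OF I])
  qed
  with J img that show thesis by blast
qed

section \<open>The Haagerup property of a C*-algebra\<close>

definition cstar_haagerup ::
    "('h :: chilbert_space \<Rightarrow>\<^sub>L 'h) set \<Rightarrow> (('h \<Rightarrow>\<^sub>L 'h) \<Rightarrow> complex) \<Rightarrow> bool" where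
  "cstar_haagerup B \<sigma> \<longleftrightarrow>
     (\<exists>(I :: (('h \<Rightarrow>\<^sub>L 'h) \<Rightarrow> ('h \<Rightarrow>\<^sub>L 'h)) net_index set) le \<Phi>.
        directed_set I le \<and>
        (\<forall>i\<in>I. completely_positive B (\<Phi> i) \<and> unital_map (\<Phi> i) \<and>
           trace_decreasing B \<sigma> (\<Phi> i) \<and> L2_compact B \<sigma> (\<Phi> i)) \<and>
        (\<forall>x\<in>B. ((\<lambda>i. norm2 \<sigma> (\<Phi> i x - x)) \<longlongrightarrow> 0) (net_filter I le)))"

section \<open>Reduced crossed products\<close>

text \<open>
  The discrete group is a type of class \<^class>\<open>group_add\<close>, which comprises all groups,
  commutative or not; the group operation is thus written additively, with unit \<open>0\<close>.
\<close>

definition star_automorphism ::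
    "('h :: chilbert_space \<Rightarrow>\<^sub>L 'h) set \<Rightarrow> (('h \<Rightarrow>\<^sub>L 'h) \<Rightarrow> ('h \<Rightarrow>\<^sub>L 'h)) \<Rightarrow> bool" where
  "star_automorphism A \<phi> \<longleftrightarrow> bij_betw \<phi> A A \<and> linear_on A \<phi> \<and>
     (\<forall>a\<in>A. \<forall>b\<in>A. \<phi> (a o\<^sub>L b) = \<phi> a o\<^sub>L \<phi> b) \<and> (\<forall>a\<in>A. \<phi> (adj a) = adj (\<phi> a))"

definition cstar_dynamical_system ::
    "('h :: chilbert_space \<Rightarrow>\<^sub>L 'h) set \<Rightarrow> ('g :: group_add \<Rightarrow> ('h \<Rightarrow>\<^sub>L 'h) \<Rightarrow> ('h \<Rightarrow>\<^sub>L 'h)) \<Rightarrow> bool" where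
  "cstar_dynamical_system A \<alpha> \<longleftrightarrow> unital_cstar_algebra A \<and>
     (\<forall>t. star_automorphism A (\<alpha> t)) \<and> (\<forall>s t. \<forall>a\<in>A. \<alpha> (s + t) a = \<alpha> s (\<alpha> t a))"

lemma sqsum_translate:
  fixes f :: "'g :: group_add \<Rightarrow> 'h :: complex_inner"
  shows "(\<lambda>s. (norm (f (t + s)))\<^sup>2) summable_on UNIV \<longleftrightarrow> (\<lambda>s. (norm (f s))\<^sup>2) summable_on UNIV"
    "(\<Sum>\<^sub>\<infinity>s. (norm (f (t + s)))\<^sup>2) = (\<Sum>\<^sub>\<infinity>s. (norm (f s))\<^sup>2)"
proof -
  have bij: "bij_betw (\<lambda>s. t + s) UNIV UNIV"
    by (rule bij_betwI[where g = "\<lambda>s. - t + s"]) (auto simp: add.assoc[symmetric])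
  show "(\<lambda>s. (norm (f (t + s)))\<^sup>2) summable_on UNIV \<longleftrightarrow> (\<lambda>s. (norm (f s))\<^sup>2) summable_on UNIV"
    by (rule summable_on_reindex_bij_betw[OF bij])
  show "(\<Sum>\<^sub>\<infinity>s. (norm (f (t + s)))\<^sup>2) = (\<Sum>\<^sub>\<infinity>s. (norm (f s))\<^sup>2)"
    by (rule infsum_reindex_bij_betw[OF bij])
qed

lift_definition shift_ell2 ::
    "'g :: group_add \<Rightarrow> ('g, 'h :: complex_inner) ell2 \<Rightarrow> ('g, 'h) ell2"
  is "\<lambda>t f s. f (- t + s)"
  by (simp only: sqsum_translate)

lift_definition left_translation ::
    "'g :: group_add \<Rightarrow> ('g, 'h :: complex_inner) ell2 \<Rightarrow>\<^sub>L ('g, 'h) ell2"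
  is shift_ell2
proof (rule bounded_linear_intro[where K = 1])
  fix t :: 'g and x y :: "('g, 'h) ell2" and r :: real
  show "shift_ell2 t (x + y) = shift_ell2 t x + shift_ell2 t y"
    "shift_ell2 t (r *\<^sub>R x) = r *\<^sub>R shift_ell2 t x"
    by (transfer; simp)+
  show "norm (shift_ell2 t x) \<le> norm x * 1"
    by transfer (simp add: sqsum_translate)
qed

text \<open>
  \<^const>\<open>Blinfun\<close> and \<^const>\<open>Abs_ell2\<close> are applied within their intended domains
  for \<open>a \<in> A\<close>, since automorphisms of C*-algebras are isometric.
\<close>

definition rep_pi ::
    "('g :: group_add \<Rightarrow> ('h :: chilbert_space \<Rightarrow>\<^sub>L 'h) \<Rightarrow> ('h \<Rightarrow>\<^sub>L 'h))
      \<Rightarrow> ('h \<Rightarrow>\<^sub>L 'h) \<Rightarrow> (('g, 'h) ell2 \<Rightarrow>\<^sub>L ('g, 'h) ell2)" where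
  "rep_pi \<alpha> a = Blinfun (\<lambda>\<xi>. Abs_ell2 (\<lambda>s. blinfun_apply (\<alpha> (- s) a) (ell2_apply \<xi> s)))"

definition l1_functions :: "('h :: chilbert_space \<Rightarrow>\<^sub>L 'h) set \<Rightarrow> ('g \<Rightarrow> 'h \<Rightarrow>\<^sub>L 'h) set" where
  "l1_functions A = {f. range f \<subseteq> A \<and> (\<lambda>s. norm (f s)) summable_on UNIV}"

definition pi_tilde ::
    "('g :: group_add \<Rightarrow> ('h :: chilbert_space \<Rightarrow>\<^sub>L 'h) \<Rightarrow> ('h \<Rightarrow>\<^sub>L 'h))
      \<Rightarrow> ('g \<Rightarrow> 'h \<Rightarrow>\<^sub>L 'h) \<Rightarrow> (('g, 'h) ell2 \<Rightarrow>\<^sub>L ('g, 'h) ell2)" where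
  "pi_tilde \<alpha> f = (\<Sum>\<^sub>\<infinity>s. rep_pi \<alpha> (f s) o\<^sub>L left_translation s)"

definition crossed_product ::
    "('h :: chilbert_space \<Rightarrow>\<^sub>L 'h) set \<Rightarrow> ('g :: group_add \<Rightarrow> ('h \<Rightarrow>\<^sub>L 'h) \<Rightarrow> ('h \<Rightarrow>\<^sub>L 'h))
      \<Rightarrow> (('g, 'h) ell2 \<Rightarrow>\<^sub>L ('g, 'h) ell2) set" where
  "crossed_product A \<alpha> = closure (pi_tilde \<alpha> ` l1_functions A)"

text \<open>
  The stated conditions determine the expectation uniquely on the crossed product, since the
  operators \<open>\<pi>(a) \<lambda>\<^sub>s\<close> span a dense subspace of it.
\<close>

definition cond_expectation ::
    "('h :: chilbert_space \<Rightarrow>\<^sub>L 'h) set \<Rightarrow> ('g :: group_add \<Rightarrow> ('h \<Rightarrow>\<^sub>L 'h) \<Rightarrow> ('h \<Rightarrow>\<^sub>L 'h))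
      \<Rightarrow> (('g, 'h) ell2 \<Rightarrow>\<^sub>L ('g, 'h) ell2) \<Rightarrow> ('h \<Rightarrow>\<^sub>L 'h)" where
  "cond_expectation A \<alpha> = (SOME E.
     E ` crossed_product A \<alpha> \<subseteq> A \<and> linear_on (crossed_product A \<alpha>) E \<and>
     (\<forall>x\<in>crossed_product A \<alpha>. norm (E x) \<le> norm x) \<and>
     (\<forall>a\<in>A. \<forall>s. E (rep_pi \<alpha> a o\<^sub>L left_translation s) = (if s = 0 then a else 0)))"

definition induced_trace ::
    "('h :: chilbert_space \<Rightarrow>\<^sub>L 'h) set \<Rightarrow> ('g :: group_add \<Rightarrow> ('h \<Rightarrow>\<^sub>L 'h) \<Rightarrow> ('h \<Rightarrow>\<^sub>L 'h))
      \<Rightarrow> (('h \<Rightarrow>\<^sub>L 'h) \<Rightarrow> complex) \<Rightarrow> (('g, 'h) ell2 \<Rightarrow>\<^sub>L ('g, 'h) ell2) \<Rightarrow> complex" where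
  "induced_trace A \<alpha> \<tau> = \<tau> \<circ> cond_expectation A \<alpha>"

section \<open>Herz-Schur multipliers\<close>

definition multiplies_by ::
    "('h :: chilbert_space \<Rightarrow>\<^sub>L 'h) set \<Rightarrow> ('g :: group_add \<Rightarrow> ('h \<Rightarrow>\<^sub>L 'h) \<Rightarrow> ('h \<Rightarrow>\<^sub>L 'h))
      \<Rightarrow> ('g \<Rightarrow> ('h \<Rightarrow>\<^sub>L 'h) \<Rightarrow> ('h \<Rightarrow>\<^sub>L 'h))
      \<Rightarrow> ((('g, 'h) ell2 \<Rightarrow>\<^sub>L ('g, 'h) ell2) \<Rightarrow> (('g, 'h) ell2 \<Rightarrow>\<^sub>L ('g, 'h) ell2)) \<Rightarrow> bool" where
  "multiplies_by A \<alpha> F S \<longleftrightarrow>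
     (\<forall>f\<in>l1_functions A. S (pi_tilde \<alpha> f) = pi_tilde \<alpha> (\<lambda>t. F t (f t)))"

definition herz_schur_multiplier ::
    "('h :: chilbert_space \<Rightarrow>\<^sub>L 'h) set \<Rightarrow> ('g :: group_add \<Rightarrow> ('h \<Rightarrow>\<^sub>L 'h) \<Rightarrow> ('h \<Rightarrow>\<^sub>L 'h))
      \<Rightarrow> ('g \<Rightarrow> ('h \<Rightarrow>\<^sub>L 'h) \<Rightarrow> ('h \<Rightarrow>\<^sub>L 'h)) \<Rightarrow> bool" where
  "herz_schur_multiplier A \<alpha> F \<longleftrightarrow>
     (\<forall>t. completely_bounded A (F t)) \<and> (\<exists>C. \<forall>t. cb_norm_le A (F t) C) \<and>
     (\<exists>S. multiplies_by A \<alpha> F S \<and> completely_bounded (pi_tilde \<alpha> ` l1_functions A) S)"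

text \<open>
  The map \<open>S\<^sub>F\<close>, extended to the whole crossed product, on which it is uniquely determined.
\<close>

definition herz_schur_map ::
    "('h :: chilbert_space \<Rightarrow>\<^sub>L 'h) set \<Rightarrow> ('g :: group_add \<Rightarrow> ('h \<Rightarrow>\<^sub>L 'h) \<Rightarrow> ('h \<Rightarrow>\<^sub>L 'h))
      \<Rightarrow> ('g \<Rightarrow> ('h \<Rightarrow>\<^sub>L 'h) \<Rightarrow> ('h \<Rightarrow>\<^sub>L 'h))
      \<Rightarrow> (('g, 'h) ell2 \<Rightarrow>\<^sub>L ('g, 'h) ell2) \<Rightarrow> (('g, 'h) ell2 \<Rightarrow>\<^sub>L ('g, 'h) ell2)" where
  "herz_schur_map A \<alpha> F =
     (SOME S. multiplies_by A \<alpha> F S \<and> completely_bounded (crossed_product A \<alpha>) S)"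

definition cp_herz_schur_multiplier ::
    "('h :: chilbert_space \<Rightarrow>\<^sub>L 'h) set \<Rightarrow> ('g :: group_add \<Rightarrow> ('h \<Rightarrow>\<^sub>L 'h) \<Rightarrow> ('h \<Rightarrow>\<^sub>L 'h))
      \<Rightarrow> ('g \<Rightarrow> ('h \<Rightarrow>\<^sub>L 'h) \<Rightarrow> ('h \<Rightarrow>\<^sub>L 'h)) \<Rightarrow> bool" where
  "cp_herz_schur_multiplier A \<alpha> F \<longleftrightarrow>
     herz_schur_multiplier A \<alpha> F \<and> completely_positive (crossed_product A \<alpha>) (herz_schur_map A \<alpha> F)"

section \<open>The Haagerup property of a C*-dynamical system\<close>

definition system_haagerup ::
    "('h :: chilbert_space \<Rightarrow>\<^sub>L 'h) set \<Rightarrow> ('g :: group_add \<Rightarrow> ('h \<Rightarrow>\<^sub>L 'h) \<Rightarrow> ('h \<Rightarrow>\<^sub>L 'h))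
      \<Rightarrow> (('h \<Rightarrow>\<^sub>L 'h) \<Rightarrow> complex) \<Rightarrow> bool" where
  "system_haagerup A \<alpha> \<tau> \<longleftrightarrow>
     (\<exists>(I :: ('g \<Rightarrow> ('h \<Rightarrow>\<^sub>L 'h) \<Rightarrow> ('h \<Rightarrow>\<^sub>L 'h)) net_index set) le F.
        directed_set I le \<and>
        (\<forall>i\<in>I. cp_herz_schur_multiplier A \<alpha> (F i) \<and>
           unital_map (F i 0) \<and> trace_decreasing A \<tau> (F i 0) \<and>
           (\<forall>t. L2_compact A \<tau> (F i t)) \<and>
           ((\<lambda>s. L2_opnorm A \<tau> (F i s)) \<longlongrightarrow> 0) cofinite) \<and>
        (\<forall>t. \<forall>a\<in>A. ((\<lambda>i. norm2 \<tau> (F i t a - a)) \<longlongrightarrow> 0) (net_filter I le)))"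

end

theory Submission
  imports Defs
begin

text \<open>
  The equivalence rests on two constructions. A completely positive multiplier \<open>F\<close> induces the map
  \<open>S\<^sub>F\<close> of the crossed product, and a unital completely positive map \<open>\<Phi>\<close> of the crossed product
  yields the multiplier \<open>F(t)(a) = \<E>(\<Phi>(\<pi>(a) \<lambda>\<^sub>t) \<lambda>\<^sub>t\<^sup>*)\<close>. Because the trace is invariant, \<open>L\<^sup>2\<close> of the
  crossed product is the orthogonal sum over \<open>t \<in> G\<close> of copies of \<open>L\<^sup>2(A, \<tau>)\<close>, spanned by the
  elements \<open>\<pi>(a) \<lambda>\<^sub>t\<close> (lemmas \<open>parseval\<close> and \<open>bessel\<close>), and the first construction places the
  operators of the maps \<open>F(t)\<close> on the diagonal, while the second takes the diagonal blocks of an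
  operator.

  A block diagonal operator whose blocks are compact with norms vanishing at infinity is compact
  (\<open>S_L2_compact\<close>). By the Kadison--Schwarz inequality, unital completely positive maps that do not
  increase the trace are contractions for the \<open>L\<^sup>2\<close>-seminorm (\<open>L2_contraction\<close>), so convergence
  on finite sums of monomials \<open>\<pi>(a) \<lambda>\<^sub>t\<close> implies convergence everywhere. This gives one
  implication. Conversely, the diagonal blocks of a compact operator are compact and, by Bessel's
  inequality, their norms vanish at infinity (\<open>coeff_map_vanishes\<close>).

  The remaining point is that the blocks of \<open>\<Phi>\<close> form a completely positive multiplier
  (\<open>coeff_map_multiplier\<close>). Conceptually, the induced map is a compression of \<open>\<Phi> \<otimes> id\<close> composed
  with the dual coaction \<open>\<pi>(a) \<lambda>\<^sub>t \<mapsto> \<pi>(a) \<lambda>\<^sub>t \<otimes> \<lambda>\<^sub>t\<close>. Instead of tensor products, the proof uses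
  matrix entries with respect to \<open>\<ell>\<^sup>2(G, H)\<close>. Every \<open>x\<close> in the crossed product is determined by its
  Fourier coefficients \<open>\<E>(x \<lambda>\<^sub>t\<^sup>*)\<close> through an equivariance of its entries (\<open>entry_B\<close>). On vectors
  supported in a finite set \<open>K\<close>, the quadratic form of the image of \<open>x\<close> is then a value of the
  quadratic form of the matrix over \<open>K \<times> K\<close> that arises by applying \<open>\<Phi>\<close> to the entries of the dual
  coaction of \<open>x\<close> (\<open>coeff_map_positive\<close>), and this matrix is positive for positive \<open>x\<close>
  (\<open>dual_positive\<close>). Complete boundedness is not a separate issue, since unital completely positive
  maps are completely contractive (\<open>completely_positive_unital_contractive\<close>).

  Two general facts support this. Automorphisms of a C*-algebra are completely contractive
  (\<open>star_automorphism_contractive\<close>), which makes \<open>\<pi>(a)\<close> well defined and bounds its matrix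
  amplifications; the square roots needed for it come from Banach's fixed point theorem. And a map
  is \<open>L\<^sup>2\<close>-compact iff it is \<open>L\<^sup>2\<close>-bounded and the image of the unit ball of the algebra is totally
  bounded in the seminorm (\<open>L2_compact_iff\<close>), so that the completion itself does not enter the main
  argument.
\<close>

section \<open>Hilbert spaces and adjoints\<close>

lemma scaleC_one [simp]: "1 *\<^sub>C x = (x :: 'v :: complex_vector)"
  using scaleR_scaleC[of 1 x] by simp

lemma scaleC_zero_left [simp]: "0 *\<^sub>C x = (0 :: 'v :: complex_vector)"
  using scaleR_scaleC[of 0 x] by simp

lemma scaleC_zero_right [simp]: "c *\<^sub>C (0 :: 'v :: complex_vector) = 0"
  using scaleC_add_right[of c "0 :: 'v" 0] by simp

lemma scaleC_sum_right: "c *\<^sub>C (\<Sum>i\<in>I. f i) = (\<Sum>i\<in>I. c *\<^sub>C (f i :: 'v :: complex_vector))"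
  by (induction I rule: infinite_finite_induct) (auto simp: scaleC_add_right)

lemma bounded_bilinear_cinner:
  "bounded_bilinear (cinner :: 'h :: complex_inner \<Rightarrow> 'h \<Rightarrow> complex)"
proof
  fix x x' y y' :: 'h and r :: real
  show "cinner (x + x') y = cinner x y + cinner x' y" by (rule cinner_add_left)
  show "cinner x (y + y') = cinner x y + cinner x y'" by (rule cinner_add_right)
  show "cinner (r *\<^sub>R x) y = r *\<^sub>R cinner x y"
    by (simp add: scaleR_scaleC[of r x] cinner_scaleC_left scaleR_conv_of_real)
  show "cinner x (r *\<^sub>R y) = r *\<^sub>R cinner x y"
    by (simp add: scaleR_scaleC[of r y] cinner_scaleC_right scaleR_conv_of_real)
  show "\<exists>K. \<forall>a b :: 'h. norm (cinner a b) \<le> norm a * norm b * K"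
    using cinner_Cauchy_Schwarz by (intro exI[of _ 1]) auto
qed

interpretation cinner: bounded_bilinear "cinner :: 'h :: complex_inner \<Rightarrow> 'h \<Rightarrow> complex"
  by (rule bounded_bilinear_cinner)

lemma cinner_ext:
  assumes "\<And>y. cinner x y = cinner x' (y :: 'h :: complex_inner)"
  shows "x = x'"
proof -
  have "cinner (x - x') (x - x') = 0" by (simp add: cinner.diff_left assms)
  then show ?thesis by (simp add: cinner_self)
qed

text \<open>Testing with \<open>c = 1\<close> and \<open>c = \<i>\<close> shows that the form is hermitian; the rest is the
  discriminant of a real quadratic polynomial. All norm estimates below that start from the
  positivity of a block matrix of operators go through this inequality, applied to its
  off-diagonal entry.\<close>

lemma positive_form_off_diagonal:
  fixes f g :: complex and p q :: real
  assumes pos: "\<And>c. complex_of_real p + c * f + cnj c * g + complex_of_real ((cmod c)\<^sup>2 * q) \<in> \<real>\<^sub>\<ge>\<^sub>0"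
    and q: "0 \<le> q"
  shows "(cmod f)\<^sup>2 \<le> p * q"
proof -
  have "Im (f + g) = 0" using pos[of 1] by (simp add: complex_nonneg_Reals_iff)
  moreover have "Re f = Re g" using pos[of \<i>] by (simp add: complex_nonneg_Reals_iff)
  ultimately have g: "g = cnj f" by (simp add: complex_eq_iff)
  have ff: "f * cnj f = complex_of_real ((cmod f)\<^sup>2)" by (rule complex_norm_square[symmetric])
  \<comment> \<open>The phase of \<open>c = - t f\<^sup>*\<close> makes both off-diagonal terms equal to \<open>- t |f|\<^sup>2\<close>.\<close>
  have quad: "0 \<le> p - 2 * t * (cmod f)\<^sup>2 + t\<^sup>2 * (cmod f)\<^sup>2 * q" for t :: real
  proof -
    have "complex_of_real p + (- of_real t * cnj f) * f + cnj (- of_real t * cnj f) * g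
        + complex_of_real ((cmod (- of_real t * cnj f))\<^sup>2 * q)
      = complex_of_real p - 2 * of_real t * (f * cnj f) + complex_of_real (t\<^sup>2 * (cmod f)\<^sup>2 * q)"
      by (simp add: g norm_mult power_mult_distrib algebra_simps)
    also have "\<dots> = complex_of_real (p - 2 * t * (cmod f)\<^sup>2 + t\<^sup>2 * (cmod f)\<^sup>2 * q)"
      by (simp only: ff) simp
    finally have eq: "complex_of_real p + (- of_real t * cnj f) * f + cnj (- of_real t * cnj f) * g
        + complex_of_real ((cmod (- of_real t * cnj f))\<^sup>2 * q)
      = complex_of_real (p - 2 * t * (cmod f)\<^sup>2 + t\<^sup>2 * (cmod f)\<^sup>2 * q)" .
    show ?thesis using pos[of "- of_real t * cnj f"] unfolding eq by (simp only: nonneg_Reals_of_real_iff)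
  qed
  show ?thesis
  proof (cases "q = 0")
    case True
    have "cmod f = 0"
    proof (rule ccontr)
      assume "cmod f \<noteq> 0"
      then have "(cmod f)\<^sup>2 > 0" by simp
      moreover have "0 \<le> p" using quad[of 0] by simp
      ultimately show False
        using quad[of "(p + 1) / (cmod f)\<^sup>2"] True by simp
    qed
    then show ?thesis using True by simp
  next
    case False
    then have "q > 0" using q by simp
    then show ?thesis using quad[of "1 / q"] by (simp add: field_simps power2_eq_square)
  qed
qed

lemma is_adjointD: "is_adjoint b a \<Longrightarrow> cinner (blinfun_apply b x) y = cinner x (blinfun_apply a y)"
  by (simp add: is_adjoint_def)

lemma is_adjoint_sym: "is_adjoint b a \<Longrightarrow> is_adjoint a b"
  unfolding is_adjoint_def by (metis cinner_commute)

lemma is_adjoint_unique: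
  assumes "is_adjoint b a" "is_adjoint b' a" shows "b = b'"
  by (rule blinfun_eqI, rule cinner_ext) (simp add: is_adjointD[OF assms(1)] is_adjointD[OF assms(2)])

lemma adj_eqI: "is_adjoint b a \<Longrightarrow> adj a = b"
  unfolding adj_def using is_adjoint_unique by blast

lemma is_adjoint_compose:
  "is_adjoint b a \<Longrightarrow> is_adjoint d c \<Longrightarrow> is_adjoint (d o\<^sub>L b) (a o\<^sub>L c)"
  by (simp add: is_adjoint_def)

lemma is_adjoint_add: "is_adjoint b a \<Longrightarrow> is_adjoint d c \<Longrightarrow> is_adjoint (b + d) (a + c)"
  by (simp add: is_adjoint_def blinfun.add_left cinner_add_left cinner_add_right)

lemma is_adjoint_diff: "is_adjoint b a \<Longrightarrow> is_adjoint d c \<Longrightarrow> is_adjoint (b - d) (a - c)"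
  by (simp add: is_adjoint_def blinfun.diff_left cinner.diff_left cinner.diff_right)

lemma is_adjoint_zero: "is_adjoint 0 0"
  by (simp add: is_adjoint_def cinner.zero_left cinner.zero_right)

lemma is_adjoint_scaleC: "is_adjoint b a \<Longrightarrow> is_adjoint (cnj c *\<^sub>C b) (c *\<^sub>C a)"
  by (simp add: is_adjoint_def scaleC_blinfun.rep_eq cinner_scaleC_left cinner_scaleC_right)

lemma is_adjoint_sum:
  "(\<And>i. i \<in> I \<Longrightarrow> is_adjoint (b i) (a i)) \<Longrightarrow> is_adjoint (\<Sum>i\<in>I. b i) (\<Sum>i\<in>I. a i)"
  by (induction I rule: infinite_finite_induct) (auto intro: is_adjoint_add is_adjoint_zero)

text \<open>From \<open>\<parallel>b x\<parallel>\<^sup>2 = \<langle>x, a b x\<rangle>\<close>.\<close>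

lemma norm_is_adjoint_le:
  assumes "is_adjoint b a" shows "norm b \<le> norm a"
proof (rule norm_blinfun_bound)
  fix x
  have "(norm (b x))\<^sup>2 = cmod (cinner (b x) (b x))" by (simp add: cinner_self norm_power)
  also have "\<dots> = cmod (cinner x (a (b x)))" by (simp add: is_adjointD[OF assms])
  also have "\<dots> \<le> norm x * (norm a * norm (b x))"
    by (rule order_trans[OF cinner_Cauchy_Schwarz mult_left_mono[OF norm_blinfun]]) simp
  finally have "norm (b x) * norm (b x) \<le> norm a * norm x * norm (b x)"
    by (simp add: power2_eq_square mult_ac)
  then show "norm (b x) \<le> norm a * norm x"
    by (cases "norm (b x) = 0") (auto simp: mult_le_cancel_right)
qed simp

lemma is_adjoint_tendsto:
  assumes ab: "\<And>n :: nat. is_adjoint (b n) (a n)" and "a \<longlonglongrightarrow> a'" "b \<longlonglongrightarrow> b'"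
  shows "is_adjoint b' a'"
  unfolding is_adjoint_def
proof (intro allI)
  fix x y
  have "(\<lambda>n. cinner (b n x) y) \<longlonglongrightarrow> cinner (b' x) y"
    by (intro cinner.tendsto blinfun.tendsto assms tendsto_const)
  moreover have "(\<lambda>n. cinner (b n x) y) \<longlonglongrightarrow> cinner x (a' y)"
    unfolding is_adjointD[OF ab] by (intro cinner.tendsto blinfun.tendsto assms tendsto_const)
  ultimately show "cinner (b' x) y = cinner x (a' y)" by (rule LIMSEQ_unique)
qed

lemma blinfun_scaleC: "a \<in> bounded_operators \<Longrightarrow> blinfun_apply a (c *\<^sub>C x) = c *\<^sub>C blinfun_apply a x"
  by (simp add: bounded_operators_def)

lemma compose_scaleC_left: "(c *\<^sub>C a) o\<^sub>L b = c *\<^sub>C (a o\<^sub>L b)"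
  by (rule blinfun_eqI) (simp add: scaleC_blinfun.rep_eq)

lemma compose_scaleC_right: "a \<in> bounded_operators \<Longrightarrow> a o\<^sub>L (c *\<^sub>C b) = c *\<^sub>C (a o\<^sub>L b)"
  by (rule blinfun_eqI) (simp add: scaleC_blinfun.rep_eq blinfun_scaleC)

lemma norm_scaleC_blinfun: "norm (c *\<^sub>C (a :: 'a :: real_normed_vector \<Rightarrow>\<^sub>L 'b :: complex_inner)) = cmod c * norm a"
proof -
  have le: "norm (c *\<^sub>C a) \<le> cmod c * norm a" for c and a :: "'a \<Rightarrow>\<^sub>L 'b"
    by (rule norm_blinfun_bound)
      (auto simp: scaleC_blinfun.rep_eq norm_scaleC mult.assoc intro!: mult_left_mono norm_blinfun)
  show ?thesis
  proof (cases "c = 0")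
    case False
    have "norm (inverse c *\<^sub>C c *\<^sub>C a) \<le> cmod (inverse c) * norm (c *\<^sub>C a)" by (rule le)
    then have "norm a \<le> inverse (cmod c) * norm (c *\<^sub>C a)"
      using False by (simp add: scaleC_scaleC norm_inverse)
    then have "cmod c * norm a \<le> norm (c *\<^sub>C a)" using False by (simp add: field_simps)
    then show ?thesis using le[of c a] by simp
  qed simp
qed

lemma bounded_linear_scaleC_blinfun:
  "bounded_linear (\<lambda>a :: 'a :: real_normed_vector \<Rightarrow>\<^sub>L 'b :: complex_inner. c *\<^sub>C a)"
  by (rule bounded_linear_intro[where K = "cmod c"])
    (simp_all add: scaleC_add_right scaleR_scaleC scaleC_scaleC norm_scaleC_blinfun mult.commute)

lemma blinfun_compose_sum_left: "(\<Sum>i\<in>I. f i) o\<^sub>L g = (\<Sum>i\<in>I. f i o\<^sub>L g)"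
  by (rule blinfun_eqI) (simp add: blinfun.sum_left)

lemma blinfun_compose_sum_right: "g o\<^sub>L (\<Sum>i\<in>I. f i) = (\<Sum>i\<in>I. g o\<^sub>L f i)"
  by (rule blinfun_eqI) (simp add: blinfun.sum_left blinfun.sum_right)

section \<open>Coordinates in the space of square-summable functions\<close>

lift_definition coord :: "'g \<Rightarrow> ('g, 'h :: complex_inner) ell2 \<Rightarrow>\<^sub>L 'h" is "\<lambda>s \<xi>. ell2_apply \<xi> s"
  by (rule bounded_linear_intro[where K = 1])
    (simp_all add: plus_ell2.rep_eq scaleR_ell2.rep_eq norm_ell2_apply_le)

lemma sqsum_point:
  fixes h :: "'h :: complex_inner"
  shows "(\<lambda>t. (norm (if t = s then h else 0))\<^sup>2) summable_on UNIV"
proof -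
  have "(\<lambda>t. (norm (if t = s then h else 0))\<^sup>2) summable_on {s}" by simp
  then show "(\<lambda>t. (norm (if t = s then h else 0))\<^sup>2) summable_on UNIV"
    by (rule summable_on_cong_neutral[THEN iffD1, rotated -1]) auto
qed

lift_definition point_fun :: "'g \<Rightarrow> 'h :: complex_inner \<Rightarrow> ('g, 'h) ell2"
  is "\<lambda>s h t. if t = s then h else 0"
  by (rule sqsum_point)

lemma norm_point_fun:
  fixes h :: "'h :: complex_inner" and s :: 'g
  shows "norm (point_fun s h) = norm h"
proof transfer
  fix s :: 'g and h :: 'h
  have "(\<Sum>\<^sub>\<infinity>t. (norm (if t = s then h else 0))\<^sup>2) = (\<Sum>\<^sub>\<infinity>t\<in>{s}. (norm (if t = s then h else 0))\<^sup>2)"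
    by (rule infsum_cong_neutral) auto
  then show "sqrt (\<Sum>\<^sub>\<infinity>t. (norm (if t = s then h else 0))\<^sup>2) = norm h" by simp
qed

lift_definition point :: "'g \<Rightarrow> 'h :: complex_inner \<Rightarrow>\<^sub>L ('g, 'h) ell2" is point_fun
proof (rule bounded_linear_intro[where K = 1])
  fix s :: 'g and x y :: 'h and r :: real
  show "point_fun s (x + y) = point_fun s x + point_fun s y"
    "point_fun s (r *\<^sub>R x) = r *\<^sub>R point_fun s x"
    by (transfer; auto simp: fun_eq_iff)+
  show "norm (point_fun s x) \<le> norm x * 1" by (simp add: norm_point_fun)
qed

lemma ell2_eqI: "(\<And>s. ell2_apply \<xi> s = ell2_apply \<eta> s) \<Longrightarrow> \<xi> = \<eta>"
  by (metis ell2_apply_inject ext)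

lemma coord_apply: "blinfun_apply (coord s) \<xi> = ell2_apply \<xi> s"
  by (simp add: coord.rep_eq)

lemma ell2_apply_point [simp]: "ell2_apply (blinfun_apply (point s) h) t = (if t = s then h else 0)"
  by (simp add: point.rep_eq point_fun.rep_eq)

lemma norm_point [simp]: "norm (blinfun_apply (point s) h) = norm h"
  by (simp add: point.rep_eq norm_point_fun)

lemma ell2_apply_sum [simp]: "ell2_apply (\<Sum>i\<in>I. f i) s = (\<Sum>i\<in>I. ell2_apply (f i) s)"
  by (simp flip: coord_apply add: blinfun.sum_right)

lemma ell2_apply_scaleC: "ell2_apply (c *\<^sub>C \<xi>) s = c *\<^sub>C ell2_apply \<xi> s"
  by (simp add: scaleC_ell2.rep_eq)

lemma sqsum_ell2: "(\<lambda>s. (norm (ell2_apply \<xi> s))\<^sup>2) summable_on UNIV"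
  using ell2_apply by blast

lemma norm_ell2_has_sum: "((\<lambda>s. (norm (ell2_apply \<xi> s))\<^sup>2) has_sum (norm \<xi>)\<^sup>2) UNIV"
proof -
  have "(norm \<xi>)\<^sup>2 = (\<Sum>\<^sub>\<infinity>s. (norm (ell2_apply \<xi> s))\<^sup>2)"
    unfolding norm_ell2.rep_eq by (simp add: infsum_nonneg)
  then show ?thesis using has_sum_infsum[OF sqsum_ell2] by metis
qed

lemma norm_ell2_finite:
  assumes K: "finite K" and 0: "\<And>s. s \<notin> K \<Longrightarrow> ell2_apply \<xi> s = 0"
  shows "(norm \<xi>)\<^sup>2 = (\<Sum>s\<in>K. (norm (ell2_apply \<xi> s))\<^sup>2)"
proof -
  have "((\<lambda>s. (norm (ell2_apply \<xi> s))\<^sup>2) has_sum (\<Sum>s\<in>K. (norm (ell2_apply \<xi> s))\<^sup>2)) UNIV"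
    using has_sum_finite[OF K] by (rule has_sum_cong_neutral[THEN iffD1, rotated -1]) (auto simp: 0)
  then show ?thesis by (rule has_sum_unique[OF norm_ell2_has_sum])
qed

lemma cinner_ell2_has_sum:
  "((\<lambda>s. cinner (ell2_apply \<xi> s) (ell2_apply \<eta> s)) has_sum cinner \<xi> \<eta>) UNIV"
  unfolding cinner_ell2.rep_eq by (rule has_sum_infsum, rule summable_cinner) (rule sqsum_ell2)+

lemma cinner_point_right: "cinner \<xi> (blinfun_apply (point s) h) = cinner (ell2_apply \<xi> s) h"
proof -
  have "((\<lambda>t. cinner (ell2_apply \<xi> t) (ell2_apply (point s h) t)) has_sum cinner (ell2_apply \<xi> s) h) {s}"
    using has_sum_finite[of "{s}" "\<lambda>t. cinner (ell2_apply \<xi> t) (ell2_apply (point s h) t)"] by simp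
  then have "((\<lambda>t. cinner (ell2_apply \<xi> t) (ell2_apply (point s h) t)) has_sum cinner (ell2_apply \<xi> s) h) UNIV"
    by (rule has_sum_cong_neutral[THEN iffD1, rotated -1]) (auto simp: cinner.zero_right)
  then show ?thesis using cinner_ell2_has_sum infsumI by metis
qed

lemma cinner_point_left: "cinner (blinfun_apply (point s) h) \<xi> = cinner h (ell2_apply \<xi> s)"
  using cinner_point_right[of \<xi> s h] cinner_commute by metis

text \<open>The squared norm of the remainder is the tail of the convergent sum of squares. This
  approximation by vectors of finite support reduces the study of quadratic forms on the
  whole space to finite matrices.\<close>

lemma points_has_sum: "((\<lambda>s. blinfun_apply (point s) (ell2_apply \<xi> s)) has_sum \<xi>) UNIV"
proof -
  let ?q = "\<lambda>K. \<Sum>s\<in>K. (norm (ell2_apply \<xi> s))\<^sup>2"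
  have tail: "norm ((\<Sum>s\<in>K. point s (ell2_apply \<xi> s)) - \<xi>) = sqrt ((norm \<xi>)\<^sup>2 - ?q K)"
    if K: "finite K" for K
  proof -
    define \<eta> where "\<eta> = (\<Sum>s\<in>K. point s (ell2_apply \<xi> s)) - \<xi>"
    have \<eta>: "ell2_apply \<eta> t = (if t \<in> K then 0 else - ell2_apply \<xi> t)" for t
      using K by (simp add: \<eta>_def minus_ell2.rep_eq)
    have "((\<lambda>t. (norm (ell2_apply \<xi> t))\<^sup>2) has_sum ((norm \<xi>)\<^sup>2 - ?q K)) (UNIV - K)"
      by (rule has_sum_Diff[OF norm_ell2_has_sum has_sum_finite[OF K]]) simp
    then have "((\<lambda>t. (norm (ell2_apply \<eta> t))\<^sup>2) has_sum ((norm \<xi>)\<^sup>2 - ?q K)) UNIV"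
      by (rule has_sum_cong_neutral[THEN iffD1, rotated -1]) (auto simp: \<eta>)
    then have "(norm \<eta>)\<^sup>2 = (norm \<xi>)\<^sup>2 - ?q K"
      using norm_ell2_has_sum infsumI by metis
    then show ?thesis unfolding \<eta>_def[symmetric] by (metis norm_ge_zero real_sqrt_unique)
  qed
  have "((\<lambda>K. sqrt ((norm \<xi>)\<^sup>2 - ?q K)) \<longlongrightarrow> sqrt ((norm \<xi>)\<^sup>2 - (norm \<xi>)\<^sup>2)) (finite_subsets_at_top UNIV)"
    using norm_ell2_has_sum unfolding has_sum_def by (intro tendsto_intros) auto
  then have "((\<lambda>K. sqrt ((norm \<xi>)\<^sup>2 - ?q K)) \<longlongrightarrow> 0) (finite_subsets_at_top UNIV)"
    by simp
  then have "((\<lambda>K. norm ((\<Sum>s\<in>K. point s (ell2_apply \<xi> s)) - \<xi>)) \<longlongrightarrow> 0) (finite_subsets_at_top UNIV)"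
    by (rule Lim_transform_eventually) (rule eventually_finite_subsets_at_top_weakI, simp add: tail)
  then show ?thesis
    unfolding has_sum_def by (simp add: tendsto_norm_zero_iff LIM_zero_iff)
qed

section \<open>Norms of operator matrices\<close>

lemma opmat_norm_set_bdd:
  fixes b :: "nat \<Rightarrow> nat \<Rightarrow> 'h :: complex_inner \<Rightarrow>\<^sub>L 'h"
  shows "bdd_above {sqrt (\<Sum>i<n. (norm (\<Sum>j<n. blinfun_apply (b i j) (x j)))\<^sup>2) | x :: nat \<Rightarrow> 'h.
            (\<Sum>j<n. (norm (x j))\<^sup>2) \<le> 1}"
proof (rule bdd_aboveI, clarify)
  fix x :: "nat \<Rightarrow> 'h" assume x: "(\<Sum>j<n. (norm (x j))\<^sup>2) \<le> 1"
  have x1: "norm (x j) \<le> 1" if "j < n" for j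
  proof -
    have "(norm (x j))\<^sup>2 \<le> (\<Sum>j<n. (norm (x j))\<^sup>2)" using that by (intro member_le_sum) auto
    then have "(norm (x j))\<^sup>2 \<le> 1\<^sup>2" using x by simp
    then show ?thesis by (rule power2_le_imp_le) simp
  qed
  have "norm (\<Sum>j<n. b i j (x j)) \<le> (\<Sum>j<n. norm (b i j))" for i
  proof (rule order_trans[OF norm_sum sum_mono])
    fix j assume "j \<in> {..<n}"
    then have "norm (b i j) * norm (x j) \<le> norm (b i j) * 1" using x1 by (intro mult_left_mono) auto
    then show "norm (b i j (x j)) \<le> norm (b i j)"
      using norm_blinfun[of "b i j" "x j"] by simp
  qed
  then show "sqrt (\<Sum>i<n. (norm (\<Sum>j<n. b i j (x j)))\<^sup>2) \<le> sqrt (\<Sum>i<n. (\<Sum>j<n. norm (b i j))\<^sup>2)"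
    by (intro real_sqrt_le_mono sum_mono power_mono) auto
qed

lemma opmat_norm_nonneg [simp]: "0 \<le> opmat_norm n b"
proof -
  have "0 \<in> {sqrt (\<Sum>i<n. (norm (\<Sum>j<n. blinfun_apply (b i j) (x j)))\<^sup>2) | x :: nat \<Rightarrow> 'a.
            (\<Sum>j<n. (norm (x j))\<^sup>2) \<le> 1}"
    by (auto intro!: exI[of _ "\<lambda>_. 0"])
  then show ?thesis unfolding opmat_norm_def by (rule cSup_upper[OF _ opmat_norm_set_bdd])
qed

lemma opmat_norm_leI:
  fixes b :: "nat \<Rightarrow> nat \<Rightarrow> 'h :: complex_inner \<Rightarrow>\<^sub>L 'h"
  assumes "0 \<le> C"
    and le: "\<And>x. (\<Sum>i<n. (norm (\<Sum>j<n. blinfun_apply (b i j) (x j)))\<^sup>2) \<le> C\<^sup>2 * (\<Sum>j<n. (norm (x j))\<^sup>2)"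
  shows "opmat_norm n b \<le> C"
  unfolding opmat_norm_def
proof (rule cSup_least)
  show "{sqrt (\<Sum>i<n. (norm (\<Sum>j<n. blinfun_apply (b i j) (x j)))\<^sup>2) | x :: nat \<Rightarrow> 'h.
            (\<Sum>j<n. (norm (x j))\<^sup>2) \<le> 1} \<noteq> {}"
    by (auto intro!: exI[of _ "\<lambda>_. 0"])
next
  fix r assume "r \<in> {sqrt (\<Sum>i<n. (norm (\<Sum>j<n. blinfun_apply (b i j) (x j)))\<^sup>2) | x :: nat \<Rightarrow> 'h.
            (\<Sum>j<n. (norm (x j))\<^sup>2) \<le> 1}"
  then obtain x :: "nat \<Rightarrow> 'h" where r: "r = sqrt (\<Sum>i<n. (norm (\<Sum>j<n. b i j (x j)))\<^sup>2)"
    and x: "(\<Sum>j<n. (norm (x j))\<^sup>2) \<le> 1" by blast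
  have "(\<Sum>i<n. (norm (\<Sum>j<n. b i j (x j)))\<^sup>2) \<le> C\<^sup>2"
    using le[of x] mult_left_mono[OF x, of "C\<^sup>2"] by simp
  then show "r \<le> C" unfolding r using assms(1) by (intro real_le_lsqrt) (auto simp: sum_nonneg)
qed

lemma opmat_norm_bound:
  fixes b :: "nat \<Rightarrow> nat \<Rightarrow> 'h :: complex_inner \<Rightarrow>\<^sub>L 'h"
  shows "(\<Sum>i<n. (norm (\<Sum>j<n. blinfun_apply (b i j) (x j)))\<^sup>2)
    \<le> (opmat_norm n b)\<^sup>2 * (\<Sum>j<n. (norm (x j))\<^sup>2)"
proof -
  define S where "S = sqrt (\<Sum>j<n. (norm (x j))\<^sup>2)"
  have S: "S\<^sup>2 = (\<Sum>j<n. (norm (x j))\<^sup>2)" "0 \<le> S" by (simp_all add: S_def sum_nonneg)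
  show ?thesis
  proof (cases "S = 0")
    case True
    then have "\<And>j. j < n \<Longrightarrow> x j = 0" using S(1) by (simp add: sum_nonneg_eq_0_iff)
    then show ?thesis using S True by (simp add: blinfun.zero_right)
  next
    case False
    define y where "y j = (1 / S) *\<^sub>R x j" for j
    have y: "(\<Sum>j<n. (norm (y j))\<^sup>2) \<le> 1"
    proof -
      have "(\<Sum>j<n. (norm (y j))\<^sup>2) = (\<Sum>j<n. (norm (x j))\<^sup>2) / S\<^sup>2"
        by (simp add: y_def power_divide sum_divide_distrib)
      then show ?thesis using False S by simp
    qed
    have "sqrt (\<Sum>i<n. (norm (\<Sum>j<n. b i j (y j)))\<^sup>2) \<le> opmat_norm n b"
      unfolding opmat_norm_def by (rule cSup_upper[OF _ opmat_norm_set_bdd]) (use y in blast)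
    then have "(\<Sum>i<n. (norm (\<Sum>j<n. b i j (y j)))\<^sup>2) \<le> (opmat_norm n b)\<^sup>2"
      by (rule sqrt_le_D)
    moreover have "(\<Sum>i<n. (norm (\<Sum>j<n. b i j (y j)))\<^sup>2) = (\<Sum>i<n. (norm (\<Sum>j<n. b i j (x j)))\<^sup>2) / S\<^sup>2"
    proof -
      have "(\<Sum>j<n. b i j (y j)) = (1 / S) *\<^sub>R (\<Sum>j<n. b i j (x j))" for i
        by (simp add: y_def blinfun.scaleR_right scaleR_sum_right)
      then show ?thesis by (simp add: power_divide sum_divide_distrib)
    qed
    ultimately have "(\<Sum>i<n. (norm (\<Sum>j<n. b i j (x j)))\<^sup>2) / S\<^sup>2 \<le> (opmat_norm n b)\<^sup>2"
      by simp
    moreover have "0 < S\<^sup>2" using False by simp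
    ultimately show ?thesis unfolding S(1)[symmetric] by (simp add: pos_divide_le_eq)
  qed
qed

lemma opmat_norm_one: "opmat_norm 1 (\<lambda>_ _. a) = norm a"
proof (rule antisym)
  show "opmat_norm 1 (\<lambda>_ _. a) \<le> norm a"
  proof (rule opmat_norm_leI)
    fix x :: "nat \<Rightarrow> 'a"
    have "(norm (a (x 0)))\<^sup>2 \<le> (norm a * norm (x 0))\<^sup>2" by (intro power_mono norm_blinfun) simp
    then show "(\<Sum>i<1::nat. (norm (\<Sum>j<1::nat. blinfun_apply a (x j)))\<^sup>2) \<le> (norm a)\<^sup>2 * (\<Sum>j<1::nat. (norm (x j))\<^sup>2)"
      by (simp add: power_mult_distrib)
  qed simp
  show "norm a \<le> opmat_norm 1 (\<lambda>_ _. a)"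
  proof (rule norm_blinfun_bound)
    fix h
    have "(norm (a h))\<^sup>2 \<le> (opmat_norm 1 (\<lambda>_ _. a) * norm h)\<^sup>2"
      using opmat_norm_bound[of "\<lambda>_ _. a" "\<lambda>_. h" 1] by (simp add: power_mult_distrib)
    then show "norm (a h) \<le> opmat_norm 1 (\<lambda>_ _. a) * norm h"
      by (rule power2_le_imp_le) simp
  qed simp
qed

lemma cb_norm_le_norm:
  assumes "cb_norm_le V \<Phi> C" "a \<in> V" shows "norm (\<Phi> a) \<le> C * norm a"
proof -
  have "opmat_norm 1 (\<lambda>_ _. \<Phi> a) \<le> C * opmat_norm 1 (\<lambda>_ _. a)"
    by (rule assms(1)[unfolded cb_norm_le_def, rule_format]) (simp add: opmat_in_def assms(2))
  then show ?thesis unfolding opmat_norm_one .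
qed

lemma cb_norm_le_mono: "cb_norm_le V \<Phi> C \<Longrightarrow> C \<le> C' \<Longrightarrow> cb_norm_le V \<Phi> C'"
  unfolding cb_norm_le_def by (meson mult_right_mono opmat_norm_nonneg order_trans)

text \<open>Pairing with the image vector itself recovers the norm of the image.\<close>

lemma opmat_norm_le_form:
  fixes b :: "nat \<Rightarrow> nat \<Rightarrow> 'h :: complex_inner \<Rightarrow>\<^sub>L 'h"
  assumes C: "0 \<le> C"
    and le: "\<And>x y. cmod (\<Sum>i<n. cinner (\<Sum>j<n. blinfun_apply (b i j) (x j)) (y i))
      \<le> C * sqrt (\<Sum>j<n. (norm (x j))\<^sup>2) * sqrt (\<Sum>i<n. (norm (y i))\<^sup>2)"
  shows "opmat_norm n b \<le> C"
proof (rule opmat_norm_leI[OF C])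
  fix x
  define y where "y i = (\<Sum>j<n. b i j (x j))" for i
  define Y where "Y = (\<Sum>i<n. (norm (y i))\<^sup>2)"
  have Y: "0 \<le> Y" by (simp add: Y_def sum_nonneg)
  have "(\<Sum>i<n. cinner (y i) (y i)) = complex_of_real Y" by (simp add: Y_def cinner_self)
  then have "Y \<le> C * sqrt (\<Sum>j<n. (norm (x j))\<^sup>2) * sqrt Y"
    using le[of x y] Y by (simp add: y_def[symmetric] Y_def[symmetric])
  then have "sqrt Y * sqrt Y \<le> C * sqrt (\<Sum>j<n. (norm (x j))\<^sup>2) * sqrt Y" using Y by simp
  then have "sqrt Y \<le> C * sqrt (\<Sum>j<n. (norm (x j))\<^sup>2)"
  proof (cases "Y = 0")
    case False
    with Y have "0 < sqrt Y" by simp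
    with \<open>sqrt Y * sqrt Y \<le> _\<close> show ?thesis by (rule mult_right_le_imp_le)
  qed (use C in \<open>simp add: sum_nonneg\<close>)
  then have "(sqrt Y)\<^sup>2 \<le> (C * sqrt (\<Sum>j<n. (norm (x j))\<^sup>2))\<^sup>2" using Y by (intro power_mono) auto
  then show "(\<Sum>i<n. (norm (\<Sum>j<n. b i j (x j)))\<^sup>2) \<le> C\<^sup>2 * (\<Sum>j<n. (norm (x j))\<^sup>2)"
    using Y by (simp add: y_def[symmetric] Y_def[symmetric] power_mult_distrib sum_nonneg)
qed

lemma opmat_form_le:
  fixes b :: "nat \<Rightarrow> nat \<Rightarrow> 'h :: complex_inner \<Rightarrow>\<^sub>L 'h"
  shows "cmod (\<Sum>i<n. cinner (\<Sum>j<n. blinfun_apply (b i j) (x j)) (y i))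
      \<le> opmat_norm n b * sqrt (\<Sum>j<n. (norm (x j))\<^sup>2) * sqrt (\<Sum>i<n. (norm (y i))\<^sup>2)"
proof -
  define w where "w i = (\<Sum>j<n. b i j (x j))" for i
  have "cmod (\<Sum>i<n. cinner (w i) (y i)) \<le> (\<Sum>i<n. \<bar>norm (w i)\<bar> * \<bar>norm (y i)\<bar>)"
    by (rule order_trans[OF norm_sum sum_mono]) (simp add: cinner_Cauchy_Schwarz)
  also have "\<dots> \<le> L2_set (\<lambda>i. norm (w i)) {..<n} * L2_set (\<lambda>i. norm (y i)) {..<n}"
    by (rule L2_set_mult_ineq)
  also have "\<dots> \<le> (opmat_norm n b * sqrt (\<Sum>j<n. (norm (x j))\<^sup>2)) * L2_set (\<lambda>i. norm (y i)) {..<n}"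
  proof (rule mult_right_mono)
    have "sqrt (\<Sum>i<n. (norm (w i))\<^sup>2) \<le> sqrt ((opmat_norm n b)\<^sup>2 * (\<Sum>j<n. (norm (x j))\<^sup>2))"
      unfolding w_def by (rule real_sqrt_le_mono[OF opmat_norm_bound])
    then show "L2_set (\<lambda>i. norm (w i)) {..<n} \<le> opmat_norm n b * sqrt (\<Sum>j<n. (norm (x j))\<^sup>2)"
      by (simp add: L2_set_def real_sqrt_mult)
  qed simp
  finally show ?thesis by (simp add: w_def L2_set_def)
qed

text \<open>A crude perturbation bound, sufficient to pass to entrywise limits for a fixed size.\<close>

lemma opmat_norm_triangle:
  fixes b c :: "nat \<Rightarrow> nat \<Rightarrow> 'h :: complex_inner \<Rightarrow>\<^sub>L 'h"
  shows "opmat_norm n c \<le> opmat_norm n b + (\<Sum>i<n. \<Sum>j<n. norm (c i j - b i j))"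
proof (rule opmat_norm_le_form)
  fix x y :: "nat \<Rightarrow> 'h"
  define X where "X = sqrt (\<Sum>j<n. (norm (x j))\<^sup>2)"
  define Y where "Y = sqrt (\<Sum>j<n. (norm (y j))\<^sup>2)"
  have X: "0 \<le> X" "norm (x j) \<le> X" if "j < n" for j
    using that unfolding X_def by (auto intro!: real_le_rsqrt member_le_sum simp: sum_nonneg)
  have Y: "norm (y j) \<le> Y" if "j < n" for j
    using that unfolding Y_def by (intro real_le_rsqrt member_le_sum) auto
  have part: "cmod (cinner ((c i j - b i j) (x j)) (y i)) \<le> norm (c i j - b i j) * X * Y"
    if ij: "i < n" "j < n" for i j
  proof -
    have "norm ((c i j - b i j) (x j)) \<le> norm (c i j - b i j) * X"
      by (rule order_trans[OF norm_blinfun mult_left_mono[OF X(2)[OF ij(2)]]]) simp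
    then have "norm ((c i j - b i j) (x j)) * norm (y i) \<le> (norm (c i j - b i j) * X) * Y"
      by (rule mult_mono[OF _ Y[OF ij(1)]]) (use X(1)[OF ij(2)] in auto)
    then show ?thesis using cinner_Cauchy_Schwarz order_trans by blast
  qed
  have "(\<Sum>i<n. cinner (\<Sum>j<n. c i j (x j)) (y i))
    = (\<Sum>i<n. cinner (\<Sum>j<n. b i j (x j)) (y i)) + (\<Sum>i<n. \<Sum>j<n. cinner ((c i j - b i j) (x j)) (y i))"
    unfolding blinfun.diff_left cinner.diff_left cinner.sum_left sum_subtractf by simp
  also have "cmod \<dots> \<le> opmat_norm n b * X * Y + (\<Sum>i<n. \<Sum>j<n. norm (c i j - b i j) * X * Y)"
  proof (rule norm_triangle_mono)
    show "cmod (\<Sum>i<n. cinner (\<Sum>j<n. b i j (x j)) (y i)) \<le> opmat_norm n b * X * Y"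
      unfolding X_def Y_def by (rule opmat_form_le)
    show "cmod (\<Sum>i<n. \<Sum>j<n. cinner ((c i j - b i j) (x j)) (y i))
      \<le> (\<Sum>i<n. \<Sum>j<n. norm (c i j - b i j) * X * Y)"
      by (rule sum_norm_le, rule sum_norm_le, rule part) auto
  qed
  also have "\<dots> = (opmat_norm n b + (\<Sum>i<n. \<Sum>j<n. norm (c i j - b i j))) * X * Y"
    unfolding sum_distrib_right distrib_right ..
  finally show "cmod (\<Sum>i<n. cinner (\<Sum>j<n. c i j (x j)) (y i))
    \<le> (opmat_norm n b + (\<Sum>i<n. \<Sum>j<n. norm (c i j - b i j)))
      * sqrt (\<Sum>j<n. (norm (x j))\<^sup>2) * sqrt (\<Sum>i<n. (norm (y i))\<^sup>2)"
    unfolding X_def Y_def .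
qed (simp add: sum_nonneg)

section \<open>Completely positive maps on operator systems\<close>

definition operator_system :: "('h :: chilbert_space \<Rightarrow>\<^sub>L 'h) set \<Rightarrow> bool" where
  "operator_system V \<longleftrightarrow> V \<subseteq> bounded_operators \<and> complex_subspace V \<and> id_blinfun \<in> V \<and>
     (\<forall>a\<in>V. \<exists>b\<in>V. is_adjoint b a)"

lemma unital_cstar_algebra_operator_system: "unital_cstar_algebra B \<Longrightarrow> operator_system B"
  by (simp add: unital_cstar_algebra_def operator_system_def)

lemma complex_subspaceD:
  assumes "complex_subspace V"
  shows "0 \<in> V" "x \<in> V \<Longrightarrow> y \<in> V \<Longrightarrow> x + y \<in> V" "x \<in> V \<Longrightarrow> c *\<^sub>C x \<in> V"
  using assms by (auto simp: complex_subspace_def)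

lemma complex_subspace_diff:
  assumes "complex_subspace V" "x \<in> V" "y \<in> V" shows "x - (y :: 'h :: complex_inner \<Rightarrow>\<^sub>L 'h) \<in> V"
proof -
  have "- y = (- 1) *\<^sub>C y" using scaleR_scaleC[of "- 1" y] by simp
  then show ?thesis
    using complex_subspaceD[OF assms(1)] assms by (metis diff_conv_add_uminus)
qed

lemma complex_subspace_sum:
  "complex_subspace V \<Longrightarrow> (\<And>i. i \<in> I \<Longrightarrow> f i \<in> V) \<Longrightarrow> (\<Sum>i\<in>I. f i) \<in> V"
  by (induction I rule: infinite_finite_induct) (auto intro: complex_subspaceD)

lemma linear_onD:
  assumes "linear_on V \<Phi>"
  shows "x \<in> V \<Longrightarrow> y \<in> V \<Longrightarrow> \<Phi> (x + y) = \<Phi> x + \<Phi> y" "x \<in> V \<Longrightarrow> \<Phi> (c *\<^sub>C x) = c *\<^sub>C \<Phi> x"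
  using assms by (auto simp: linear_on_def)

lemma linear_on_zero: "linear_on V \<Phi> \<Longrightarrow> complex_subspace V \<Longrightarrow> \<Phi> 0 = 0"
  using linear_onD(2)[of V \<Phi> 0 0] by (simp add: complex_subspaceD(1))

lemma linear_on_diff:
  assumes "linear_on V \<Phi>" "complex_subspace V" "x \<in> V" "y \<in> V"
  shows "\<Phi> (x - y) = \<Phi> x - \<Phi> (y :: 'h :: complex_inner \<Rightarrow>\<^sub>L 'h)"
  using linear_onD(1)[OF assms(1) complex_subspace_diff[OF assms(2-4)] assms(4)] by simp

lemma linear_on_sum:
  assumes "linear_on V \<Phi>" "complex_subspace V" "\<And>i. i \<in> I \<Longrightarrow> f i \<in> V"
  shows "\<Phi> (\<Sum>i\<in>I. f i) = (\<Sum>i\<in>I. \<Phi> (f i))"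
  using assms(3)
  by (induction I rule: infinite_finite_induct)
    (auto simp: linear_on_zero[OF assms(1,2)] linear_onD(1)[OF assms(1)] complex_subspace_sum[OF assms(2)])

lemma linear_on_tendsto:
  fixes \<Phi> :: "('h :: complex_inner \<Rightarrow>\<^sub>L 'h) \<Rightarrow> ('k :: complex_inner \<Rightarrow>\<^sub>L 'k)"
  assumes \<Phi>: "linear_on V \<Phi>" "\<And>a. a \<in> V \<Longrightarrow> norm (\<Phi> a) \<le> C * norm a" and V: "complex_subspace V"
    and f: "\<And>n. f n \<in> V" "a \<in> V" "(f \<longlongrightarrow> a) F"
  shows "((\<lambda>n. \<Phi> (f n)) \<longlongrightarrow> \<Phi> a) F"
proof -
  have "((\<lambda>n. C * norm (f n - a)) \<longlongrightarrow> C * norm (a - a)) F" by (intro tendsto_intros f)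
  then have lim: "((\<lambda>n. C * norm (f n - a)) \<longlongrightarrow> 0) F" by simp
  have "((\<lambda>n. \<Phi> (f n) - \<Phi> a) \<longlongrightarrow> 0) F"
    by (rule Lim_null_comparison[OF always_eventually lim])
      (simp add: \<Phi>(2) complex_subspace_diff[OF V] linear_on_diff[OF \<Phi>(1) V, symmetric] f)
  then show ?thesis by (simp add: LIM_zero_iff)
qed

text \<open>Enumerating the index set reduces this to the definition. The index sets that occur are a
  two-element set, a disjoint union of two copies of an initial segment, and pairs of a matrix
  index and a group element.\<close>

lemma completely_positive_finite:
  fixes b :: "'j \<Rightarrow> 'j \<Rightarrow> 'h :: complex_inner \<Rightarrow>\<^sub>L 'h"
  assumes cp: "completely_positive V \<Phi>" and J: "finite J"
    and b: "\<And>i j. i \<in> J \<Longrightarrow> j \<in> J \<Longrightarrow> b i j \<in> V"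
    and pos: "\<And>x. (\<Sum>i\<in>J. cinner (\<Sum>j\<in>J. blinfun_apply (b i j) (x j)) (x i)) \<in> \<real>\<^sub>\<ge>\<^sub>0"
  shows "(\<Sum>i\<in>J. cinner (\<Sum>j\<in>J. blinfun_apply (\<Phi> (b i j)) (x j)) (x i)) \<in> \<real>\<^sub>\<ge>\<^sub>0"
proof -
  define n where "n = card J"
  obtain e where e: "bij_betw e {..<n} J"
    using ex_bij_betw_nat_finite[OF J] unfolding n_def atLeast0LessThan by blast
  have eJ: "e k \<in> J" if "k < n" for k using e that by (auto simp: bij_betw_def)
  have "opmat_positive n (\<lambda>k l. b (e k) (e l))"
    unfolding opmat_positive_def
  proof
    fix x :: "nat \<Rightarrow> 'h"
    define y where "y i = x (inv_into {..<n} e i)" for i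
    have y: "x k = y (e k)" if "k < n" for k
      using e that by (simp add: y_def bij_betw_def inv_into_f_f)
    have "(\<Sum>k<n. cinner (\<Sum>l<n. b (e k) (e l) (x l)) (x k))
      = (\<Sum>k<n. cinner (\<Sum>l<n. b (e k) (e l) (y (e l))) (y (e k)))"
      by (simp add: y)
    also have "\<dots> = (\<Sum>k<n. cinner (\<Sum>j\<in>J. b (e k) j (y j)) (y (e k)))"
      by (subst sum.reindex_bij_betw[OF e]) (rule refl)
    also have "\<dots> = (\<Sum>i\<in>J. cinner (\<Sum>j\<in>J. b i j (y j)) (y i))"
      by (rule sum.reindex_bij_betw[OF e])
    finally show "(\<Sum>k<n. cinner (\<Sum>l<n. b (e k) (e l) (x l)) (x k)) \<in> \<real>\<^sub>\<ge>\<^sub>0"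
      using pos by simp
  qed
  moreover have "opmat_in n V (\<lambda>k l. b (e k) (e l))" by (simp add: opmat_in_def b eJ)
  ultimately have "opmat_positive n (\<lambda>k l. \<Phi> (b (e k) (e l)))"
    using cp unfolding completely_positive_def by blast
  then have "(\<Sum>k<n. cinner (\<Sum>l<n. \<Phi> (b (e k) (e l)) (x (e l))) (x (e k))) \<in> \<real>\<^sub>\<ge>\<^sub>0"
    unfolding opmat_positive_def by (rule allE[of _ "\<lambda>k. x (e k)"])
  also have "(\<Sum>k<n. cinner (\<Sum>l<n. \<Phi> (b (e k) (e l)) (x (e l))) (x (e k)))
    = (\<Sum>k<n. cinner (\<Sum>j\<in>J. \<Phi> (b (e k) j) (x j)) (x (e k)))"
    by (subst sum.reindex_bij_betw[OF e]) (rule refl)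
  also have "\<dots> = (\<Sum>i\<in>J. cinner (\<Sum>j\<in>J. \<Phi> (b i j) (x j)) (x i))"
    by (rule sum.reindex_bij_betw[OF e])
  finally show ?thesis .
qed

text \<open>A matrix \<open>b\<close> with \<open>\<parallel>b\<parallel> \<le> C\<close> makes the block matrix with rows \<open>(C, b)\<close> and \<open>(b\<^sup>*, C)\<close>
  positive. A unital completely positive map preserves the shape of this matrix and its
  positivity, and positivity of the image bounds the norm of its off-diagonal block.\<close>

lemma completely_positive_unital_contractive:
  assumes V: "operator_system V" and cp: "completely_positive V \<Phi>" and un: "unital_map \<Phi>"
  shows "cb_norm_le V \<Phi> 1"
  unfolding cb_norm_le_def mult_1
proof (intro allI impI)
  fix n and b :: "nat \<Rightarrow> nat \<Rightarrow> 'a \<Rightarrow>\<^sub>L 'a"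
  assume b: "opmat_in n V b"
  have lin: "linear_on V \<Phi>" and im: "\<And>a. a \<in> V \<Longrightarrow> \<Phi> a \<in> V"
    using cp by (auto simp: completely_positive_def)
  have sub: "complex_subspace V" and idV: "id_blinfun \<in> V" and bo: "V \<subseteq> bounded_operators"
    using V by (auto simp: operator_system_def)
  define C where "C = opmat_norm n b"
  have C0: "0 \<le> C" by (simp add: C_def)
  have bV: "b i j \<in> V" if "i < n" "j < n" for i j using b that by (simp add: opmat_in_def)
  have "\<forall>a\<in>V. \<exists>b\<in>V. is_adjoint b a" using V by (simp add: operator_system_def)
  then obtain st where st: "\<And>a. a \<in> V \<Longrightarrow> st a \<in> V" "\<And>a. a \<in> V \<Longrightarrow> is_adjoint (st a) a" by metis
  define dg where "dg i j = (if i = j then complex_of_real C *\<^sub>C id_blinfun else (0 :: 'a \<Rightarrow>\<^sub>L 'a))" for i j :: nat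
  define m where "m p q = (case p of
      Inl i \<Rightarrow> (case q of Inl j \<Rightarrow> dg i j | Inr j \<Rightarrow> b i j)
    | Inr i \<Rightarrow> (case q of Inl j \<Rightarrow> st (b j i) | Inr j \<Rightarrow> dg i j))" for p q :: "nat + nat"
  let ?J = "{..<n} <+> {..<n}"
  have dgV: "dg i j \<in> V" for i j
    by (simp add: dg_def complex_subspaceD[OF sub] idV)
  have \<Phi>dg: "\<Phi> (dg i j) = dg i j" for i j
    using un by (simp add: dg_def linear_onD[OF lin idV] linear_on_zero[OF lin sub] unital_map_def)
  have dg_sum: "(\<Sum>j<n. dg i j (x j)) = complex_of_real C *\<^sub>C x i" if "i < n" for x i
  proof -
    have "(\<Sum>j<n. dg i j (x j)) = (\<Sum>j<n. if i = j then complex_of_real C *\<^sub>C x j else 0)"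
      by (rule sum.cong) (auto simp: dg_def scaleC_blinfun.rep_eq blinfun.zero_left)
    then show ?thesis using that by simp
  qed
  have expand: "(\<Sum>p\<in>?J. cinner (\<Sum>q\<in>?J. \<Psi> (m p q) (v q)) (v p))
    = complex_of_real (C * (\<Sum>i<n. (norm (v (Inl i)))\<^sup>2))
      + (\<Sum>i<n. cinner (\<Sum>j<n. \<Psi> (b i j) (v (Inr j))) (v (Inl i)))
      + (\<Sum>i<n. cinner (\<Sum>j<n. \<Psi> (st (b j i)) (v (Inl j))) (v (Inr i)))
      + complex_of_real (C * (\<Sum>i<n. (norm (v (Inr i)))\<^sup>2))"
    if \<Psi>: "\<And>i j. \<Psi> (dg i j) = dg i j" for \<Psi> and v :: "nat + nat \<Rightarrow> 'a"
    by (simp add: sum.Plus m_def \<Psi> cinner_add_left sum.distrib dg_sum cinner_scaleC_left cinner_self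
        sum_distrib_left)
  have pos: "(\<Sum>p\<in>?J. cinner (\<Sum>q\<in>?J. m p q (v q)) (v p)) \<in> \<real>\<^sub>\<ge>\<^sub>0" for v
  proof -
    define w where "w = (\<Sum>i<n. cinner (\<Sum>j<n. b i j (v (Inr j))) (v (Inl i)))"
    define x where "x = sqrt (\<Sum>i<n. (norm (v (Inl i)))\<^sup>2)"
    define y where "y = sqrt (\<Sum>i<n. (norm (v (Inr i)))\<^sup>2)"
    have "(\<Sum>i<n. cinner (\<Sum>j<n. st (b j i) (v (Inl j))) (v (Inr i)))
      = (\<Sum>i<n. \<Sum>j<n. cinner (v (Inl j)) (b j i (v (Inr i))))"
      by (simp add: cinner.sum_left is_adjointD[OF st(2)] bV)
    also have "\<dots> = (\<Sum>j<n. \<Sum>i<n. cinner (v (Inl j)) (b j i (v (Inr i))))" by (rule sum.swap)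
    also have "\<dots> = cnj w"
      by (simp add: w_def cinner.sum_left cinner_commute[symmetric])
    finally have g: "(\<Sum>i<n. cinner (\<Sum>j<n. st (b j i) (v (Inl j))) (v (Inr i))) = cnj w" .
    have "cmod w \<le> C * y * x" unfolding w_def C_def x_def y_def by (rule opmat_form_le)
    then have "- (C * y * x) \<le> Re w" using abs_Re_le_cmod[of w] by linarith
    moreover have "0 \<le> C * (x - y)\<^sup>2" using C0 by simp
    then have "2 * (C * y * x) \<le> C * x\<^sup>2 + C * y\<^sup>2" by (simp add: power2_eq_square algebra_simps)
    ultimately have "0 \<le> C * x\<^sup>2 + 2 * Re w + C * y\<^sup>2" by linarith
    moreover have "x\<^sup>2 = (\<Sum>i<n. (norm (v (Inl i)))\<^sup>2)" "y\<^sup>2 = (\<Sum>i<n. (norm (v (Inr i)))\<^sup>2)"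
      by (simp_all add: x_def y_def sum_nonneg)
    ultimately show ?thesis
      by (simp add: expand[of "\<lambda>a. a"] g w_def[symmetric] complex_nonneg_Reals_iff)
  qed
  have mV: "m p q \<in> V" if "p \<in> ?J" "q \<in> ?J" for p q
    using that by (auto simp: m_def dgV bV st(1) split: sum.splits)
  have pos': "(\<Sum>p\<in>?J. cinner (\<Sum>q\<in>?J. \<Phi> (m p q) (v q)) (v p)) \<in> \<real>\<^sub>\<ge>\<^sub>0" for v
    by (rule completely_positive_finite[OF cp _ mV pos]) auto
  show "opmat_norm n (\<lambda>i j. \<Phi> (b i j)) \<le> opmat_norm n b"
    unfolding C_def[symmetric]
  proof (rule opmat_norm_le_form[OF C0])
    fix x y :: "nat \<Rightarrow> 'a"
    define X where "X = (\<Sum>j<n. (norm (x j))\<^sup>2)"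
    define Y where "Y = (\<Sum>j<n. (norm (y j))\<^sup>2)"
    define f where "f = (\<Sum>i<n. cinner (\<Sum>j<n. \<Phi> (b i j) (x j)) (y i))"
    define g where "g = (\<Sum>i<n. cinner (\<Sum>j<n. \<Phi> (st (b j i)) (y j)) (x i))"
    have "(cmod f)\<^sup>2 \<le> (C * Y) * (C * X)"
    proof (rule positive_form_off_diagonal[where g = g])
      fix c
      define v where "v p = (case p of Inl i \<Rightarrow> y i | Inr i \<Rightarrow> c *\<^sub>C x i)" for p :: "nat + nat"
      have 1: "(\<Sum>j<n. \<Phi> (b i j) (c *\<^sub>C x j)) = c *\<^sub>C (\<Sum>j<n. \<Phi> (b i j) (x j))" if "i < n" for i
        unfolding scaleC_sum_right
        by (rule sum.cong) (use bV im bo that in \<open>auto intro!: blinfun_scaleC\<close>)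
      have "complex_of_real (C * Y) + c * f + cnj c * g + complex_of_real ((cmod c)\<^sup>2 * (C * X))
        = (\<Sum>p\<in>?J. cinner (\<Sum>q\<in>?J. \<Phi> (m p q) (v q)) (v p))"
        unfolding expand[of \<Phi>, OF \<Phi>dg]
        by (simp add: v_def 1 cinner_scaleC_left cinner_scaleC_right X_def Y_def f_def g_def
            norm_scaleC power_mult_distrib sum_distrib_left mult_ac)
      then show "complex_of_real (C * Y) + c * f + cnj c * g + complex_of_real ((cmod c)\<^sup>2 * (C * X)) \<in> \<real>\<^sub>\<ge>\<^sub>0"
        using pos'[of v] by simp
    qed (simp add: C0 X_def sum_nonneg)
    also have "\<dots> = (C * sqrt X * sqrt Y)\<^sup>2"
      by (simp add: power2_eq_square X_def Y_def sum_nonneg mult_ac flip: real_sqrt_mult)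
    finally show "cmod f \<le> C * sqrt X * sqrt Y"
      by (rule power2_le_imp_le) (simp add: C0 X_def Y_def sum_nonneg)
  qed
qed

lemma completely_positive_contractive:
  assumes "operator_system V" "completely_positive V \<Phi>" "unital_map \<Phi>" "a \<in> V"
  shows "norm (\<Phi> a) \<le> norm a"
  using cb_norm_le_norm[OF completely_positive_unital_contractive[OF assms(1-3)] assms(4)] by simp

text \<open>The Kadison--Schwarz inequality. The block matrix with rows \<open>(1, x)\<close> and \<open>(x\<^sup>*, x\<^sup>* x)\<close> is
  positive, as its quadratic form at \<open>(u, v)\<close> is \<open>\<parallel>u + x v\<parallel>\<^sup>2\<close>; so is its image. The off-diagonal
  entry of the image is tested at the vectors \<open>h\<close> and \<open>\<Phi>(x) h\<close>.\<close>

lemma completely_positive_Schwarz: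
  fixes h :: "'h :: chilbert_space"
  assumes V: "operator_system V" and cp: "completely_positive V \<Phi>" and un: "unital_map \<Phi>"
    and x: "x \<in> V" "y \<in> V" "y o\<^sub>L x \<in> V" "is_adjoint y x"
  shows "complex_of_real ((norm (\<Phi> x h))\<^sup>2) \<le> cinner (\<Phi> (y o\<^sub>L x) h) h"
proof -
  have idV: "id_blinfun \<in> V" and bo: "V \<subseteq> bounded_operators"
    using V by (auto simp: operator_system_def)
  have \<Phi>x: "\<Phi> x \<in> bounded_operators" "\<Phi> (y o\<^sub>L x) \<in> bounded_operators"
    using cp x bo by (auto simp: completely_positive_def)
  define m where "m p q = (if p then (if q then id_blinfun else x) else (if q then y else y o\<^sub>L x))" for p q :: bool
  have pos: "(\<Sum>p\<in>UNIV. cinner (\<Sum>q\<in>UNIV. m p q (v q)) (v p)) \<in> \<real>\<^sub>\<ge>\<^sub>0" for v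
  proof -
    have "(\<Sum>p\<in>UNIV. cinner (\<Sum>q\<in>UNIV. m p q (v q)) (v p))
      = cinner (v True + x (v False)) (v True + x (v False))"
      by (simp add: UNIV_bool m_def cinner_add_left cinner_add_right is_adjointD[OF x(4)])
    then show ?thesis by (simp add: cinner_self nonneg_Reals_of_real_iff flip: of_real_power)
  qed
  have pos': "(\<Sum>p\<in>UNIV. cinner (\<Sum>q\<in>UNIV. \<Phi> (m p q) (v q)) (v p)) \<in> \<real>\<^sub>\<ge>\<^sub>0" for v
    by (rule completely_positive_finite[OF cp _ _ pos]) (auto simp: m_def idV x)
  have pos'': "cinner (v True) (v True) + cinner (\<Phi> x (v False)) (v True)
      + cinner (\<Phi> y (v True)) (v False) + cinner (\<Phi> (y o\<^sub>L x) (v False)) (v False) \<in> \<real>\<^sub>\<ge>\<^sub>0" for v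
    using pos'[of v] un by (simp add: UNIV_bool m_def cinner_add_left unital_map_def add_ac)
  define z where "z = cinner (\<Phi> (y o\<^sub>L x) h) h"
  have z: "z \<in> \<real>\<^sub>\<ge>\<^sub>0"
    using pos''[of "\<lambda>p. if p then 0 else h"]
    by (simp add: z_def cinner.zero_left cinner.zero_right blinfun.zero_right)
  then obtain q where q: "z = complex_of_real q" "0 \<le> q"
    by (metis nonneg_Reals_cases)
  define k where "k = \<Phi> x h"
  have "(cmod (cinner k k))\<^sup>2 \<le> (norm k)\<^sup>2 * q"
  proof (rule positive_form_off_diagonal[where g = "cinner (\<Phi> y k) h"])
    fix c
    have "complex_of_real ((norm k)\<^sup>2) + c * cinner k k + cnj c * cinner (\<Phi> y k) h
      + c * cnj c * z \<in> \<real>\<^sub>\<ge>\<^sub>0"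
      using pos''[of "\<lambda>p. if p then k else c *\<^sub>C h"]
      by (simp add: blinfun_scaleC[OF \<Phi>x(1)] blinfun_scaleC[OF \<Phi>x(2)] cinner_scaleC_left
          cinner_scaleC_right k_def z_def cinner_self mult_ac)
    then show "complex_of_real ((norm k)\<^sup>2) + c * cinner k k + cnj c * cinner (\<Phi> y k) h
      + complex_of_real ((cmod c)\<^sup>2 * q) \<in> \<real>\<^sub>\<ge>\<^sub>0"
      unfolding q(1) by (simp only: of_real_mult complex_norm_square)
  qed (rule q(2))
  moreover have "cmod (cinner k k) = (norm k)\<^sup>2" by (simp add: cinner_self norm_power)
  ultimately have "(norm k)\<^sup>2 * (norm k)\<^sup>2 \<le> (norm k)\<^sup>2 * q" by (simp add: power2_eq_square)
  then have "(norm k)\<^sup>2 \<le> q"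
  proof (cases "k = 0")
    case False
    then have "0 < (norm k)\<^sup>2" by simp
    with \<open>(norm k)\<^sup>2 * (norm k)\<^sup>2 \<le> _\<close> show ?thesis by (rule mult_left_le_imp_le)
  qed (use q(2) in simp)
  then show ?thesis unfolding z_def[symmetric] k_def[symmetric] q(1) by (simp add: less_eq_complex_def)
qed

section \<open>Automorphisms of C*-algebras are completely contractive\<close>

text \<open>Matrices over an algebra become single operators on \<open>\<ell>\<^sup>2(\<nat>, H)\<close>, supported in the first \<open>n\<close>
  coordinates, so that facts about one operator on a Hilbert space apply to matrices of any size.\<close>

definition opmat_blinfun ::
    "nat \<Rightarrow> (nat \<Rightarrow> nat \<Rightarrow> 'h :: chilbert_space \<Rightarrow>\<^sub>L 'h) \<Rightarrow> (nat, 'h) ell2 \<Rightarrow>\<^sub>L (nat, 'h) ell2" where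
  "opmat_blinfun n b = (\<Sum>i<n. \<Sum>j<n. point i o\<^sub>L b i j o\<^sub>L coord j)"

definition entry :: "('i, 'h :: chilbert_space) ell2 \<Rightarrow>\<^sub>L ('i, 'h) ell2 \<Rightarrow> 'i \<Rightarrow> 'i \<Rightarrow> 'h \<Rightarrow>\<^sub>L 'h" where
  "entry T i j = coord i o\<^sub>L T o\<^sub>L point j"

lemma opmat_blinfun_apply:
  "opmat_blinfun n b \<xi> = (\<Sum>i<n. point i (\<Sum>j<n. b i j (ell2_apply \<xi> j)))"
  by (simp add: opmat_blinfun_def blinfun.sum_left blinfun.sum_right coord_apply)

lemma ell2_apply_opmat_blinfun:
  "ell2_apply (opmat_blinfun n b \<xi>) i = (if i < n then \<Sum>j<n. b i j (ell2_apply \<xi> j) else 0)"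
  by (simp add: opmat_blinfun_apply)

lemma ell2_apply_entry: "ell2_apply (blinfun_apply T (point j h)) i = entry T i j h"
  by (simp add: entry_def coord_apply)

lemma entry_opmat_blinfun: "i < n \<Longrightarrow> j < n \<Longrightarrow> entry (opmat_blinfun n b) i j = b i j"
proof (rule blinfun_eqI)
  fix h assume "i < n" "j < n"
  then have "entry (opmat_blinfun n b) i j h = (\<Sum>k<n. if k = j then b i k h else 0)"
    unfolding ell2_apply_entry[symmetric] ell2_apply_opmat_blinfun
    by (auto simp: if_distrib[of "blinfun_apply _"] blinfun.zero_right cong: if_cong)
  then show "entry (opmat_blinfun n b) i j h = b i j h" using \<open>j < n\<close> by simp
qed

lemma norm_opmat_blinfun:
  fixes b :: "nat \<Rightarrow> nat \<Rightarrow> 'h :: chilbert_space \<Rightarrow>\<^sub>L 'h"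
  shows "norm (opmat_blinfun n b) = opmat_norm n b"
proof (rule antisym)
  have sq: "(norm (opmat_blinfun n b \<xi>))\<^sup>2 = (\<Sum>i<n. (norm (\<Sum>j<n. b i j (ell2_apply \<xi> j)))\<^sup>2)"
    for \<xi> :: "(nat, 'h) ell2"
  proof -
    have "(norm (opmat_blinfun n b \<xi>))\<^sup>2 = (\<Sum>i<n. (norm (ell2_apply (opmat_blinfun n b \<xi>) i))\<^sup>2)"
      by (rule norm_ell2_finite) (auto simp: ell2_apply_opmat_blinfun)
    then show ?thesis by (simp add: ell2_apply_opmat_blinfun)
  qed
  show "norm (opmat_blinfun n b) \<le> opmat_norm n b"
  proof (rule norm_blinfun_bound)
    fix \<xi> :: "(nat, 'h) ell2"
    have "(\<Sum>j<n. (norm (ell2_apply \<xi> j))\<^sup>2) \<le> (norm \<xi>)\<^sup>2"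
      by (rule has_sum_mono2[OF has_sum_finite norm_ell2_has_sum]) auto
    then have "(norm (opmat_blinfun n b \<xi>))\<^sup>2 \<le> (opmat_norm n b * norm \<xi>)\<^sup>2"
      unfolding sq power_mult_distrib
      by (intro order_trans[OF opmat_norm_bound] mult_left_mono) auto
    then show "norm (opmat_blinfun n b \<xi>) \<le> opmat_norm n b * norm \<xi>"
      by (rule power2_le_imp_le) simp
  qed simp
  show "opmat_norm n b \<le> norm (opmat_blinfun n b)"
  proof (rule opmat_norm_leI)
    fix x :: "nat \<Rightarrow> 'h"
    define \<xi> where "\<xi> = (\<Sum>j<n. point j (x j))"
    have \<xi>: "ell2_apply \<xi> j = (if j < n then x j else 0)" for j by (simp add: \<xi>_def)
    have "(norm \<xi>)\<^sup>2 = (\<Sum>j<n. (norm (ell2_apply \<xi> j))\<^sup>2)"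
      by (rule norm_ell2_finite) (auto simp: \<xi>)
    then have "(norm \<xi>)\<^sup>2 = (\<Sum>j<n. (norm (x j))\<^sup>2)" by (simp add: \<xi>)
    moreover have "(norm (opmat_blinfun n b \<xi>))\<^sup>2 \<le> (norm (opmat_blinfun n b) * norm \<xi>)\<^sup>2"
      by (intro power_mono norm_blinfun) simp
    moreover have "(norm (opmat_blinfun n b \<xi>))\<^sup>2 = (\<Sum>i<n. (norm (\<Sum>j<n. b i j (x j)))\<^sup>2)"
      unfolding sq by (simp add: \<xi>)
    ultimately show "(\<Sum>i<n. (norm (\<Sum>j<n. b i j (x j)))\<^sup>2)
        \<le> (norm (opmat_blinfun n b))\<^sup>2 * (\<Sum>j<n. (norm (x j))\<^sup>2)"
      by (simp add: power_mult_distrib)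
  qed simp
qed

lemma opmat_blinfun_eqI:
  "(\<And>i j. i < n \<Longrightarrow> j < n \<Longrightarrow> a i j = b i j) \<Longrightarrow> opmat_blinfun n a = opmat_blinfun n b"
  by (simp add: opmat_blinfun_def)

lemma opmat_blinfun_compose:
  "opmat_blinfun n a o\<^sub>L opmat_blinfun n b = opmat_blinfun n (\<lambda>i j. \<Sum>k<n. a i k o\<^sub>L b k j)"
proof (rule blinfun_eqI, rule ell2_eqI)
  fix \<xi> i
  have "(\<Sum>k<n. a i k (\<Sum>j<n. b k j (ell2_apply \<xi> j))) = (\<Sum>k<n. \<Sum>j<n. a i k (b k j (ell2_apply \<xi> j)))"
    by (simp add: blinfun.sum_right)
  also have "\<dots> = (\<Sum>j<n. \<Sum>k<n. a i k (b k j (ell2_apply \<xi> j)))" by (rule sum.swap)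
  finally show "ell2_apply ((opmat_blinfun n a o\<^sub>L opmat_blinfun n b) \<xi>) i
    = ell2_apply (opmat_blinfun n (\<lambda>i j. \<Sum>k<n. a i k o\<^sub>L b k j) \<xi>) i"
    by (simp add: ell2_apply_opmat_blinfun blinfun.sum_left)
qed

lemma opmat_blinfun_add:
  "opmat_blinfun n a + opmat_blinfun n b = opmat_blinfun n (\<lambda>i j. a i j + b i j)"
  by (rule blinfun_eqI, rule ell2_eqI)
    (simp add: ell2_apply_opmat_blinfun plus_ell2.rep_eq blinfun.add_left sum.distrib)

lemma opmat_blinfun_scaleC:
  "c *\<^sub>C opmat_blinfun n b = opmat_blinfun n (\<lambda>i j. c *\<^sub>C b i j)"
  by (rule blinfun_eqI, rule ell2_eqI)
    (simp add: ell2_apply_opmat_blinfun scaleC_blinfun.rep_eq scaleC_ell2.rep_eq scaleC_sum_right)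

lemma is_adjoint_opmat_blinfun:
  assumes "\<And>i j. i < n \<Longrightarrow> j < n \<Longrightarrow> is_adjoint (a j i) (b i j)"
  shows "is_adjoint (opmat_blinfun n a) (opmat_blinfun n b)"
  unfolding is_adjoint_def
proof (intro allI)
  fix \<xi> \<eta>
  have "cinner (opmat_blinfun n a \<xi>) \<eta>
    = (\<Sum>i<n. \<Sum>j<n. cinner (a i j (ell2_apply \<xi> j)) (ell2_apply \<eta> i))"
    by (simp add: opmat_blinfun_apply cinner.sum_left cinner_point_left)
  also have "\<dots> = (\<Sum>i<n. \<Sum>j<n. cinner (ell2_apply \<xi> j) (b j i (ell2_apply \<eta> i)))"
    by (intro sum.cong refl is_adjointD assms) auto
  also have "\<dots> = (\<Sum>j<n. \<Sum>i<n. cinner (ell2_apply \<xi> j) (b j i (ell2_apply \<eta> i)))"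
    by (rule sum.swap)
  also have "\<dots> = cinner \<xi> (opmat_blinfun n b \<eta>)"
    by (simp add: opmat_blinfun_apply cinner.sum_right cinner_point_right)
  finally show "cinner (opmat_blinfun n a \<xi>) \<eta> = cinner \<xi> (opmat_blinfun n b \<eta>)" .
qed

lemma is_adjoint_entry:
  assumes "is_adjoint S T" shows "is_adjoint (entry S j i) (entry T i j)"
  unfolding is_adjoint_def
  by (simp flip: ell2_apply_entry cinner_point_left cinner_point_right add: is_adjointD[OF assms])

lemma continuous_entry: "continuous_on UNIV (\<lambda>T. entry T i j)"
  unfolding entry_def
  by (intro continuous_intros)

text \<open>The equation says that \<open>(1 - z)\<^sup>2 = 1 - x\<close>. The map \<open>z \<mapsto> (x + z\<^sup>2) / 2\<close> is a contraction of the
  ball of radius \<open>\<parallel>x\<parallel>\<close>, so Banach's fixed point theorem yields square roots without spectral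
  theory, inside any closed set of operators that the iteration does not leave.\<close>

lemma square_root_fixed_point:
  fixes x :: "'k :: banach \<Rightarrow>\<^sub>L 'k"
  assumes M: "closed M" "0 \<in> M" "\<And>z. z \<in> M \<Longrightarrow> (1/2) *\<^sub>R (x + (z o\<^sub>L z)) \<in> M"
    and x: "norm x < 1"
  obtains z where "z \<in> M" "2 *\<^sub>R z = x + (z o\<^sub>L z)"
proof -
  let ?S = "M \<inter> cball 0 (norm x)" and ?f = "\<lambda>z. (1/2) *\<^sub>R (x + (z o\<^sub>L z))"
  have "\<exists>!z\<in>?S. ?f z = z"
  proof (rule Banach_fix[where c = "norm x"])
    show "complete ?S" using M(1) by (simp add: complete_eq_closed closed_Int)
    show "?S \<noteq> {}" using M(2) by auto
    show "?f ` ?S \<subseteq> ?S"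
    proof clarify
      fix z assume z: "z \<in> M" "z \<in> cball 0 (norm x)"
      have "norm (z o\<^sub>L z) \<le> norm z * norm z" by (rule norm_blinfun_compose)
      also have "\<dots> \<le> 1 * norm x" using z(2) x by (intro mult_mono) auto
      finally have "norm (x + (z o\<^sub>L z)) \<le> 2 * norm x"
        using norm_triangle_ineq[of x "z o\<^sub>L z"] by linarith
      then show "?f z \<in> ?S" using M(3)[OF z(1)] by simp
    qed
    show "dist (?f z) (?f w) \<le> norm x * dist z w" if "z \<in> ?S" "w \<in> ?S" for z w
    proof -
      have "(z o\<^sub>L z) - (w o\<^sub>L w) = (z o\<^sub>L (z - w)) + ((z - w) o\<^sub>L w)"
        by (rule blinfun_eqI) (simp add: blinfun.diff_left blinfun.diff_right blinfun.add_left)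
      then have "norm ((z o\<^sub>L z) - (w o\<^sub>L w)) \<le> norm z * norm (z - w) + norm (z - w) * norm w"
        by (metis norm_triangle_mono norm_blinfun_compose)
      also have "\<dots> \<le> norm x * norm (z - w) + norm (z - w) * norm x"
        using that by (intro add_mono mult_mono) auto
      finally have "norm ((z o\<^sub>L z) - (w o\<^sub>L w)) \<le> 2 * (norm x * norm (z - w))" by simp
      moreover have "?f z - ?f w = (1/2) *\<^sub>R ((z o\<^sub>L z) - (w o\<^sub>L w))"
        by (simp add: scaleR_add_right scaleR_diff_right)
      ultimately show ?thesis by (simp add: dist_norm)
    qed
  qed (use x in auto)
  then obtain z where z: "z \<in> M" "?f z = z" by auto
  from z(2) have "2 *\<^sub>R z = 2 *\<^sub>R ?f z" by simp
  also have "\<dots> = x + (z o\<^sub>L z)" by simp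
  finally show thesis using that z(1) by blast
qed

text \<open>If \<open>\<parallel>b\<parallel> < 1\<close> then \<open>1 - b\<^sup>* b = (1 - z)\<^sup>2\<close> for a selfadjoint matrix \<open>z\<close> over the algebra. Applying
  the automorphism to the entries keeps this identity, so the image of \<open>b\<close> is a contraction.\<close>

lemma star_automorphism_contractive:
  assumes A: "unital_cstar_algebra A" and \<phi>: "star_automorphism A \<phi>"
  shows "cb_norm_le A \<phi> 1"
  unfolding cb_norm_le_def mult_1
proof (intro allI impI)
  fix n b
  assume b: "opmat_in n A b"
  have sub: "complex_subspace A" and bo: "A \<subseteq> bounded_operators" and cl: "closed A"
    and mult: "\<And>a b. a \<in> A \<Longrightarrow> b \<in> A \<Longrightarrow> a o\<^sub>L b \<in> A"
    and adjA: "\<forall>a\<in>A. \<exists>b\<in>A. is_adjoint b a"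
    using A by (auto simp: unital_cstar_algebra_def)
  have lin: "linear_on A \<phi>" and im: "\<And>a. a \<in> A \<Longrightarrow> \<phi> a \<in> A"
    and \<phi>mult: "\<And>a b. a \<in> A \<Longrightarrow> b \<in> A \<Longrightarrow> \<phi> (a o\<^sub>L b) = \<phi> a o\<^sub>L \<phi> b"
    and \<phi>adj: "\<And>a. a \<in> A \<Longrightarrow> \<phi> (adj a) = adj (\<phi> a)"
    using \<phi> by (auto simp: star_automorphism_def bij_betw_def)
  have adj_in: "adj a \<in> A" "is_adjoint (adj a) a" if "a \<in> A" for a
    using adjA that adj_eqI by blast+
  have adj_im: "is_adjoint (\<phi> c) (\<phi> a)" if "a \<in> A" "is_adjoint c a" for a c
    using adj_in(2)[OF im[OF that(1)]] \<phi>adj[OF that(1)] adj_eqI[OF that(2)] by metis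
  \<comment> \<open>The strict bound is needed for the square root; rescaling removes it at the end.\<close>
  have main: "opmat_norm n (\<lambda>i j. \<phi> (b i j)) \<le> 1" if b: "opmat_in n A b" and b1: "opmat_norm n b < 1" for b
  proof -
    have bA: "b i j \<in> A" if "i < n" "j < n" for i j using b that by (simp add: opmat_in_def)
    define x where "x i j = (\<Sum>k<n. adj (b k i) o\<^sub>L b k j)" for i j
    define X where "X = opmat_blinfun n (\<lambda>i j. adj (b j i)) o\<^sub>L opmat_blinfun n b"
    have X: "X = opmat_blinfun n x" by (simp add: X_def x_def[abs_def] opmat_blinfun_compose)
    have xA: "x i j \<in> A" if "i < n" "j < n" for i j
      unfolding x_def using that by (intro complex_subspace_sum[OF sub] mult adj_in bA) auto
    have adjb: "is_adjoint (opmat_blinfun n (\<lambda>i j. adj (b j i))) (opmat_blinfun n b)"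
      by (rule is_adjoint_opmat_blinfun) (simp add: adj_in bA)
    have Xadj: "is_adjoint X X"
      unfolding X_def by (rule is_adjoint_compose[OF is_adjoint_sym[OF adjb] adjb])
    have "norm X \<le> norm (opmat_blinfun n b) * norm (opmat_blinfun n b)"
      unfolding X_def
      by (rule order_trans[OF norm_blinfun_compose]) (intro mult_right_mono norm_is_adjoint_le adjb norm_ge_zero)
    also have "\<dots> < 1"
      using mult_strict_mono'[OF b1 b1] by (simp add: norm_opmat_blinfun)
    finally have X1: "norm X < 1" .
    \<comment> \<open>The selfadjoint matrices over the algebra, as a closed set of operators.\<close>
    define M where "M = {T :: (nat, 'a) ell2 \<Rightarrow>\<^sub>L (nat, 'a) ell2. T = opmat_blinfun n (entry T) \<and>
      (\<forall>i<n. \<forall>j<n. entry T i j \<in> A) \<and> is_adjoint T T}"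
    have M_I: "opmat_blinfun n c \<in> M"
      if "\<And>i j. i < n \<Longrightarrow> j < n \<Longrightarrow> c i j \<in> A" "is_adjoint (opmat_blinfun n c) (opmat_blinfun n c)" for c
      using that unfolding M_def by (auto simp: entry_opmat_blinfun intro!: opmat_blinfun_eqI)
    obtain z where z: "z \<in> M" "2 *\<^sub>R z = X + (z o\<^sub>L z)"
    proof (rule square_root_fixed_point[OF _ _ _ X1])
      show "closed M"
      proof -
        have c1: "closed {T :: (nat, 'a) ell2 \<Rightarrow>\<^sub>L (nat, 'a) ell2. T = opmat_blinfun n (entry T)}"
          unfolding opmat_blinfun_def
          by (intro closed_Collect_eq continuous_intros continuous_entry)
        have c2: "closed {T :: (nat, 'a) ell2 \<Rightarrow>\<^sub>L (nat, 'a) ell2. entry T i j \<in> A}" for i j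
          using continuous_closed_vimage[OF cl, of "\<lambda>T. entry T i j"] continuous_entry[of i j]
          by (auto simp: continuous_on_eq_continuous_at vimage_def)
        have c3: "closed {T :: (nat, 'a) ell2 \<Rightarrow>\<^sub>L (nat, 'a) ell2. is_adjoint T T}"
          by (auto simp: closed_sequential_limits intro: is_adjoint_tendsto)
        have "M = {T. T = opmat_blinfun n (entry T)} \<inter> (\<Inter>i\<in>{..<n}. \<Inter>j\<in>{..<n}. {T. entry T i j \<in> A})
            \<inter> {T. is_adjoint T T}"
          by (auto simp: M_def)
        then show ?thesis using c1 c2 c3 by (auto intro!: closed_Int closed_INT)
      qed
      show "0 \<in> M"
        using M_I[of "\<lambda>_ _. 0"] complex_subspaceD(1)[OF sub] is_adjoint_zero
        by (simp add: opmat_blinfun_def)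
      fix z assume zM: "z \<in> M"
      define w where "w i j = complex_of_real (1/2) *\<^sub>C (x i j + (\<Sum>k<n. entry z i k o\<^sub>L entry z k j))" for i j
      have zz: "z = opmat_blinfun n (entry z)" and zA: "\<And>i j. i < n \<Longrightarrow> j < n \<Longrightarrow> entry z i j \<in> A"
        and zs: "is_adjoint z z" using zM unfolding M_def by blast+
      have "z o\<^sub>L z = opmat_blinfun n (\<lambda>i j. \<Sum>k<n. entry z i k o\<^sub>L entry z k j)"
        unfolding opmat_blinfun_compose[symmetric] using zz by simp
      then have eq: "(1/2) *\<^sub>R (X + (z o\<^sub>L z)) = opmat_blinfun n w"
        by (simp add: X opmat_blinfun_add scaleR_scaleC opmat_blinfun_scaleC w_def[abs_def])
      have "is_adjoint (cnj (complex_of_real (1/2)) *\<^sub>C (X + (z o\<^sub>L z))) (complex_of_real (1/2) *\<^sub>C (X + (z o\<^sub>L z)))"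
        by (intro is_adjoint_scaleC is_adjoint_add is_adjoint_compose Xadj zs)
      then have ad: "is_adjoint (opmat_blinfun n w) (opmat_blinfun n w)"
        unfolding eq[symmetric] scaleR_scaleC by simp
      have "w i j \<in> A" if "i < n" "j < n" for i j
        unfolding w_def using that
        by (intro complex_subspaceD[OF sub] complex_subspace_sum[OF sub] mult zA xA) auto
      then show "(1/2) *\<^sub>R (X + (z o\<^sub>L z)) \<in> M" unfolding eq by (rule M_I[OF _ ad])
    qed blast
    define y where "y = entry z"
    have zz: "z = opmat_blinfun n y" and yA: "\<And>i j. i < n \<Longrightarrow> j < n \<Longrightarrow> y i j \<in> A"
      and zs: "is_adjoint z z" using z(1) unfolding M_def y_def by blast+
    have ys: "is_adjoint (y j i) (y i j)" for i j
      unfolding y_def by (rule is_adjoint_entry[OF zs])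
    have "complex_of_real 2 *\<^sub>C z = opmat_blinfun n (\<lambda>i j. x i j + (\<Sum>k<n. y i k o\<^sub>L y k j))"
      using z(2) unfolding scaleR_scaleC unfolding X zz by (simp add: opmat_blinfun_add opmat_blinfun_compose)
    then have eq: "complex_of_real 2 *\<^sub>C y i j = x i j + (\<Sum>k<n. y i k o\<^sub>L y k j)" if "i < n" "j < n" for i j
      using arg_cong[of _ _ "\<lambda>T. entry T i j"] that
      unfolding zz opmat_blinfun_scaleC by (metis (no_types, lifting) entry_opmat_blinfun)
    \<comment> \<open>The same identity for the entrywise images, written with operators again.\<close>
    define \<beta> where "\<beta> = opmat_blinfun n (\<lambda>i j. \<phi> (b i j))"
    define \<beta>' where "\<beta>' = opmat_blinfun n (\<lambda>i j. \<phi> (adj (b j i)))"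
    define \<zeta> where "\<zeta> = opmat_blinfun n (\<lambda>i j. \<phi> (y i j))"
    have \<beta>': "is_adjoint \<beta>' \<beta>"
      unfolding \<beta>_def \<beta>'_def by (intro is_adjoint_opmat_blinfun adj_im adj_in bA)
    have \<zeta>: "is_adjoint \<zeta> \<zeta>"
      unfolding \<zeta>_def by (intro is_adjoint_opmat_blinfun adj_im ys yA)
    have "complex_of_real 2 *\<^sub>C \<phi> (y i j)
      = (\<Sum>k<n. \<phi> (adj (b k i)) o\<^sub>L \<phi> (b k j)) + (\<Sum>k<n. \<phi> (y i k) o\<^sub>L \<phi> (y k j))"
      if ij: "i < n" "j < n" for i j
    proof -
      have "complex_of_real 2 *\<^sub>C \<phi> (y i j) = \<phi> (x i j + (\<Sum>k<n. y i k o\<^sub>L y k j))"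
        using linear_onD(2)[OF lin yA[OF ij]] eq[OF ij] by metis
      also have "\<dots> = \<phi> (x i j) + \<phi> (\<Sum>k<n. y i k o\<^sub>L y k j)"
        using ij by (intro linear_onD[OF lin] xA complex_subspace_sum[OF sub] mult yA) auto
      also have "\<phi> (x i j) = (\<Sum>k<n. \<phi> (adj (b k i)) o\<^sub>L \<phi> (b k j))"
        unfolding x_def using ij
        by (subst linear_on_sum[OF lin sub]) (auto intro!: mult adj_in bA sum.cong \<phi>mult)
      also have "\<phi> (\<Sum>k<n. y i k o\<^sub>L y k j) = (\<Sum>k<n. \<phi> (y i k) o\<^sub>L \<phi> (y k j))"
        using ij by (subst linear_on_sum[OF lin sub]) (auto intro!: mult yA sum.cong \<phi>mult)
      finally show ?thesis .
    qed
    then have eq\<zeta>: "complex_of_real 2 *\<^sub>C \<zeta> = (\<beta>' o\<^sub>L \<beta>) + (\<zeta> o\<^sub>L \<zeta>)"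
      unfolding \<zeta>_def \<beta>_def \<beta>'_def opmat_blinfun_compose opmat_blinfun_add opmat_blinfun_scaleC
      by (rule opmat_blinfun_eqI)
    have "norm \<beta> \<le> 1"
    proof (rule norm_blinfun_bound)
      fix \<xi>
      have two: "2 *\<^sub>C \<zeta> \<xi> = \<zeta> \<xi> + \<zeta> \<xi>"
        using scaleR_scaleC[of 2 "\<zeta> \<xi>"] by (simp add: scaleR_2)
      have "cinner (\<xi> - \<zeta> \<xi>) (\<xi> - \<zeta> \<xi>) = cinner (\<xi> - (\<zeta> \<xi> + \<zeta> \<xi>) + \<zeta> (\<zeta> \<xi>)) \<xi>"
        by (simp add: cinner.diff_left cinner.diff_right cinner_add_left is_adjointD[OF \<zeta>])
      also have "\<zeta> \<xi> + \<zeta> \<xi> = \<beta>' (\<beta> \<xi>) + \<zeta> (\<zeta> \<xi>)"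
        using arg_cong[OF eq\<zeta>, of "\<lambda>T. blinfun_apply T \<xi>"]
        by (simp add: scaleC_blinfun.rep_eq two blinfun.add_left)
      also have "cinner (\<xi> - (\<beta>' (\<beta> \<xi>) + \<zeta> (\<zeta> \<xi>)) + \<zeta> (\<zeta> \<xi>)) \<xi> = cinner \<xi> \<xi> - cinner (\<beta> \<xi>) (\<beta> \<xi>)"
        by (simp add: cinner.diff_left is_adjointD[OF \<beta>'])
      finally have "complex_of_real ((norm (\<xi> - \<zeta> \<xi>))\<^sup>2) = complex_of_real ((norm \<xi>)\<^sup>2 - (norm (\<beta> \<xi>))\<^sup>2)"
        unfolding cinner_self by (simp only: of_real_diff)
      then have "(norm (\<xi> - \<zeta> \<xi>))\<^sup>2 = (norm \<xi>)\<^sup>2 - (norm (\<beta> \<xi>))\<^sup>2" using of_real_eq_iff by blast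
      then have "(norm (\<beta> \<xi>))\<^sup>2 \<le> (norm \<xi>)\<^sup>2" using zero_le_power2[of "norm (\<xi> - \<zeta> \<xi>)"] by linarith
      from power2_le_imp_le[OF this norm_ge_zero] show "norm (\<beta> \<xi>) \<le> 1 * norm \<xi>" by simp
    qed simp
    then show ?thesis by (simp add: \<beta>_def norm_opmat_blinfun)
  qed
  show "opmat_norm n (\<lambda>i j. \<phi> (b i j)) \<le> opmat_norm n b"
  proof (rule dense_ge)
    fix C assume C: "opmat_norm n b < C"
    then have C0: "0 < C" using opmat_norm_nonneg[of n b] by linarith
    define c where "c = complex_of_real (1 / C)"
    have c: "cmod c = 1 / C" using C0 by (simp add: c_def norm_divide)
    have sc: "opmat_norm n (\<lambda>i j. c *\<^sub>C a i j) = opmat_norm n a / C" for a :: "nat \<Rightarrow> nat \<Rightarrow> 'a \<Rightarrow>\<^sub>L 'a"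
      using c by (simp flip: norm_opmat_blinfun opmat_blinfun_scaleC add: norm_scaleC_blinfun)
    have "opmat_norm n (\<lambda>i j. \<phi> (c *\<^sub>C b i j)) \<le> 1"
      using b C C0 complex_subspaceD(3)[OF sub]
      by (intro main) (auto simp: opmat_in_def sc)
    moreover have "opmat_norm n (\<lambda>i j. \<phi> (c *\<^sub>C b i j)) = opmat_norm n (\<lambda>i j. c *\<^sub>C \<phi> (b i j))"
      unfolding norm_opmat_blinfun[symmetric] using b
      by (intro arg_cong[where f = norm] opmat_blinfun_eqI linear_onD(2)[OF lin]) (simp add: opmat_in_def)
    ultimately show "opmat_norm n (\<lambda>i j. \<phi> (b i j)) \<le> C"
      using C0 by (simp add: sc field_simps)
  qed
qed

text \<open>Polarization with the scalars \<open>1\<close> and \<open>\<i>\<close>.\<close>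

lemma positive_op_selfadjoint:
  assumes "positive_op a" "a \<in> bounded_operators" shows "is_adjoint a a"
  unfolding is_adjoint_def
proof (intro allI)
  fix x y
  define f where "f = cinner (a x) y"
  define g where "g = cinner (a y) x"
  have *: "Im (c * f + cnj c * g) = 0" for c
  proof -
    have "cinner (a (c *\<^sub>C x + y)) (c *\<^sub>C x + y)
      = cinner (a y) y + (c * f + cnj c * g) + c * cnj c * cinner (a x) x"
      by (simp add: blinfun.add_right blinfun_scaleC[OF assms(2)] cinner_add_left cinner_add_right
          cinner_scaleC_left cinner_scaleC_right f_def g_def algebra_simps)
    moreover have Im0: "Im (cinner (a z) z) = 0" for z
      using assms(1) by (simp add: positive_op_def complex_nonneg_Reals_iff)
    moreover have "Im (c * cnj c * cinner (a x) x) = 0"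
      using Im0[of x] unfolding complex_norm_square[symmetric] by (simp flip: of_real_power)
    ultimately show ?thesis by (metis Im0 add_0 add_0_right plus_complex.sel(2))
  qed
  have "f = cnj g" using *[of 1] *[of \<i>] by (simp add: complex_eq_iff)
  then show "cinner (a x) y = cinner x (a y)" unfolding f_def g_def by (metis cinner_commute)
qed

text \<open>For \<open>0 \<le> a\<close> one has \<open>\<parallel>\<parallel>a\<parallel> - a\<parallel> \<le> \<parallel>a\<parallel>\<close>; a contraction preserving the unit preserves this
  estimate, which in turn gives positivity of the real part.\<close>

lemma star_automorphism_positive:
  assumes A: "unital_cstar_algebra A" and \<phi>: "star_automorphism A \<phi>" and a: "a \<in> A" "positive_op a"
  shows "positive_op (\<phi> a)" and "\<phi> id_blinfun = id_blinfun"
proof -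
  have sub: "complex_subspace A" and bo: "A \<subseteq> bounded_operators" and idA: "id_blinfun \<in> A"
    using A by (auto simp: unital_cstar_algebra_def)
  have lin: "linear_on A \<phi>" and im: "\<phi> ` A = A"
    and \<phi>mult: "\<And>a b. a \<in> A \<Longrightarrow> b \<in> A \<Longrightarrow> \<phi> (a o\<^sub>L b) = \<phi> a o\<^sub>L \<phi> b"
    and \<phi>adj: "\<And>a. a \<in> A \<Longrightarrow> \<phi> (adj a) = adj (\<phi> a)"
    using \<phi> by (auto simp: star_automorphism_def bij_betw_def)
  obtain e where e: "e \<in> A" "\<phi> e = id_blinfun" using im idA by (metis imageE)
  have "id_blinfun o\<^sub>L e = e" "\<phi> id_blinfun o\<^sub>L id_blinfun = \<phi> id_blinfun"
    by (rule blinfun_eqI, simp)+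
  then have "id_blinfun = \<phi> id_blinfun" using \<phi>mult[OF idA e(1)] e(2) by simp
  then show un: "\<phi> id_blinfun = id_blinfun" by simp
  define C where "C = norm a"
  define b where "b = complex_of_real C *\<^sub>C id_blinfun - a"
  have bA: "b \<in> A" unfolding b_def by (intro complex_subspace_diff complex_subspaceD sub idA a)
  have bx: "b x = complex_of_real C *\<^sub>C x - a x" for x
    by (simp add: b_def blinfun.diff_left scaleC_blinfun.rep_eq)
  have bpos: "cinner (b x) x = complex_of_real (Re (cinner (b x) x))"
    "0 \<le> Re (cinner (b x) x)" "Re (cinner (b x) x) \<le> C * (norm x)\<^sup>2" for x
  proof -
    have ax: "0 \<le> Re (cinner (a x) x)" "Im (cinner (a x) x) = 0"
      using a(2) by (auto simp: positive_op_def complex_nonneg_Reals_iff)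
    have "Re (cinner (a x) x) \<le> cmod (cinner (a x) x)" by (rule complex_Re_le_cmod)
    also have "\<dots> \<le> norm (a x) * norm x" by (rule cinner_Cauchy_Schwarz)
    also have "\<dots> \<le> C * norm x * norm x" unfolding C_def by (intro mult_right_mono norm_blinfun) simp
    finally have "Re (cinner (a x) x) \<le> C * (norm x)\<^sup>2" by (simp add: power2_eq_square)
    then show "cinner (b x) x = complex_of_real (Re (cinner (b x) x))"
      "0 \<le> Re (cinner (b x) x)" "Re (cinner (b x) x) \<le> C * (norm x)\<^sup>2"
      using ax by (simp_all add: bx cinner.diff_left cinner_scaleC_left cinner_self complex_eq_iff)
  qed
  have "norm b \<le> C"
  proof (rule norm_blinfun_bound)
    fix x
    define y where "y = b x"
    have bbo: "b \<in> bounded_operators" using bA bo by auto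
    have "(cmod (cinner (b x) y))\<^sup>2 \<le> Re (cinner (b y) y) * Re (cinner (b x) x)"
    proof (rule positive_form_off_diagonal[where g = "cinner (b y) x"])
      fix c
      have "cinner (b (c *\<^sub>C x + y)) (c *\<^sub>C x + y)
        = cinner (b y) y + c * cinner (b x) y + cnj c * cinner (b y) x + c * cnj c * cinner (b x) x"
        by (simp add: blinfun.add_right blinfun_scaleC[OF bbo] cinner_add_left cinner_add_right
            cinner_scaleC_left cinner_scaleC_right algebra_simps)
      also have "\<dots> = complex_of_real (Re (cinner (b y) y)) + c * cinner (b x) y + cnj c * cinner (b y) x
          + complex_of_real ((cmod c)\<^sup>2 * Re (cinner (b x) x))"
        using bpos(1)[of x] bpos(1)[of y] by (simp only: of_real_mult complex_norm_square)
      finally show "complex_of_real (Re (cinner (b y) y)) + c * cinner (b x) y + cnj c * cinner (b y) x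
          + complex_of_real ((cmod c)\<^sup>2 * Re (cinner (b x) x)) \<in> \<real>\<^sub>\<ge>\<^sub>0"
        using bpos(1,2)[of "c *\<^sub>C x + y"] by (metis nonneg_Reals_of_real_iff)
    qed (rule bpos)
    also have "\<dots> \<le> (C * (norm y)\<^sup>2) * (C * (norm x)\<^sup>2)"
      by (intro mult_mono bpos) (simp add: C_def)
    finally have "(cmod (cinner (b x) y))\<^sup>2 \<le> (norm y)\<^sup>2 * (C * norm x)\<^sup>2"
      by (simp add: power2_eq_square mult_ac)
    moreover have "cmod (cinner (b x) y) = (norm y)\<^sup>2" by (simp add: y_def cinner_self norm_power)
    ultimately have "((norm y)\<^sup>2)\<^sup>2 \<le> (norm y)\<^sup>2 * (C * norm x)\<^sup>2" by simp
    then have "(norm y)\<^sup>2 \<le> (C * norm x)\<^sup>2"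
      by (cases "y = 0") (auto simp: power2_eq_square dest: mult_left_le_imp_le)
    then show "norm (b x) \<le> C * norm x" unfolding y_def
      by (rule power2_le_imp_le) (simp add: C_def)
  qed (simp add: C_def)
  then have nb: "norm (\<phi> b) \<le> C"
    using cb_norm_le_norm[OF star_automorphism_contractive[OF A \<phi>] bA] by simp
  have \<phi>b: "\<phi> b = complex_of_real C *\<^sub>C id_blinfun - \<phi> a"
    unfolding b_def using linear_on_diff[OF lin sub complex_subspaceD(3)[OF sub idA] a(1)]
      linear_onD(2)[OF lin idA] un by simp
  have "is_adjoint (\<phi> a) (\<phi> a)"
  proof -
    have aa: "adj a = a" using positive_op_selfadjoint[OF a(2)] a(1) bo adj_eqI by blast
    have "\<phi> a \<in> A" using im a by auto
    then obtain c where "is_adjoint c (\<phi> a)" using A unfolding unital_cstar_algebra_def by blast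
    then show ?thesis using \<phi>adj[OF a(1)] aa adj_eqI by metis
  qed
  then have Im: "Im (cinner (\<phi> a x) x) = 0" for x
  proof -
    have "cinner (\<phi> a x) x = cnj (cinner (\<phi> a x) x)"
      using is_adjointD[OF \<open>is_adjoint (\<phi> a) (\<phi> a)\<close>, of x x] cinner_commute by metis
    then show ?thesis by (simp add: complex_eq_iff)
  qed
  have Re: "0 \<le> Re (cinner (\<phi> a x) x)" for x
  proof -
    have "Re (cinner (\<phi> b x) x) \<le> norm (\<phi> b x) * norm x"
      using complex_Re_le_cmod cinner_Cauchy_Schwarz order_trans by blast
    also have "\<dots> \<le> (C * norm x) * norm x"
      by (intro mult_right_mono order_trans[OF norm_blinfun]) (auto intro: mult_right_mono nb)
    finally have "Re (cinner (\<phi> b x) x) \<le> C * (norm x)\<^sup>2" by (simp add: power2_eq_square)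
    moreover have "Re (cinner (\<phi> b x) x) = C * (norm x)\<^sup>2 - Re (cinner (\<phi> a x) x)"
      by (simp add: \<phi>b blinfun.diff_left scaleC_blinfun.rep_eq cinner.diff_left cinner_scaleC_left cinner_self)
    ultimately show ?thesis by linarith
  qed
  show "positive_op (\<phi> a)" using Im Re by (simp add: positive_op_def complex_nonneg_Reals_iff)
qed

section \<open>The algebra of the crossed product\<close>

lemma norm_entry_le: "norm (entry T i j) \<le> norm T"
proof (rule norm_blinfun_bound)
  fix h
  have "norm (entry T i j h) \<le> norm (T (point j h))"
    unfolding ell2_apply_entry[symmetric] by (rule norm_ell2_apply_le)
  also have "\<dots> \<le> norm T * norm h" using norm_blinfun[of T "point j h"] by simp
  finally show "norm (entry T i j h) \<le> norm T * norm h" .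
qed simp

lemma entry_add: "entry (S + T) i j = entry S i j + entry T i j"
  by (rule blinfun_eqI) (simp flip: ell2_apply_entry add: blinfun.add_left plus_ell2.rep_eq)

lemma entry_diff: "entry (S - T) i j = entry S i j - entry T i j"
  by (rule blinfun_eqI) (simp flip: ell2_apply_entry add: blinfun.diff_left minus_ell2.rep_eq)

lemma entry_scaleC: "entry (c *\<^sub>C T) i j = c *\<^sub>C entry T i j"
  by (rule blinfun_eqI) (simp flip: ell2_apply_entry add: scaleC_blinfun.rep_eq ell2_apply_scaleC)

lemma entry_zero [simp]: "entry 0 i j = 0"
  by (simp add: entry_def)

lemma entry_sum: "entry (\<Sum>k\<in>I. T k) i j = (\<Sum>k\<in>I. entry (T k) i j)"
  by (simp add: entry_def blinfun_compose_sum_left blinfun_compose_sum_right)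

lemma entry_tendsto: "(f \<longlongrightarrow> T) F \<Longrightarrow> ((\<lambda>n. entry (f n) i j) \<longlongrightarrow> entry T i j) F"
  unfolding entry_def by (intro tendsto_intros)

lemma ell2_apply_left_translation: "ell2_apply (left_translation t \<xi>) s = ell2_apply \<xi> (- t + s)"
  by (simp add: left_translation.rep_eq shift_ell2.rep_eq)

lemma norm_left_translation: "norm (blinfun_apply (left_translation t) \<xi>) = norm \<xi>"
  unfolding norm_ell2.rep_eq ell2_apply_left_translation
  by (simp add: sqsum_translate(2)[of "\<lambda>s. ell2_apply \<xi> s" "- t"])

lemma bounded_operatorsI: "(\<And>c x. blinfun_apply a (c *\<^sub>C x) = c *\<^sub>C blinfun_apply a x) \<Longrightarrow> a \<in> bounded_operators"
  by (simp add: bounded_operators_def)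

lemma closure_complex_subspace:
  fixes V :: "('h :: complex_inner \<Rightarrow>\<^sub>L 'h) set"
  assumes V: "complex_subspace V" shows "complex_subspace (closure V)"
  unfolding complex_subspace_def
proof (intro conjI ballI allI)
  show "0 \<in> closure V" using complex_subspaceD(1)[OF V] closure_subset by blast
  fix x y assume "x \<in> closure V" "y \<in> closure V"
  then obtain f g where "\<And>n. f n \<in> V" "f \<longlonglongrightarrow> x" "\<And>n. g n \<in> V" "g \<longlonglongrightarrow> y"
    unfolding closure_sequential by metis
  then have "\<And>n. f n + g n \<in> V" "(\<lambda>n. f n + g n) \<longlonglongrightarrow> x + y"
    by (auto intro: complex_subspaceD[OF V] tendsto_add)
  then show "x + y \<in> closure V" unfolding closure_sequential by (metis (no_types, lifting))
next
  fix c x assume "x \<in> closure V"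
  then obtain f where f: "\<And>n. f n \<in> V" "f \<longlonglongrightarrow> x" unfolding closure_sequential by metis
  then have "\<And>n. c *\<^sub>C f n \<in> V" "(\<lambda>n. c *\<^sub>C f n) \<longlonglongrightarrow> c *\<^sub>C x"
    using bounded_linear.tendsto[OF bounded_linear_scaleC_blinfun]
    by (auto intro: complex_subspaceD[OF V])
  then show "c *\<^sub>C x \<in> closure V" unfolding closure_sequential by (metis (no_types, lifting))
qed

text \<open>Taking adjoints is isometric, so the adjoints of a convergent sequence converge.\<close>

lemma unital_cstar_algebra_closure:
  fixes V :: "('h :: chilbert_space \<Rightarrow>\<^sub>L 'h) set"
  assumes V: "V \<subseteq> bounded_operators" "complex_subspace V" "id_blinfun \<in> V"
    "\<And>a b. a \<in> V \<Longrightarrow> b \<in> V \<Longrightarrow> a o\<^sub>L b \<in> V" "\<And>a. a \<in> V \<Longrightarrow> \<exists>b\<in>V. is_adjoint b a"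
  shows "unital_cstar_algebra (closure V)"
  unfolding unital_cstar_algebra_def
proof (intro conjI ballI)
  show "closure V \<subseteq> bounded_operators"
  proof
    fix x assume "x \<in> closure V"
    then obtain f where f: "\<And>n. f n \<in> V" "f \<longlonglongrightarrow> x" unfolding closure_sequential by metis
    show "x \<in> bounded_operators"
    proof (rule bounded_operatorsI)
      fix c h
      have 1: "(\<lambda>n. f n (c *\<^sub>C h)) \<longlonglongrightarrow> x (c *\<^sub>C h)" by (intro blinfun.tendsto f tendsto_const)
      have bl: "bounded_linear (\<lambda>y :: 'h. c *\<^sub>C y)"
        by (rule bounded_linear_intro[where K = "cmod c"])
          (simp_all add: scaleC_add_right scaleR_scaleC scaleC_scaleC norm_scaleC mult.commute)
      have "(\<lambda>n. c *\<^sub>C f n h) \<longlonglongrightarrow> c *\<^sub>C x h"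
        by (intro bounded_linear.tendsto[OF bl] blinfun.tendsto f tendsto_const)
      moreover have "f n (c *\<^sub>C h) = c *\<^sub>C f n h" for n
        using f(1) V(1) by (blast intro: blinfun_scaleC)
      ultimately have "(\<lambda>n. f n (c *\<^sub>C h)) \<longlonglongrightarrow> c *\<^sub>C x h" by simp
      with 1 show "x (c *\<^sub>C h) = c *\<^sub>C x h" by (rule LIMSEQ_unique)
    qed
  qed
  show "complex_subspace (closure V)" by (rule closure_complex_subspace[OF V(2)])
  show "closed (closure V)" by simp
  show "id_blinfun \<in> closure V" using V(3) closure_subset by blast
next
  fix x y assume "x \<in> closure V" "y \<in> closure V"
  then obtain f g where "\<And>n. f n \<in> V" "f \<longlonglongrightarrow> x" "\<And>n. g n \<in> V" "g \<longlonglongrightarrow> y"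
    unfolding closure_sequential by metis
  then have "\<And>n. f n o\<^sub>L g n \<in> V" "(\<lambda>n. f n o\<^sub>L g n) \<longlonglongrightarrow> (x o\<^sub>L y)"
    by (auto intro!: V(4) tendsto_intros)
  then show "x o\<^sub>L y \<in> closure V" unfolding closure_sequential by (metis (no_types, lifting))
next
  fix x assume "x \<in> closure V"
  then obtain f where f: "\<And>n. f n \<in> V" "f \<longlonglongrightarrow> x" unfolding closure_sequential by metis
  obtain g where g: "\<And>n. g n \<in> V" "\<And>n. is_adjoint (g n) (f n)" using V(5)[OF f(1)] by metis
  have "Cauchy g"
  proof (rule metric_CauchyI)
    fix e :: real assume "0 < e"
    then obtain M where "\<forall>m\<ge>M. \<forall>n\<ge>M. dist (f m) (f n) < e"
      using LIMSEQ_imp_Cauchy[OF f(2)] unfolding Cauchy_def by blast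
    moreover have "dist (g m) (g n) \<le> dist (f m) (f n)" for m n
      unfolding dist_norm by (intro norm_is_adjoint_le is_adjoint_diff g)
    ultimately show "\<exists>M. \<forall>m\<ge>M. \<forall>n\<ge>M. dist (g m) (g n) < e" by (meson order_le_less_trans)
  qed
  then obtain y where y: "g \<longlonglongrightarrow> y" using Cauchy_convergent convergent_def by blast
  then have "y \<in> closure V" "is_adjoint y x"
    using g f(2) by (auto simp: closure_sequential intro: is_adjoint_tendsto)
  then show "\<exists>b\<in>closure V. is_adjoint b x" by blast
qed

lemma has_sum_sum:
  fixes f :: "'i \<Rightarrow> 'x \<Rightarrow> 'v :: topological_comm_monoid_add"
  shows "(\<And>i. i \<in> I \<Longrightarrow> (f i has_sum S i) X) \<Longrightarrow> ((\<lambda>x. \<Sum>i\<in>I. f i x) has_sum (\<Sum>i\<in>I. S i)) X"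
  by (induction I rule: infinite_finite_induct) (auto intro: has_sum_add)

lemma has_sum_translate:
  fixes f :: "'g :: group_add \<Rightarrow> 'v :: {comm_monoid_add, topological_space}"
  shows "((\<lambda>r. f (s + r)) has_sum S) UNIV \<longleftrightarrow> (f has_sum S) UNIV"
proof -
  have "bij_betw (\<lambda>r. s + r) UNIV (UNIV :: 'g set)"
    by (rule bij_betwI[where g = "\<lambda>r. - s + r"]) (auto simp: add.assoc[symmetric])
  then show ?thesis by (rule has_sum_reindex_bij_betw)
qed

locale dynamics =
  fixes A :: "('h :: chilbert_space \<Rightarrow>\<^sub>L 'h) set"
    and \<alpha> :: "'g :: group_add \<Rightarrow> ('h \<Rightarrow>\<^sub>L 'h) \<Rightarrow> ('h \<Rightarrow>\<^sub>L 'h)"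
  assumes dyn: "cstar_dynamical_system A \<alpha>"
begin

lemma A_alg: "unital_cstar_algebra A" and aut: "star_automorphism A (\<alpha> t)"
  and \<alpha>_add: "a \<in> A \<Longrightarrow> \<alpha> (s + t) a = \<alpha> s (\<alpha> t a)"
  using dyn by (auto simp: cstar_dynamical_system_def)

lemma A_sub: "complex_subspace A" and A_bo: "A \<subseteq> bounded_operators" and A_closed: "closed A"
  and A_mult: "a \<in> A \<Longrightarrow> b \<in> A \<Longrightarrow> a o\<^sub>L b \<in> A" and A_id: "id_blinfun \<in> A"
  using A_alg by (auto simp: unital_cstar_algebra_def)

lemma A_adj: "a \<in> A \<Longrightarrow> adj a \<in> A" "a \<in> A \<Longrightarrow> is_adjoint (adj a) a"
  using A_alg adj_eqI unfolding unital_cstar_algebra_def by blast+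

lemma \<alpha>_lin: "linear_on A (\<alpha> t)" and \<alpha>_in: "a \<in> A \<Longrightarrow> \<alpha> t a \<in> A"
  and \<alpha>_mult: "a \<in> A \<Longrightarrow> b \<in> A \<Longrightarrow> \<alpha> t (a o\<^sub>L b) = \<alpha> t a o\<^sub>L \<alpha> t b"
  and \<alpha>_adj: "a \<in> A \<Longrightarrow> \<alpha> t (adj a) = adj (\<alpha> t a)" and \<alpha>_inj: "inj_on (\<alpha> t) A"
  using aut[of t] by (auto simp: star_automorphism_def bij_betw_def)

lemma \<alpha>_0: "a \<in> A \<Longrightarrow> \<alpha> 0 a = a"
  using \<alpha>_add[of a 0 0] \<alpha>_inj[of 0] \<alpha>_in by (simp add: inj_on_def)

lemma \<alpha>_norm: "a \<in> A \<Longrightarrow> norm (\<alpha> t a) \<le> norm a"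
  using cb_norm_le_norm[OF star_automorphism_contractive[OF A_alg aut]] by simp

lemma \<alpha>_is_adjoint: "a \<in> A \<Longrightarrow> is_adjoint (\<alpha> t (adj a)) (\<alpha> t a)"
  using \<alpha>_adj A_adj \<alpha>_in by metis

lemma \<alpha>_unit: "\<alpha> t id_blinfun = id_blinfun"
  using star_automorphism_positive(2)[OF A_alg aut A_id]
  by (simp add: positive_op_def cinner_self nonneg_Reals_of_real_iff flip: of_real_power)

lemma \<alpha>_tendsto:
  assumes "\<And>n :: nat. f n \<in> A" "f \<longlonglongrightarrow> a"
  shows "(\<lambda>n. \<alpha> t (f n)) \<longlonglongrightarrow> \<alpha> t a"
proof -
  have "a \<in> A" using closed_sequentially[OF A_closed] assms by blast
  from linear_on_tendsto[OF \<alpha>_lin _ A_sub assms(1) this assms(2), where C = 1]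
  show ?thesis by (simp add: \<alpha>_norm)
qed

text \<open>The coordinatewise formula defines a bounded operator because automorphisms are contractive.
  These equations are all that is used of \<open>\<pi>(a)\<close> from here on.\<close>

lemma rep_pi_apply:
  assumes a: "a \<in> A"
  shows "ell2_apply (rep_pi \<alpha> a \<xi>) s = \<alpha> (- s) a (ell2_apply \<xi> s)"
    and "norm (rep_pi \<alpha> a) \<le> norm a"
proof -
  define f where "f \<xi> = Abs_ell2 (\<lambda>s. \<alpha> (- s) a (ell2_apply \<xi> s))" for \<xi>
  have le: "norm (\<alpha> (- s) a h) \<le> norm a * norm h" for s h
    using norm_blinfun[of "\<alpha> (- s) a" h] mult_right_mono[OF \<alpha>_norm[OF a, of "- s"], of "norm h"] by simp
  have le2: "(norm (\<alpha> (- s) a h))\<^sup>2 \<le> (norm a)\<^sup>2 * (norm h)\<^sup>2" for s h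
    using power_mono[OF le norm_ge_zero, of s h 2] by (simp add: power_mult_distrib)
  have sm: "(\<lambda>s. (norm (\<alpha> (- s) a (ell2_apply \<xi> s)))\<^sup>2) summable_on UNIV" for \<xi>
    by (rule summable_on_comparison_test[OF summable_on_cmult_right[OF sqsum_ell2]]) (auto intro: le2)
  have f: "ell2_apply (f \<xi>) s = \<alpha> (- s) a (ell2_apply \<xi> s)" for \<xi> s
    unfolding f_def using sm by (simp add: Abs_ell2_inverse)
  have nf: "norm (f \<xi>) \<le> norm a * norm \<xi>" for \<xi>
  proof -
    have "(norm (f \<xi>))\<^sup>2 \<le> (norm a)\<^sup>2 * (norm \<xi>)\<^sup>2"
      by (rule has_sum_mono[OF norm_ell2_has_sum has_sum_cmult_right[OF norm_ell2_has_sum]])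
        (simp add: f le2)
    then show ?thesis by (metis norm_ge_zero mult_nonneg_nonneg power2_le_imp_le power_mult_distrib)
  qed
  have nf': "norm (f \<xi>) \<le> norm \<xi> * norm a" for \<xi> using nf[of \<xi>] by (simp add: mult.commute)
  have bl: "bounded_linear f"
    by (rule bounded_linear_intro[where K = "norm a"])
      (auto intro!: ell2_eqI simp: f plus_ell2.rep_eq scaleR_ell2.rep_eq blinfun.add_right
        blinfun.scaleR_right nf')
  have eq: "blinfun_apply (rep_pi \<alpha> a) = f"
    unfolding rep_pi_def f_def[symmetric] by (rule bounded_linear_Blinfun_apply[OF bl])
  show "ell2_apply (rep_pi \<alpha> a \<xi>) s = \<alpha> (- s) a (ell2_apply \<xi> s)" by (simp add: eq f)
  show "norm (rep_pi \<alpha> a) \<le> norm a" by (rule norm_blinfun_bound) (simp_all add: eq nf)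
qed

definition monomial :: "('h \<Rightarrow>\<^sub>L 'h) \<Rightarrow> 'g \<Rightarrow> (('g, 'h) ell2 \<Rightarrow>\<^sub>L ('g, 'h) ell2)" where
  "monomial a s = rep_pi \<alpha> a o\<^sub>L left_translation s"

lemma monomial_apply:
  "a \<in> A \<Longrightarrow> ell2_apply (monomial a s \<xi>) r = \<alpha> (- r) a (ell2_apply \<xi> (- s + r))"
  by (simp add: monomial_def rep_pi_apply ell2_apply_left_translation)

lemma monomial_eqI:
  "(\<And>\<xi> r. ell2_apply (blinfun_apply S \<xi>) r = ell2_apply (blinfun_apply T \<xi>) r) \<Longrightarrow> S = T"
  by (intro blinfun_eqI ell2_eqI)

lemma norm_monomial_le: assumes a: "a \<in> A" shows "norm (monomial a s) \<le> norm a"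
proof (rule norm_blinfun_bound)
  fix \<xi>
  have "norm (monomial a s \<xi>) \<le> norm (rep_pi \<alpha> a) * norm \<xi>"
    unfolding monomial_def using norm_blinfun[of "rep_pi \<alpha> a" "left_translation s \<xi>"]
    by (simp add: norm_left_translation)
  then show "norm (monomial a s \<xi>) \<le> norm a * norm \<xi>"
    using mult_right_mono[OF rep_pi_apply(2)[OF a] norm_ge_zero[of \<xi>]] by linarith
qed simp

lemma monomial_add: "a \<in> A \<Longrightarrow> b \<in> A \<Longrightarrow> monomial (a + b) s = monomial a s + monomial b s"
  by (rule monomial_eqI)
    (simp add: monomial_apply complex_subspaceD[OF A_sub] plus_ell2.rep_eq blinfun.add_left linear_onD[OF \<alpha>_lin])

lemma monomial_scaleC: "a \<in> A \<Longrightarrow> monomial (c *\<^sub>C a) s = c *\<^sub>C monomial a s"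
  by (rule monomial_eqI)
    (simp add: monomial_apply complex_subspaceD[OF A_sub] scaleC_blinfun.rep_eq ell2_apply_scaleC linear_onD[OF \<alpha>_lin])

lemma monomial_zero [simp]: "monomial 0 s = 0"
  using monomial_scaleC[OF complex_subspaceD(1)[OF A_sub], of 0 s] by simp

lemma monomial_diff: "a \<in> A \<Longrightarrow> b \<in> A \<Longrightarrow> monomial (a - b) s = monomial a s - monomial b s"
  using monomial_add[of "a - b" b s] complex_subspace_diff[OF A_sub] by simp

lemma monomial_bo: "a \<in> A \<Longrightarrow> monomial a s \<in> bounded_operators"
  using \<alpha>_in A_bo
  by (intro bounded_operatorsI ell2_eqI) (auto simp: monomial_apply ell2_apply_scaleC intro!: blinfun_scaleC)

lemma monomial_mult:
  assumes "a \<in> A" "b \<in> A"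
  shows "monomial a s o\<^sub>L monomial b t = monomial (a o\<^sub>L \<alpha> s b) (s + t)"
proof (rule monomial_eqI)
  fix \<xi> r
  have "\<alpha> (- (- s + r)) b = \<alpha> (- r) (\<alpha> s b)"
    using \<alpha>_add[OF assms(2), of "- r" s] by (simp add: minus_add)
  moreover have "- t + (- s + r) = - (s + t) + r" by (simp only: minus_add add.assoc)
  ultimately show "ell2_apply ((monomial a s o\<^sub>L monomial b t) \<xi>) r
      = ell2_apply (monomial (a o\<^sub>L \<alpha> s b) (s + t) \<xi>) r"
    using assms by (simp add: monomial_apply A_mult \<alpha>_in \<alpha>_mult)
qed

lemma monomial_id: "monomial id_blinfun 0 = id_blinfun"
  by (rule monomial_eqI) (simp add: monomial_apply A_id \<alpha>_unit)

lemma monomial_adjoint: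
  assumes a: "a \<in> A"
  shows "is_adjoint (monomial (\<alpha> (- s) (adj a)) (- s)) (monomial a s)"
  unfolding is_adjoint_def
proof (intro allI)
  fix \<xi> \<eta>
  have "((\<lambda>p. cinner (ell2_apply \<xi> p) (ell2_apply (monomial a s \<eta>) p)) has_sum
      cinner \<xi> (monomial a s \<eta>)) UNIV" by (rule cinner_ell2_has_sum)
  then have "((\<lambda>r. cinner (ell2_apply \<xi> (s + r)) (ell2_apply (monomial a s \<eta>) (s + r))) has_sum
      cinner \<xi> (monomial a s \<eta>)) UNIV" by (subst has_sum_translate)
  moreover have "cinner (ell2_apply \<xi> (s + r)) (ell2_apply (monomial a s \<eta>) (s + r))
    = cinner (ell2_apply (monomial (\<alpha> (- s) (adj a)) (- s) \<xi>) r) (ell2_apply \<eta> r)" for r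
  proof -
    have "\<alpha> (- r) (\<alpha> (- s) (adj a)) = \<alpha> (- (s + r)) (adj a)"
      using \<alpha>_add[OF A_adj(1)[OF a], of "- r" "- s"] by (simp add: minus_add)
    then show ?thesis
      using a by (simp add: monomial_apply A_adj \<alpha>_in is_adjointD[OF \<alpha>_is_adjoint] add.assoc[symmetric])
  qed
  ultimately have "((\<lambda>r. cinner (ell2_apply (monomial (\<alpha> (- s) (adj a)) (- s) \<xi>) r) (ell2_apply \<eta> r)) has_sum
      cinner \<xi> (monomial a s \<eta>)) UNIV" by simp
  then show "cinner (monomial (\<alpha> (- s) (adj a)) (- s) \<xi>) \<eta> = cinner \<xi> (monomial a s \<eta>)"
    by (rule has_sum_unique[OF cinner_ell2_has_sum])
qed

lemma entry_monomial:
  assumes a: "a \<in> A"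
  shows "entry (monomial a s) r t = (if r = s + t then \<alpha> (- r) a else 0)"
proof (rule blinfun_eqI)
  fix h
  have "- s + r = t \<longleftrightarrow> r = s + t" by (metis add.assoc add_0 left_minus right_minus)
  then show "entry (monomial a s) r t h = (if r = s + t then \<alpha> (- r) a else 0) h"
    unfolding ell2_apply_entry[symmetric] by (simp add: monomial_apply[OF a] blinfun.zero_right)
qed

text \<open>Coordinate by coordinate, this is the complete contractivity of the automorphisms.\<close>

lemma monomial_completely_contractive:
  assumes a: "opmat_in n A a"
  shows "opmat_norm n (\<lambda>i j. monomial (a i j) t) \<le> opmat_norm n a"
proof (rule opmat_norm_leI)
  fix \<xi> :: "nat \<Rightarrow> ('g, 'h) ell2"
  define N where "N = opmat_norm n a"
  have aA: "a i j \<in> A" if "i < n" "j < n" for i j using a that by (simp add: opmat_in_def)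
  have sh: "((\<lambda>r. (norm (ell2_apply (\<xi> j) (- t + r)))\<^sup>2) has_sum (norm (\<xi> j))\<^sup>2) UNIV" for j
    by (subst has_sum_translate) (rule norm_ell2_has_sum)
  have "(\<Sum>i<n. (norm (\<Sum>j<n. monomial (a i j) t (\<xi> j)))\<^sup>2) \<le> N\<^sup>2 * (\<Sum>j<n. (norm (\<xi> j))\<^sup>2)"
  proof (rule has_sum_mono)
    show "((\<lambda>r. \<Sum>i<n. (norm (ell2_apply (\<Sum>j<n. monomial (a i j) t (\<xi> j)) r))\<^sup>2) has_sum
        (\<Sum>i<n. (norm (\<Sum>j<n. monomial (a i j) t (\<xi> j)))\<^sup>2)) UNIV"
      by (intro has_sum_sum norm_ell2_has_sum)
    show "((\<lambda>r. N\<^sup>2 * (\<Sum>j<n. (norm (ell2_apply (\<xi> j) (- t + r)))\<^sup>2)) has_sum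
        N\<^sup>2 * (\<Sum>j<n. (norm (\<xi> j))\<^sup>2)) UNIV"
      by (intro has_sum_cmult_right has_sum_sum sh)
    fix r
    have "opmat_norm n (\<lambda>i j. \<alpha> (- r) (a i j)) \<le> N"
      using star_automorphism_contractive[OF A_alg aut, of "- r"] a unfolding cb_norm_le_def N_def by simp
    then have "(opmat_norm n (\<lambda>i j. \<alpha> (- r) (a i j)))\<^sup>2 \<le> N\<^sup>2" by (intro power_mono) auto
    then have "(\<Sum>i<n. (norm (\<Sum>j<n. \<alpha> (- r) (a i j) (ell2_apply (\<xi> j) (- t + r))))\<^sup>2)
        \<le> N\<^sup>2 * (\<Sum>j<n. (norm (ell2_apply (\<xi> j) (- t + r)))\<^sup>2)"
      by (intro order_trans[OF opmat_norm_bound] mult_right_mono) (auto simp: sum_nonneg)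
    then show "(\<Sum>i<n. (norm (ell2_apply (\<Sum>j<n. monomial (a i j) t (\<xi> j)) r))\<^sup>2)
        \<le> N\<^sup>2 * (\<Sum>j<n. (norm (ell2_apply (\<xi> j) (- t + r)))\<^sup>2)"
      by (simp add: monomial_apply aA)
  qed
  then show "(\<Sum>i<n. (norm (\<Sum>j<n. monomial (a i j) t (\<xi> j)))\<^sup>2)
      \<le> (opmat_norm n a)\<^sup>2 * (\<Sum>j<n. (norm (\<xi> j))\<^sup>2)" unfolding N_def .
qed simp

text \<open>The algebraic crossed product. Unlike the image of the absolutely summable functions, it is
  visibly closed under products and adjoints, and on it the Fourier coefficients determine an
  element by a finite sum. Its closure is the crossed product as well.\<close>

definition finsums :: "(('g, 'h) ell2 \<Rightarrow>\<^sub>L ('g, 'h) ell2) set" where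
  "finsums = {\<Sum>s\<in>K. monomial (f s) s | K f. finite K \<and> (\<forall>s. f s \<in> A)}"

lemma finsumsE:
  assumes "x \<in> finsums"
  obtains K f where "finite K" "\<And>s. f s \<in> A" "x = (\<Sum>s\<in>K. monomial (f s) s)"
  using assms unfolding finsums_def by blast

lemma finsumsI: "finite K \<Longrightarrow> (\<And>s. f s \<in> A) \<Longrightarrow> (\<Sum>s\<in>K. monomial (f s) s) \<in> finsums"
  unfolding finsums_def by blast

lemma finsums_monomial: "a \<in> A \<Longrightarrow> monomial a s \<in> finsums"
  using finsumsI[of "{s}" "\<lambda>_. a"] by simp

lemma finsums_subspace: "complex_subspace finsums"
  unfolding complex_subspace_def
proof (intro conjI ballI allI)
  show "0 \<in> finsums" using finsums_monomial[of 0 0] complex_subspaceD(1)[OF A_sub] by simp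
  fix x y assume xy: "x \<in> finsums" "y \<in> finsums"
  from xy(1) obtain K f where K: "finite K" "\<And>s. f s \<in> A" "x = (\<Sum>s\<in>K. monomial (f s) s)"
    by (rule finsumsE) blast
  from xy(2) obtain L g where L: "finite L" "\<And>s. g s \<in> A" "y = (\<Sum>s\<in>L. monomial (g s) s)"
    by (rule finsumsE) blast
  define f' where "f' s = (if s \<in> K then f s else 0)" for s
  define g' where "g' s = (if s \<in> L then g s else 0)" for s
  have in': "f' s \<in> A" "g' s \<in> A" for s using K L complex_subspaceD[OF A_sub] by (auto simp: f'_def g'_def)
  have "x = (\<Sum>s\<in>K \<union> L. monomial (f' s) s)"
    unfolding K(3) by (rule sum.mono_neutral_cong_left) (auto simp: K L f'_def)
  moreover have "y = (\<Sum>s\<in>K \<union> L. monomial (g' s) s)"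
    unfolding L(3) by (rule sum.mono_neutral_cong_left) (auto simp: K L g'_def)
  ultimately have "x + y = (\<Sum>s\<in>K \<union> L. monomial (f' s + g' s) s)"
    by (simp add: monomial_add in' sum.distrib)
  then show "x + y \<in> finsums" using K L in' by (auto intro!: finsumsI complex_subspaceD[OF A_sub])
next
  fix c x assume "x \<in> finsums"
  then obtain K f where K: "finite K" "\<And>s. f s \<in> A" "x = (\<Sum>s\<in>K. monomial (f s) s)" by (rule finsumsE) blast
  then have "c *\<^sub>C x = (\<Sum>s\<in>K. monomial (c *\<^sub>C f s) s)" by (simp add: scaleC_sum_right monomial_scaleC)
  then show "c *\<^sub>C x \<in> finsums" using K by (auto intro!: finsumsI complex_subspaceD[OF A_sub])
qed

lemma finsums_id: "id_blinfun \<in> finsums"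
  using finsums_monomial[OF A_id, of 0] by (simp add: monomial_id)

lemma finsums_mult: assumes "x \<in> finsums" "y \<in> finsums" shows "x o\<^sub>L y \<in> finsums"
proof -
  from assms(1) obtain K f where K: "finite K" "\<And>s. f s \<in> A" "x = (\<Sum>s\<in>K. monomial (f s) s)"
    by (rule finsumsE) blast
  from assms(2) obtain L g where L: "finite L" "\<And>s. g s \<in> A" "y = (\<Sum>s\<in>L. monomial (g s) s)"
    by (rule finsumsE) blast
  have "x o\<^sub>L y = (\<Sum>s\<in>K. \<Sum>t\<in>L. monomial (f s o\<^sub>L \<alpha> s (g t)) (s + t))"
    unfolding K(3) L(3) blinfun_compose_sum_left unfolding blinfun_compose_sum_right
    by (simp add: monomial_mult K L)
  then show ?thesis
    by (auto intro!: complex_subspace_sum[OF finsums_subspace] finsums_monomial A_mult \<alpha>_in K L)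
qed

lemma finsums_adjoint: assumes "x \<in> finsums" shows "\<exists>y\<in>finsums. is_adjoint y x"
proof -
  from assms obtain K f where K: "finite K" "\<And>s. f s \<in> A" "x = (\<Sum>s\<in>K. monomial (f s) s)"
    by (rule finsumsE) blast
  have "is_adjoint (\<Sum>s\<in>K. monomial (\<alpha> (- s) (adj (f s))) (- s)) x"
    unfolding K(3) by (intro is_adjoint_sum monomial_adjoint K)
  moreover have "(\<Sum>s\<in>K. monomial (\<alpha> (- s) (adj (f s))) (- s)) \<in> finsums"
    by (intro complex_subspace_sum[OF finsums_subspace] finsums_monomial \<alpha>_in A_adj K)
  ultimately show ?thesis by blast
qed

lemma finsums_bo: "finsums \<subseteq> bounded_operators"
proof
  fix x assume "x \<in> finsums"
  then obtain K f where K: "finite K" "\<And>s. f s \<in> A" "x = (\<Sum>s\<in>K. monomial (f s) s)" by (rule finsumsE) blast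
  show "x \<in> bounded_operators"
    unfolding K(3) using K(2)
    by (intro bounded_operatorsI)
      (auto simp: blinfun.sum_left scaleC_sum_right intro!: sum.cong blinfun_scaleC monomial_bo)
qed

lemma pi_tilde_has_sum:
  assumes f: "f \<in> l1_functions A"
  shows "((\<lambda>s. monomial (f s) s) has_sum pi_tilde \<alpha> f) UNIV"
proof -
  have fA: "f s \<in> A" for s using f by (auto simp: l1_functions_def)
  have "(\<lambda>s. norm (f s)) summable_on UNIV" using f by (simp add: l1_functions_def)
  then have "(\<lambda>s. norm (monomial (f s) s)) summable_on UNIV"
    by (rule summable_on_comparison_test) (auto intro: norm_monomial_le fA)
  then have "(\<lambda>s. monomial (f s) s) summable_on UNIV" by (rule abs_summable_summable)
  then show ?thesis unfolding pi_tilde_def monomial_def by (rule has_sum_infsum)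
qed

lemma pi_tilde_finite:
  assumes "finite K" "\<And>s. f s \<in> A" "\<And>s. s \<notin> K \<Longrightarrow> f s = 0"
  shows "f \<in> l1_functions A" "pi_tilde \<alpha> f = (\<Sum>s\<in>K. monomial (f s) s)"
proof -
  have "(\<lambda>s. norm (f s)) summable_on K" using assms(1) by simp
  then have "(\<lambda>s. norm (f s)) summable_on UNIV"
    by (rule summable_on_cong_neutral[THEN iffD1, rotated -1]) (auto simp: assms)
  then show f: "f \<in> l1_functions A" using assms(2) by (auto simp: l1_functions_def)
  have "((\<lambda>s. monomial (f s) s) has_sum (\<Sum>s\<in>K. monomial (f s) s)) K"
    using assms(1) by (rule has_sum_finite)
  then have "((\<lambda>s. monomial (f s) s) has_sum (\<Sum>s\<in>K. monomial (f s) s)) UNIV"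
    by (rule has_sum_cong_neutral[THEN iffD1, rotated -1]) (auto simp: assms)
  then show "pi_tilde \<alpha> f = (\<Sum>s\<in>K. monomial (f s) s)"
    by (rule has_sum_unique[OF pi_tilde_has_sum[OF f]])
qed

lemma finsums_pi_tilde:
  assumes "x \<in> finsums"
  obtains f where "f \<in> l1_functions A" "x = pi_tilde \<alpha> f"
proof -
  from assms obtain K f where K: "finite K" "\<And>s. f s \<in> A" "x = (\<Sum>s\<in>K. monomial (f s) s)"
    by (rule finsumsE) blast
  define g where "g s = (if s \<in> K then f s else 0)" for s
  have "(\<Sum>s\<in>K. monomial (f s) s) = (\<Sum>s\<in>K. monomial (g s) s)" by (simp add: g_def)
  then show thesis
    using that[of g] pi_tilde_finite[of K g] K complex_subspaceD(1)[OF A_sub] by (auto simp: g_def)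
qed

abbreviation B :: "(('g, 'h) ell2 \<Rightarrow>\<^sub>L ('g, 'h) ell2) set" where "B \<equiv> crossed_product A \<alpha>"

lemma B_closure: "B = closure finsums"
proof
  have "pi_tilde \<alpha> f \<in> closure finsums" if f: "f \<in> l1_functions A" for f
  proof (rule Lim_in_closed_set)
    have fA: "f s \<in> A" for s using f by (auto simp: l1_functions_def)
    show "((\<lambda>K. \<Sum>s\<in>K. monomial (f s) s) \<longlongrightarrow> pi_tilde \<alpha> f) (finite_subsets_at_top UNIV)"
      using pi_tilde_has_sum[OF f] by (simp add: has_sum_def)
    show "\<forall>\<^sub>F K in finite_subsets_at_top UNIV. (\<Sum>s\<in>K. monomial (f s) s) \<in> closure finsums"
      by (rule eventually_finite_subsets_at_top_weakI, rule subsetD[OF closure_subset],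
          rule finsumsI[OF _ fA])
  qed auto
  then show "B \<subseteq> closure finsums" unfolding crossed_product_def by (intro closure_minimal) auto
  show "closure finsums \<subseteq> B"
    unfolding crossed_product_def by (rule closure_mono) (blast elim: finsums_pi_tilde)
qed

lemma B_alg: "unital_cstar_algebra B"
  unfolding B_closure
  by (rule unital_cstar_algebra_closure[OF finsums_bo finsums_subspace finsums_id finsums_mult finsums_adjoint])

lemma B_sub: "complex_subspace B" and B_id: "id_blinfun \<in> B"
  using B_alg by (auto simp: unital_cstar_algebra_def)

lemma linear_on_monomial: "linear_on A (\<lambda>a. monomial a s)"
  by (simp add: linear_on_def monomial_add monomial_scaleC)

lemma finsums_B: "x \<in> finsums \<Longrightarrow> x \<in> B"
  unfolding B_closure using closure_subset by blast

lemma monomial_B: "a \<in> A \<Longrightarrow> monomial a s \<in> B"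
  by (simp add: finsums_B finsums_monomial)

lemma pi_tilde_B: "f \<in> l1_functions A \<Longrightarrow> pi_tilde \<alpha> f \<in> B"
  unfolding crossed_product_def by (rule subsetD[OF closure_subset imageI])

lemma B_sequence:
  assumes "x \<in> B" obtains f where "\<And>n :: nat. f n \<in> finsums" "f \<longlonglongrightarrow> x"
  using assms unfolding B_closure closure_sequential by blast

text \<open>The Fourier coefficient \<open>\<E>(x \<lambda>\<^sub>s\<^sup>*)\<close>. The conditional expectation is the compression to the
  unit coordinate, and \<open>\<lambda>\<^sub>s\<^sup>*\<close> moves this coordinate to \<open>s\<^sup>-\<^sup>1\<close>, which is written \<open>- s\<close>.\<close>

definition fcoeff :: "(('g, 'h) ell2 \<Rightarrow>\<^sub>L ('g, 'h) ell2) \<Rightarrow> 'g \<Rightarrow> ('h \<Rightarrow>\<^sub>L 'h)" where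
  "fcoeff x s = entry x 0 (- s)"

lemma fcoeff_add: "fcoeff (x + y) s = fcoeff x s + fcoeff y s" by (simp add: fcoeff_def entry_add)
lemma fcoeff_diff: "fcoeff (x - y) s = fcoeff x s - fcoeff y s" by (simp add: fcoeff_def entry_diff)
lemma fcoeff_scaleC: "fcoeff (c *\<^sub>C x) s = c *\<^sub>C fcoeff x s" by (simp add: fcoeff_def entry_scaleC)
lemma fcoeff_sum: "fcoeff (\<Sum>i\<in>I. f i) s = (\<Sum>i\<in>I. fcoeff (f i) s)" by (simp add: fcoeff_def entry_sum)
lemma norm_fcoeff_le: "norm (fcoeff x s) \<le> norm x" by (simp add: fcoeff_def norm_entry_le)
lemma fcoeff_tendsto: "(f \<longlongrightarrow> x) F \<Longrightarrow> ((\<lambda>n. fcoeff (f n) s) \<longlongrightarrow> fcoeff x s) F"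
  by (simp add: fcoeff_def entry_tendsto)

lemma fcoeff_monomial: "a \<in> A \<Longrightarrow> fcoeff (monomial a s) t = (if s = t then a else 0)"
  by (auto simp: fcoeff_def entry_monomial \<alpha>_0 eq_neg_iff_add_eq_0 add_eq_0_iff)

lemma fcoeff_finsum:
  assumes "finite K" "\<And>s. f s \<in> A"
  shows "fcoeff (\<Sum>s\<in>K. monomial (f s) s) t = (if t \<in> K then f t else 0)"
  using assms by (simp add: fcoeff_sum fcoeff_monomial)

lemma finsums_fcoeff:
  assumes "x \<in> finsums"
  obtains K where "finite K" "x = (\<Sum>s\<in>K. monomial (fcoeff x s) s)" "\<And>s. s \<notin> K \<Longrightarrow> fcoeff x s = 0"
proof -
  from assms obtain K f where K: "finite K" "\<And>s. f s \<in> A" "x = (\<Sum>s\<in>K. monomial (f s) s)"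
    by (rule finsumsE) blast
  have "fcoeff x t = (if t \<in> K then f t else 0)" for t unfolding K(3) by (rule fcoeff_finsum[OF K(1,2)])
  then show thesis using that[of K] K by simp
qed

lemma fcoeff_A: assumes x: "x \<in> B" shows "fcoeff x s \<in> A"
proof -
  obtain f where f: "\<And>n. f n \<in> finsums" "f \<longlonglongrightarrow> x" using B_sequence[OF x] by blast
  have "fcoeff y s \<in> A" if "y \<in> finsums" for y
    using that complex_subspaceD(1)[OF A_sub] by (elim finsumsE) (simp add: fcoeff_finsum)
  then show ?thesis using f by (intro closed_sequentially[OF A_closed _ fcoeff_tendsto[OF f(2)]]) auto
qed

text \<open>Both sides are continuous in \<open>x\<close> and linear, and for a monomial this is the formula for its
  entries. Hence the row of the unit determines the whole matrix, which is equivariant along the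
  diagonals; this is what lets operations on Fourier coefficients be read off from entries.\<close>

lemma entry_B: assumes x: "x \<in> B" shows "entry x r t = \<alpha> (- r) (fcoeff x (r - t))"
proof -
  obtain f where f: "\<And>n. f n \<in> finsums" "f \<longlonglongrightarrow> x" using B_sequence[OF x] by blast
  have fin: "entry y r t = \<alpha> (- r) (fcoeff y (r - t))" if y: "y \<in> finsums" for y
  proof -
    from y obtain K where K: "finite K" "y = (\<Sum>s\<in>K. monomial (fcoeff y s) s)" "\<And>s. s \<notin> K \<Longrightarrow> fcoeff y s = 0"
      by (rule finsums_fcoeff) blast
    have yA: "fcoeff y s \<in> A" for s by (rule fcoeff_A[OF finsums_B[OF y]])
    have *: "r = s + t \<longleftrightarrow> s = r - t" for s by (auto simp: algebra_simps)
    have "entry y r t = (\<Sum>s\<in>K. entry (monomial (fcoeff y s) s) r t)"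
      by (subst K(2)) (rule entry_sum)
    also have "\<dots> = (\<Sum>s\<in>K. if s = r - t then \<alpha> (- r) (fcoeff y s) else 0)"
      by (simp add: entry_monomial yA *)
    also have "\<dots> = \<alpha> (- r) (fcoeff y (r - t))"
      using K(1,3) by (simp add: linear_on_zero[OF \<alpha>_lin A_sub])
    finally show ?thesis .
  qed
  have "(\<lambda>n. entry (f n) r t) \<longlonglongrightarrow> entry x r t" by (rule entry_tendsto[OF f(2)])
  moreover have "(\<lambda>n. entry (f n) r t) \<longlonglongrightarrow> \<alpha> (- r) (fcoeff x (r - t))"
    unfolding fin[OF f(1)] by (intro \<alpha>_tendsto fcoeff_A finsums_B f fcoeff_tendsto)
  ultimately show ?thesis by (rule LIMSEQ_unique)
qed

lemma pi_tilde_fcoeff: assumes f: "f \<in> l1_functions A" shows "fcoeff (pi_tilde \<alpha> f) s = f s"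
proof -
  have fA: "f s \<in> A" for s using f by (auto simp: l1_functions_def)
  have "bounded_linear (\<lambda>x. fcoeff x s)"
    unfolding fcoeff_def entry_def by (intro bounded_linear_intros)
  from has_sum_bounded_linear[OF this pi_tilde_has_sum[OF f]]
  have "((\<lambda>t. if t = s then f t else 0) has_sum fcoeff (pi_tilde \<alpha> f) s) UNIV"
    by (simp add: o_def fcoeff_monomial fA)
  moreover have "((\<lambda>t. if t = s then f t else 0) has_sum f s) {s}"
    using has_sum_finite[of "{s}" "\<lambda>t. if t = s then f t else 0"] by simp
  then have "((\<lambda>t. if t = s then f t else 0) has_sum f s) UNIV"
    by (rule has_sum_cong_neutral[THEN iffD1, rotated -1]) auto
  ultimately show ?thesis by (rule has_sum_unique)
qed

text \<open>The compression to the unit coordinate satisfies the conditions that define the conditional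
  expectation, and these determine it on the algebraic crossed product and hence, by
  continuity, on its closure.\<close>

lemma cond_expectation_fcoeff: assumes x: "x \<in> B" shows "cond_expectation A \<alpha> x = fcoeff x 0"
proof -
  define P where "P E \<longleftrightarrow> E ` B \<subseteq> A \<and> linear_on B E \<and> (\<forall>x\<in>B. norm (E x) \<le> norm x) \<and>
     (\<forall>a\<in>A. \<forall>s. E (rep_pi \<alpha> a o\<^sub>L left_translation s) = (if s = 0 then a else 0))" for E
  have "P (\<lambda>x. fcoeff x 0)"
    unfolding P_def monomial_def[symmetric]
    by (auto simp: fcoeff_A linear_on_def fcoeff_add fcoeff_scaleC norm_fcoeff_le fcoeff_monomial)
  then have "P (SOME E. P E)" by (rule someI[of P])
  then have "P (cond_expectation A \<alpha>)" unfolding cond_expectation_def P_def .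
  then obtain E where E: "E = cond_expectation A \<alpha>" "linear_on B E" "\<And>x. x \<in> B \<Longrightarrow> norm (E x) \<le> norm x"
    "\<And>a s. a \<in> A \<Longrightarrow> E (monomial a s) = (if s = 0 then a else 0)"
    unfolding P_def monomial_def by blast
  have fin: "E y = fcoeff y 0" if "y \<in> finsums" for y
  proof -
    from that obtain K f where K: "finite K" "\<And>s. f s \<in> A" "y = (\<Sum>s\<in>K. monomial (f s) s)"
      by (rule finsumsE) blast
    have "E y = (\<Sum>s\<in>K. E (monomial (f s) s))"
      unfolding K(3) by (rule linear_on_sum[OF E(2) B_sub]) (simp add: monomial_B K)
    also have "\<dots> = (\<Sum>s\<in>K. fcoeff (monomial (f s) s) 0)" by (simp add: E(4) fcoeff_monomial K(2))
    finally show ?thesis unfolding K(3) fcoeff_sum .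
  qed
  obtain f where f: "\<And>n. f n \<in> finsums" "f \<longlonglongrightarrow> x" using B_sequence[OF x] by blast
  have "(\<lambda>n. E (f n)) \<longlonglongrightarrow> E x"
    by (rule linear_on_tendsto[OF E(2) _ B_sub finsums_B[OF f(1)] x f(2), where C = 1]) (simp add: E(3))
  then have "(\<lambda>n. fcoeff (f n) 0) \<longlonglongrightarrow> E x" by (simp add: fin f(1))
  from LIMSEQ_unique[OF this fcoeff_tendsto[OF f(2)]] show ?thesis by (simp add: E(1))
qed

end

section \<open>The seminorm of a state\<close>

locale cstar_state =
  fixes B :: "('h :: chilbert_space \<Rightarrow>\<^sub>L 'h) set" and \<sigma> :: "('h \<Rightarrow>\<^sub>L 'h) \<Rightarrow> complex"
  assumes alg: "unital_cstar_algebra B"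
    and \<sigma>_add: "a \<in> B \<Longrightarrow> b \<in> B \<Longrightarrow> \<sigma> (a + b) = \<sigma> a + \<sigma> b"
    and \<sigma>_scaleC: "a \<in> B \<Longrightarrow> \<sigma> (c *\<^sub>C a) = c * \<sigma> a"
    and \<sigma>_pos: "a \<in> B \<Longrightarrow> positive_op a \<Longrightarrow> \<sigma> a \<in> \<real>\<^sub>\<ge>\<^sub>0"
    and \<sigma>_id: "\<sigma> id_blinfun = 1"
begin

lemma sub: "complex_subspace B" and bo: "B \<subseteq> bounded_operators"
  and mult: "a \<in> B \<Longrightarrow> b \<in> B \<Longrightarrow> a o\<^sub>L b \<in> B" and idB: "id_blinfun \<in> B"
  using alg by (auto simp: unital_cstar_algebra_def)

lemma adjB: "a \<in> B \<Longrightarrow> adj a \<in> B" "a \<in> B \<Longrightarrow> is_adjoint (adj a) a"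
  using alg adj_eqI unfolding unital_cstar_algebra_def by blast+

lemmas subB = complex_subspaceD[OF sub] complex_subspace_diff[OF sub]

lemma \<sigma>_diff: "a \<in> B \<Longrightarrow> b \<in> B \<Longrightarrow> \<sigma> (a - b) = \<sigma> a - \<sigma> b"
  using \<sigma>_add[of "a - b" b] subB by simp

definition ip :: "('h \<Rightarrow>\<^sub>L 'h) \<Rightarrow> ('h \<Rightarrow>\<^sub>L 'h) \<Rightarrow> complex" where
  "ip a b = \<sigma> (adj a o\<^sub>L b)"

lemma ip_add_right: "a \<in> B \<Longrightarrow> b \<in> B \<Longrightarrow> c \<in> B \<Longrightarrow> ip a (b + c) = ip a b + ip a c"
  by (simp add: ip_def bounded_bilinear.add_right[OF bounded_bilinear_blinfun_compose] \<sigma>_add mult adjB)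

lemma ip_scaleC_right: "a \<in> B \<Longrightarrow> b \<in> B \<Longrightarrow> ip a (c *\<^sub>C b) = c * ip a b"
  using adjB(1)[of a] bo by (auto simp: ip_def compose_scaleC_right \<sigma>_scaleC mult)

lemma ip_add_left: assumes "a \<in> B" "b \<in> B" "c \<in> B" shows "ip (a + b) c = ip a c + ip b c"
proof -
  have "adj (a + b) = adj a + adj b" by (intro adj_eqI is_adjoint_add adjB assms)
  then show ?thesis
    using assms by (simp add: ip_def bounded_bilinear.add_left[OF bounded_bilinear_blinfun_compose] \<sigma>_add mult adjB)
qed

lemma ip_scaleC_left: assumes "a \<in> B" "b \<in> B" shows "ip (c *\<^sub>C a) b = cnj c * ip a b"
proof -
  have "adj (c *\<^sub>C a) = cnj c *\<^sub>C adj a" by (intro adj_eqI is_adjoint_scaleC adjB assms)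
  then show ?thesis using assms by (simp add: ip_def compose_scaleC_left \<sigma>_scaleC mult adjB)
qed

lemma positive_op_square: "a \<in> B \<Longrightarrow> positive_op (adj a o\<^sub>L a)"
  unfolding positive_op_def
  by (auto simp: is_adjointD[OF adjB(2)] cinner_self nonneg_Reals_of_real_iff simp flip: of_real_power)

lemma ip_self: assumes "a \<in> B" shows "ip a a = complex_of_real ((norm2 \<sigma> a)\<^sup>2)"
proof -
  have "ip a a \<in> \<real>\<^sub>\<ge>\<^sub>0" unfolding ip_def by (intro \<sigma>_pos mult adjB assms positive_op_square)
  then show ?thesis by (simp add: norm2_def ip_def complex_nonneg_Reals_iff complex_eq_iff)
qed

lemma norm2_nonneg [simp]: "a \<in> B \<Longrightarrow> 0 \<le> norm2 \<sigma> a"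
  using \<sigma>_pos[OF mult[OF adjB(1)] positive_op_square]
  by (simp add: norm2_def complex_nonneg_Reals_iff)

lemma ip_Cauchy_Schwarz:
  assumes a: "a \<in> B" and b: "b \<in> B" shows "cmod (ip b a) \<le> norm2 \<sigma> b * norm2 \<sigma> a"
proof -
  have "(cmod (ip b a))\<^sup>2 \<le> (norm2 \<sigma> b)\<^sup>2 * (norm2 \<sigma> a)\<^sup>2"
  proof (rule positive_form_off_diagonal[where g = "ip a b"])
    fix c
    have ca: "c *\<^sub>C a \<in> B" using subB a by simp
    have "ip (c *\<^sub>C a + b) (c *\<^sub>C a + b) = ip b b + c * ip b a + cnj c * ip a b + c * cnj c * ip a a"
      using a b ca subB by (simp add: ip_add_left ip_add_right ip_scaleC_left ip_scaleC_right algebra_simps)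
    then have "complex_of_real ((norm2 \<sigma> b)\<^sup>2) + c * ip b a + cnj c * ip a b
        + complex_of_real ((cmod c)\<^sup>2 * (norm2 \<sigma> a)\<^sup>2) = complex_of_real ((norm2 \<sigma> (c *\<^sub>C a + b))\<^sup>2)"
      using ip_self[OF subB(2)[OF ca b]] ip_self[OF a] ip_self[OF b]
      by (simp only: of_real_mult complex_norm_square)
    then show "complex_of_real ((norm2 \<sigma> b)\<^sup>2) + c * ip b a + cnj c * ip a b
        + complex_of_real ((cmod c)\<^sup>2 * (norm2 \<sigma> a)\<^sup>2) \<in> \<real>\<^sub>\<ge>\<^sub>0"
      by (simp only: nonneg_Reals_of_real_iff) simp
  qed simp
  then have "(cmod (ip b a))\<^sup>2 \<le> (norm2 \<sigma> b * norm2 \<sigma> a)\<^sup>2" by (simp add: power_mult_distrib)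
  then show ?thesis by (rule power2_le_imp_le) (simp add: a b)
qed

lemma norm2_triangle:
  assumes a: "a \<in> B" and b: "b \<in> B" shows "norm2 \<sigma> (a + b) \<le> norm2 \<sigma> a + norm2 \<sigma> b"
proof -
  have ab: "a + b \<in> B" using subB a b by simp
  have "complex_of_real ((norm2 \<sigma> (a + b))\<^sup>2) = ip a a + ip a b + ip b a + ip b b"
    unfolding ip_self[OF ab, symmetric] using a b ab by (simp add: ip_add_left ip_add_right)
  then have "(norm2 \<sigma> (a + b))\<^sup>2 = Re (ip a a + ip a b + ip b a + ip b b)"
    by (metis Re_complex_of_real)
  also have "\<dots> = (norm2 \<sigma> a)\<^sup>2 + Re (ip a b) + Re (ip b a) + (norm2 \<sigma> b)\<^sup>2"
    by (simp only: plus_complex.sel ip_self[OF a] ip_self[OF b] Re_complex_of_real)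
  also have "\<dots> \<le> (norm2 \<sigma> a)\<^sup>2 + norm2 \<sigma> a * norm2 \<sigma> b + norm2 \<sigma> b * norm2 \<sigma> a + (norm2 \<sigma> b)\<^sup>2"
    using ip_Cauchy_Schwarz[OF a b] ip_Cauchy_Schwarz[OF b a]
      complex_Re_le_cmod[of "ip a b"] complex_Re_le_cmod[of "ip b a"] by linarith
  also have "\<dots> = (norm2 \<sigma> a + norm2 \<sigma> b)\<^sup>2" by (simp add: power2_eq_square algebra_simps)
  finally show ?thesis by (rule power2_le_imp_le) (simp add: a b)
qed

lemma norm2_scaleC: assumes a: "a \<in> B" shows "norm2 \<sigma> (c *\<^sub>C a) = cmod c * norm2 \<sigma> a"
proof -
  have ca: "c *\<^sub>C a \<in> B" using subB a by simp
  have "complex_of_real ((norm2 \<sigma> (c *\<^sub>C a))\<^sup>2) = (c * cnj c) * ip a a"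
    unfolding ip_self[OF ca, symmetric] using a ca by (simp add: ip_scaleC_left ip_scaleC_right)
  also have "\<dots> = complex_of_real ((cmod c * norm2 \<sigma> a)\<^sup>2)"
    by (simp only: ip_self[OF a] complex_norm_square[symmetric] of_real_mult[symmetric] power_mult_distrib)
  finally have "(norm2 \<sigma> (c *\<^sub>C a))\<^sup>2 = (cmod c * norm2 \<sigma> a)\<^sup>2" using of_real_eq_iff by blast
  then show ?thesis using a ca by simp
qed

lemma norm2_zero [simp]: "norm2 \<sigma> 0 = 0"
  using norm2_scaleC[OF subB(1), of 0] by simp

lemma norm2_minus: "a \<in> B \<Longrightarrow> norm2 \<sigma> (- a) = norm2 \<sigma> a"
  using norm2_scaleC[of a "- 1"] scaleR_scaleC[of "- 1" a] by simp

lemma norm2_minus_commute: "a \<in> B \<Longrightarrow> b \<in> B \<Longrightarrow> norm2 \<sigma> (a - b) = norm2 \<sigma> (b - a)"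
  using norm2_minus[of "b - a"] subB by simp

lemma norm2_triangle_diff:
  "a \<in> B \<Longrightarrow> b \<in> B \<Longrightarrow> c \<in> B \<Longrightarrow> norm2 \<sigma> (a - c) \<le> norm2 \<sigma> (a - b) + norm2 \<sigma> (b - c)"
  using norm2_triangle[of "a - b" "b - c"] subB by simp

lemma norm2_diff_ineq: assumes "a \<in> B" "b \<in> B" shows "\<bar>norm2 \<sigma> a - norm2 \<sigma> b\<bar> \<le> norm2 \<sigma> (a - b)"
  using norm2_triangle[of "a - b" b] norm2_triangle[of "b - a" a] norm2_minus_commute[OF assms] assms subB
  by simp

text \<open>The operator \<open>\<parallel>a\<parallel>\<^sup>2 - a\<^sup>* a\<close> is positive, and the state is \<open>1\<close> at the unit.\<close>

lemma norm2_le_norm: assumes a: "a \<in> B" shows "norm2 \<sigma> a \<le> norm a"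
proof -
  define c where "c = complex_of_real ((norm a)\<^sup>2) *\<^sub>C id_blinfun - (adj a o\<^sub>L a)"
  have cB: "c \<in> B" unfolding c_def by (intro subB idB mult adjB a)
  have "positive_op c"
    unfolding positive_op_def
  proof
    fix x
    have "(norm (a x))\<^sup>2 \<le> (norm a * norm x)\<^sup>2" by (intro power_mono norm_blinfun) simp
    moreover have "cinner (c x) x = complex_of_real ((norm a * norm x)\<^sup>2 - (norm (a x))\<^sup>2)"
      by (simp add: c_def blinfun.diff_left scaleC_blinfun.rep_eq cinner.diff_left cinner_scaleC_left
          is_adjointD[OF adjB(2)[OF a]] cinner_self power_mult_distrib)
    ultimately show "cinner (c x) x \<in> \<real>\<^sub>\<ge>\<^sub>0" by (simp only: nonneg_Reals_of_real_iff)
  qed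
  then have "\<sigma> c \<in> \<real>\<^sub>\<ge>\<^sub>0" by (rule \<sigma>_pos[OF cB])
  moreover have "\<sigma> c = complex_of_real ((norm a)\<^sup>2 - (norm2 \<sigma> a)\<^sup>2)"
    using ip_self[OF a] a
    by (simp add: c_def \<sigma>_diff \<sigma>_scaleC \<sigma>_id idB subB mult adjB ip_def)
  ultimately have "(norm2 \<sigma> a)\<^sup>2 \<le> (norm a)\<^sup>2" by (simp only: nonneg_Reals_of_real_iff)
  then show ?thesis by (rule power2_le_imp_le) simp
qed

lemma norm2_tendsto:
  assumes "\<And>n. f n \<in> B" "a \<in> B" "f \<longlonglongrightarrow> a" shows "(\<lambda>n. norm2 \<sigma> (f n)) \<longlonglongrightarrow> norm2 \<sigma> a"
proof -
  have "(\<lambda>n. norm (f n - a)) \<longlonglongrightarrow> 0" using assms(3) by (simp add: tendsto_norm_zero_iff LIM_zero_iff)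
  then have "(\<lambda>n. norm2 \<sigma> (f n) - norm2 \<sigma> a) \<longlonglongrightarrow> 0"
  proof (rule Lim_null_comparison[rotated])
    show "\<forall>\<^sub>F n in sequentially. norm (norm2 \<sigma> (f n) - norm2 \<sigma> a) \<le> norm (f n - a)"
      using norm2_diff_ineq[OF assms(1,2)] norm2_le_norm[OF subB(4)[OF assms(1,2)]]
      by (intro always_eventually) (metis order_trans real_norm_def)
  qed
  then show ?thesis by (simp add: LIM_zero_iff)
qed

lemma norm2_sum_le:
  "(\<And>i. i \<in> I \<Longrightarrow> f i \<in> B) \<Longrightarrow> norm2 \<sigma> (\<Sum>i\<in>I. f i) \<le> (\<Sum>i\<in>I. norm2 \<sigma> (f i))"
proof (induction I rule: infinite_finite_induct)
  case (insert i I)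
  have "norm2 \<sigma> (\<Sum>i\<in>insert i I. f i) \<le> norm2 \<sigma> (f i) + norm2 \<sigma> (\<Sum>i\<in>I. f i)"
    using insert by (simp add: norm2_triangle complex_subspace_sum[OF sub])
  then show ?case using insert by force
qed auto

section \<open>The completion in the seminorm of a state\<close>

abbreviation "Cau \<equiv> L2_Cauchy B \<sigma>"
abbreviation "cls x \<equiv> L2_rel B \<sigma> `` {x}"

lemma Cau_B: "x \<in> Cau \<Longrightarrow> x n \<in> B"
  by (auto simp: L2_Cauchy_def)

lemma CauD: "x \<in> Cau \<Longrightarrow> 0 < e \<Longrightarrow> \<exists>N. \<forall>m\<ge>N. \<forall>n\<ge>N. norm2 \<sigma> (x m - x n) < e"
  by (simp add: L2_Cauchy_def)

lemma Cau_const: "b \<in> B \<Longrightarrow> (\<lambda>_. b) \<in> Cau"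
  by (auto simp: L2_Cauchy_def)

lemma Cau_dist_convergent:
  assumes x: "x \<in> Cau" and y: "y \<in> Cau"
  shows "convergent (\<lambda>n. norm2 \<sigma> (x n - y n))"
proof (rule Cauchy_convergent, rule metric_CauchyI)
  fix e :: real assume e: "0 < e"
  obtain M where M: "\<And>m n. m \<ge> M \<Longrightarrow> n \<ge> M \<Longrightarrow> norm2 \<sigma> (x m - x n) < e / 2"
    using CauD[OF x, of "e / 2"] e by auto
  obtain N where N: "\<And>m n. m \<ge> N \<Longrightarrow> n \<ge> N \<Longrightarrow> norm2 \<sigma> (y m - y n) < e / 2"
    using CauD[OF y, of "e / 2"] e by auto
  have "dist (norm2 \<sigma> (x m - y m)) (norm2 \<sigma> (x n - y n)) < e" if "m \<ge> max M N" "n \<ge> max M N" for m n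
  proof -
    have "\<bar>norm2 \<sigma> (x m - y m) - norm2 \<sigma> (x n - y n)\<bar> \<le> norm2 \<sigma> ((x m - y m) - (x n - y n))"
      by (intro norm2_diff_ineq subB Cau_B x y)
    also have "(x m - y m) - (x n - y n) = (x m - x n) + (y n - y m)" by simp
    also have "norm2 \<sigma> \<dots> \<le> norm2 \<sigma> (x m - x n) + norm2 \<sigma> (y n - y m)"
      by (intro norm2_triangle subB Cau_B x y)
    also have "\<dots> < e" using M[of m n] N[of n m] that by simp
    finally show ?thesis by (simp add: dist_real_def)
  qed
  then show "\<exists>M. \<forall>m\<ge>M. \<forall>n\<ge>M. dist (norm2 \<sigma> (x m - y m)) (norm2 \<sigma> (x n - y n)) < e" by blast
qed

lemma rel_limit:
  assumes "(x, x') \<in> L2_rel B \<sigma>" "(y, y') \<in> L2_rel B \<sigma>" "(\<lambda>n. norm2 \<sigma> (x n - y n)) \<longlonglongrightarrow> r"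
  shows "(\<lambda>n. norm2 \<sigma> (x' n - y' n)) \<longlonglongrightarrow> r"
proof -
  have xy: "x n \<in> B" "x' n \<in> B" "y n \<in> B" "y' n \<in> B" for n
    using assms Cau_B by (auto simp: L2_rel_def)
  have "(\<lambda>n. norm2 \<sigma> (x n - x' n) + norm2 \<sigma> (y n - y' n)) \<longlonglongrightarrow> 0 + 0"
    using assms by (intro tendsto_add) (auto simp: L2_rel_def)
  then have "(\<lambda>n. norm2 \<sigma> (x n - x' n) + norm2 \<sigma> (y n - y' n)) \<longlonglongrightarrow> 0" by simp
  then have "(\<lambda>n. norm2 \<sigma> (x' n - y' n) - norm2 \<sigma> (x n - y n)) \<longlonglongrightarrow> 0"
  proof (rule Lim_null_comparison[rotated])
    have "norm (norm2 \<sigma> (x' n - y' n) - norm2 \<sigma> (x n - y n)) \<le> norm2 \<sigma> (x n - x' n) + norm2 \<sigma> (y n - y' n)" for n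
    proof -
      have "\<bar>norm2 \<sigma> (x' n - y' n) - norm2 \<sigma> (x n - y n)\<bar> \<le> norm2 \<sigma> ((x' n - y' n) - (x n - y n))"
        by (intro norm2_diff_ineq subB xy)
      also have "(x' n - y' n) - (x n - y n) = (x' n - x n) + (y n - y' n)" by simp
      also have "norm2 \<sigma> \<dots> \<le> norm2 \<sigma> (x' n - x n) + norm2 \<sigma> (y n - y' n)"
        by (intro norm2_triangle subB xy)
      finally show ?thesis using norm2_minus_commute[OF xy(1,2)] by simp
    qed
    then show "\<forall>\<^sub>F n in sequentially. norm (norm2 \<sigma> (x' n - y' n) - norm2 \<sigma> (x n - y n))
        \<le> norm2 \<sigma> (x n - x' n) + norm2 \<sigma> (y n - y' n)" by simp
  qed
  from tendsto_add[OF this assms(3)] show ?thesis by simp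
qed

lemma rel_refl: "x \<in> Cau \<Longrightarrow> (x, x) \<in> L2_rel B \<sigma>"
  by (simp add: L2_rel_def)

lemma rel_equiv: "equiv Cau (L2_rel B \<sigma>)"
proof (rule equivI)
  show "L2_rel B \<sigma> \<subseteq> Cau \<times> Cau" by (auto simp: L2_rel_def)
  show "refl_on Cau (L2_rel B \<sigma>)" by (auto simp: refl_on_def L2_rel_def)
  show "sym (L2_rel B \<sigma>)"
    by (rule symI) (auto simp: L2_rel_def norm2_minus_commute[OF Cau_B Cau_B])
  show "trans (L2_rel B \<sigma>)"
  proof (rule transI)
    fix x y z assume xy: "(x, y) \<in> L2_rel B \<sigma>" and yz: "(y, z) \<in> L2_rel B \<sigma>"
    then have "(\<lambda>n. norm2 \<sigma> (x n - z n)) \<longlonglongrightarrow> 0"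
      using rel_limit[OF rel_refl yz, of x 0] by (auto simp: L2_rel_def)
    then show "(x, z) \<in> L2_rel B \<sigma>" using xy yz by (simp add: L2_rel_def)
  qed
qed

lemma cls_in: "x \<in> Cau \<Longrightarrow> cls x \<in> L2_space B \<sigma>"
  by (simp add: L2_space_def quotientI)

lemma L2_spaceE:
  assumes "X \<in> L2_space B \<sigma>" obtains x where "x \<in> Cau" "X = cls x"
  using assms by (auto simp: L2_space_def elim: quotientE)

lemma L2_dist_cls:
  assumes "x \<in> Cau" "y \<in> Cau" shows "(\<lambda>n. norm2 \<sigma> (x n - y n)) \<longlonglongrightarrow> L2_dist B \<sigma> (cls x) (cls y)"
proof -
  obtain r where r: "(\<lambda>n. norm2 \<sigma> (x n - y n)) \<longlonglongrightarrow> r"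
    using Cau_dist_convergent[OF assms] by (auto simp: convergent_def)
  have "L2_dist B \<sigma> (cls x) (cls y) = (THE r. \<forall>x'\<in>cls x. \<forall>y'\<in>cls y. (\<lambda>n. norm2 \<sigma> (x' n - y' n)) \<longlonglongrightarrow> r)"
    by (simp add: L2_dist_def cls_in assms)
  also have "\<dots> = r"
  proof (rule the_equality)
    show "\<forall>x'\<in>cls x. \<forall>y'\<in>cls y. (\<lambda>n. norm2 \<sigma> (x' n - y' n)) \<longlonglongrightarrow> r"
      using rel_limit[OF _ _ r] by auto
    fix q assume "\<forall>x'\<in>cls x. \<forall>y'\<in>cls y. (\<lambda>n. norm2 \<sigma> (x' n - y' n)) \<longlonglongrightarrow> q"
    then have "(\<lambda>n. norm2 \<sigma> (x n - y n)) \<longlonglongrightarrow> q" using rel_refl assms by auto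
    then show "q = r" using r LIMSEQ_unique by blast
  qed
  finally show ?thesis using r by simp
qed

lemma L2_norm_cls:
  assumes "x \<in> Cau" shows "(\<lambda>n. norm2 \<sigma> (x n)) \<longlonglongrightarrow> L2_norm \<sigma> (cls x)"
proof -
  have z: "(\<lambda>_. 0) \<in> Cau" by (rule Cau_const) (rule subB)
  obtain r where "(\<lambda>n. norm2 \<sigma> (x n - 0)) \<longlonglongrightarrow> r"
    using Cau_dist_convergent[OF assms z] by (auto simp: convergent_def)
  then have r: "(\<lambda>n. norm2 \<sigma> (x n)) \<longlonglongrightarrow> r" by simp
  have "L2_norm \<sigma> (cls x) = r"
    unfolding L2_norm_def
  proof (rule the_equality)
    show "\<forall>x'\<in>cls x. (\<lambda>n. norm2 \<sigma> (x' n)) \<longlonglongrightarrow> r"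
      using rel_limit[OF _ rel_refl[OF z], of x _ r] r by auto
    fix q assume "\<forall>x'\<in>cls x. (\<lambda>n. norm2 \<sigma> (x' n)) \<longlonglongrightarrow> q"
    then have "(\<lambda>n. norm2 \<sigma> (x n)) \<longlonglongrightarrow> q" using rel_refl assms by auto
    then show "q = r" using r LIMSEQ_unique by blast
  qed
  then show ?thesis using r by simp
qed

lemma L2_norm_const: assumes "b \<in> B" shows "L2_norm \<sigma> (cls (\<lambda>_. b)) = norm2 \<sigma> b"
  using LIMSEQ_unique[OF L2_norm_cls[OF Cau_const[OF assms]] tendsto_const] .

lemma L2_dist_const:
  assumes "b \<in> B" "c \<in> B" shows "L2_dist B \<sigma> (cls (\<lambda>_. b)) (cls (\<lambda>_. c)) = norm2 \<sigma> (b - c)"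
  using LIMSEQ_unique[OF L2_dist_cls[OF Cau_const Cau_const] tendsto_const] assms by blast

lemma Metric_space_L2: "Metric_space (L2_space B \<sigma>) (L2_dist B \<sigma>)"
proof
  fix X Y Z
  show "0 \<le> L2_dist B \<sigma> X Y"
  proof (cases "X \<in> L2_space B \<sigma> \<and> Y \<in> L2_space B \<sigma>")
    case True
    then obtain x y where xy: "x \<in> Cau" "X = cls x" "y \<in> Cau" "Y = cls y" by (metis L2_spaceE)
    show ?thesis unfolding xy
      by (rule LIMSEQ_le_const[OF L2_dist_cls[OF xy(1,3)]]) (intro exI[of _ 0] allI impI norm2_nonneg subB Cau_B xy)
  qed (auto simp: L2_dist_def)
  show "L2_dist B \<sigma> X Y = L2_dist B \<sigma> Y X"
  proof (cases "X \<in> L2_space B \<sigma> \<and> Y \<in> L2_space B \<sigma>")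
    case True
    then obtain x y where xy: "x \<in> Cau" "X = cls x" "y \<in> Cau" "Y = cls y" by (metis L2_spaceE)
    have "(\<lambda>n. norm2 \<sigma> (x n - y n)) \<longlonglongrightarrow> L2_dist B \<sigma> (cls y) (cls x)"
      using L2_dist_cls[OF xy(3,1)] by (simp add: norm2_minus_commute[OF Cau_B Cau_B] xy)
    then show ?thesis unfolding xy by (rule LIMSEQ_unique[OF L2_dist_cls[OF xy(1,3)]])
  qed (auto simp: L2_dist_def)
  assume X: "X \<in> L2_space B \<sigma>" and Y: "Y \<in> L2_space B \<sigma>"
  obtain x where x: "x \<in> Cau" "X = cls x" using X by (rule L2_spaceE)
  obtain y where y: "y \<in> Cau" "Y = cls y" using Y by (rule L2_spaceE)
  show "L2_dist B \<sigma> X Y = 0 \<longleftrightarrow> X = Y"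
  proof
    assume "L2_dist B \<sigma> X Y = 0"
    then have "(x, y) \<in> L2_rel B \<sigma>" using L2_dist_cls[OF x(1) y(1)] x y by (simp add: L2_rel_def)
    then show "X = Y" unfolding x y by (rule equiv_class_eq[OF rel_equiv])
  next
    assume "X = Y"
    then have "L2_dist B \<sigma> X Y = L2_dist B \<sigma> (cls x) (cls x)" using x by simp
    moreover have "(\<lambda>n. norm2 \<sigma> (x n - x n)) \<longlonglongrightarrow> 0" by simp
    ultimately show "L2_dist B \<sigma> X Y = 0" using LIMSEQ_unique[OF L2_dist_cls[OF x(1) x(1)]] by simp
  qed
  assume Z: "Z \<in> L2_space B \<sigma>"
  obtain z where z: "z \<in> Cau" "Z = cls z" using Z by (rule L2_spaceE)
  show "L2_dist B \<sigma> X Z \<le> L2_dist B \<sigma> X Y + L2_dist B \<sigma> Y Z"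
    unfolding x y z
    by (rule LIMSEQ_le[OF L2_dist_cls[OF x(1) z(1)]
          tendsto_add[OF L2_dist_cls[OF x(1) y(1)] L2_dist_cls[OF y(1) z(1)]]])
      (auto intro!: norm2_triangle_diff Cau_B x y z)
qed

sublocale L2: Metric_space "L2_space B \<sigma>" "L2_dist B \<sigma>"
  by (rule Metric_space_L2)

lemma L2_dense:
  assumes x: "x \<in> Cau" and e: "0 < e"
  shows "\<exists>N. \<forall>n\<ge>N. L2_dist B \<sigma> (cls x) (cls (\<lambda>_. x n)) < e"
proof -
  obtain N where N: "\<And>m n. m \<ge> N \<Longrightarrow> n \<ge> N \<Longrightarrow> norm2 \<sigma> (x m - x n) < e / 2"
    using CauD[OF x, of "e / 2"] e by auto
  have "L2_dist B \<sigma> (cls x) (cls (\<lambda>_. x n)) \<le> e / 2" if "n \<ge> N" for n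
    by (rule LIMSEQ_le_const2[OF L2_dist_cls[OF x Cau_const[OF Cau_B[OF x]]]])
      (use N that in \<open>auto intro!: exI[of _ N] less_imp_le\<close>)
  then show ?thesis using e by (intro exI[of _ N]) force
qed

text \<open>A Cauchy sequence of classes is approximated by constant classes of
  elements \<open>b\<^sub>k\<close> of the algebra, and the sequence of the \<open>b\<^sub>k\<close> itself represents the limit.\<close>

lemma L2_complete: "L2.mcomplete"
  unfolding L2.mcomplete_def
proof (intro allI impI)
  fix X assume X: "L2.MCauchy X"
  have "\<exists>b\<in>B. L2_dist B \<sigma> (X k) (cls (\<lambda>_. b)) < 1 / Suc k" for k
  proof -
    have "X k \<in> L2_space B \<sigma>" using X by (auto simp: L2.MCauchy_def)
    then obtain x where x: "x \<in> Cau" "X k = cls x" by (rule L2_spaceE)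
    show ?thesis using L2_dense[OF x(1), of "1 / Suc k"] Cau_B[OF x(1)] x(2) by auto
  qed
  then obtain b where b: "\<And>k. b k \<in> B" "\<And>k. L2_dist B \<sigma> (X k) (cls (\<lambda>_. b k)) < 1 / Suc k" by metis
  have XM: "X k \<in> L2_space B \<sigma>" for k using X by (auto simp: L2.MCauchy_def)
  have bM: "cls (\<lambda>_. b k) \<in> L2_space B \<sigma>" for k by (intro cls_in Cau_const b)
  have bC: "b \<in> Cau"
    unfolding L2_Cauchy_def
  proof (clarify, intro conjI allI impI)
    show "range b \<subseteq> B" using b by auto
    fix e :: real assume e: "0 < e"
    obtain N where N: "\<And>m n. m \<ge> N \<Longrightarrow> n \<ge> N \<Longrightarrow> L2_dist B \<sigma> (X m) (X n) < e / 3"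
      using X e unfolding L2.MCauchy_def by (meson divide_pos_pos zero_less_numeral)
    obtain K where K: "1 / Suc K < e / 3" using nat_approx_posE[of "e / 3"] e by auto
    have "norm2 \<sigma> (b m - b n) < e" if mn: "m \<ge> max N K" "n \<ge> max N K" for m n
    proof -
      have small: "1 / Suc j < e / 3" if "j \<ge> K" for j
        using K that by (meson frac_le le_less_trans of_nat_le_iff of_nat_0_less_iff order_refl zero_le_one zero_less_Suc Suc_le_mono)
      have "norm2 \<sigma> (b m - b n) = L2_dist B \<sigma> (cls (\<lambda>_. b m)) (cls (\<lambda>_. b n))"
        by (simp add: L2_dist_const b)
      also have "\<dots> \<le> L2_dist B \<sigma> (cls (\<lambda>_. b m)) (X m) + L2_dist B \<sigma> (X m) (cls (\<lambda>_. b n))"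
        by (rule L2.triangle[OF bM XM bM])
      also have "L2_dist B \<sigma> (X m) (cls (\<lambda>_. b n)) \<le> L2_dist B \<sigma> (X m) (X n) + L2_dist B \<sigma> (X n) (cls (\<lambda>_. b n))"
        by (rule L2.triangle[OF XM XM bM])
      finally show ?thesis
        using b(2)[of m] b(2)[of n] N[of m n] small[of m] small[of n] mn
          L2.commute[of "cls (\<lambda>_. b m)" "X m"] by simp
    qed
    then show "\<exists>N. \<forall>m\<ge>N. \<forall>n\<ge>N. norm2 \<sigma> (b m - b n) < e" by blast
  qed
  have "(\<lambda>k. L2_dist B \<sigma> (X k) (cls b)) \<longlonglongrightarrow> 0"
  proof (rule LIMSEQ_I)
    fix e :: real assume e: "0 < e"
    obtain N where N: "\<And>n. n \<ge> N \<Longrightarrow> L2_dist B \<sigma> (cls b) (cls (\<lambda>_. b n)) < e / 2"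
      using L2_dense[OF bC, of "e / 2"] e by auto
    obtain K where K: "1 / Suc K < e / 2" using nat_approx_posE[of "e / 2"] e by auto
    have "norm (L2_dist B \<sigma> (X k) (cls b) - 0) < e" if k: "k \<ge> max N K" for k
    proof -
      have "1 / Suc k \<le> 1 / Suc K" using k by (intro divide_left_mono) auto
      moreover have "L2_dist B \<sigma> (X k) (cls b) \<le> L2_dist B \<sigma> (X k) (cls (\<lambda>_. b k)) + L2_dist B \<sigma> (cls (\<lambda>_. b k)) (cls b)"
        by (rule L2.triangle[OF XM bM cls_in[OF bC]])
      ultimately show ?thesis
        using b(2)[of k] N[of k] K k L2.commute[of "cls b" "cls (\<lambda>_. b k)"] by simp
    qed
    then show "\<exists>no. \<forall>n\<ge>no. norm (L2_dist B \<sigma> (X n) (cls b) - 0) < e" by blast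
  qed
  then have "limitin L2.mtopology X (cls b) sequentially"
    by (simp add: L2.limitin_metric_dist_null XM cls_in bC)
  then show "\<exists>x. limitin L2.mtopology X x sequentially" ..
qed

lemma Cau_image:
  assumes \<Phi>: "linear_on B \<Phi>" "\<Phi> ` B \<subseteq> B" "\<And>b. b \<in> B \<Longrightarrow> norm2 \<sigma> (\<Phi> b) \<le> C * norm2 \<sigma> b"
    and C: "0 < C" and x: "x \<in> Cau"
  shows "\<Phi> \<circ> x \<in> Cau"
  unfolding L2_Cauchy_def
proof (clarify, intro conjI allI impI)
  show "range (\<Phi> \<circ> x) \<subseteq> B" using \<Phi>(2) Cau_B[OF x] by auto
  fix e :: real assume e: "0 < e"
  obtain N where N: "\<And>m n. m \<ge> N \<Longrightarrow> n \<ge> N \<Longrightarrow> norm2 \<sigma> (x m - x n) < e / C"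
    using CauD[OF x, of "e / C"] e C by auto
  have "norm2 \<sigma> ((\<Phi> \<circ> x) m - (\<Phi> \<circ> x) n) < e" if "m \<ge> N" "n \<ge> N" for m n
  proof -
    have "norm2 \<sigma> ((\<Phi> \<circ> x) m - (\<Phi> \<circ> x) n) \<le> C * norm2 \<sigma> (x m - x n)"
      using \<Phi>(3)[OF subB(4)[OF Cau_B[OF x] Cau_B[OF x]]]
      by (simp add: linear_on_diff[OF \<Phi>(1) sub Cau_B[OF x] Cau_B[OF x]])
    also have "\<dots> < e" using N[OF that] C by (simp add: field_simps)
    finally show ?thesis .
  qed
  then show "\<exists>N. \<forall>m\<ge>N. \<forall>n\<ge>N. norm2 \<sigma> ((\<Phi> \<circ> x) m - (\<Phi> \<circ> x) n) < e" by blast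
qed

lemma L2_ext_cls:
  assumes \<Phi>: "linear_on B \<Phi>" "\<Phi> ` B \<subseteq> B" "\<And>b. b \<in> B \<Longrightarrow> norm2 \<sigma> (\<Phi> b) \<le> C * norm2 \<sigma> b"
    and C: "0 < C" and x: "x \<in> Cau"
  shows "L2_ext B \<sigma> \<Phi> (cls x) = cls (\<Phi> \<circ> x)"
proof -
  have "cls (\<Phi> \<circ> y) = cls (\<Phi> \<circ> x)" if xy: "(x, y) \<in> L2_rel B \<sigma>" for y
  proof (rule sym, rule equiv_class_eq[OF rel_equiv])
    have y: "y \<in> Cau" and l: "(\<lambda>n. norm2 \<sigma> (x n - y n)) \<longlonglongrightarrow> 0" using xy by (auto simp: L2_rel_def)
    have "(\<lambda>n. C * norm2 \<sigma> (x n - y n)) \<longlonglongrightarrow> C * 0" by (intro tendsto_intros l)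
    then have "(\<lambda>n. C * norm2 \<sigma> (x n - y n)) \<longlonglongrightarrow> 0" by simp
    then have "(\<lambda>n. norm2 \<sigma> ((\<Phi> \<circ> x) n - (\<Phi> \<circ> y) n)) \<longlonglongrightarrow> 0"
    proof (rule Lim_null_comparison[rotated])
      show "\<forall>\<^sub>F n in sequentially. norm (norm2 \<sigma> ((\<Phi> \<circ> x) n - (\<Phi> \<circ> y) n)) \<le> C * norm2 \<sigma> (x n - y n)"
      proof (rule always_eventually, rule allI)
        fix n
        have B: "x n - y n \<in> B" by (intro subB Cau_B x y)
        have "norm2 \<sigma> ((\<Phi> \<circ> x) n - (\<Phi> \<circ> y) n) = norm2 \<sigma> (\<Phi> (x n - y n))"
          by (simp add: linear_on_diff[OF \<Phi>(1) sub Cau_B[OF x] Cau_B[OF y]])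
        moreover have "0 \<le> norm2 \<sigma> (\<Phi> (x n - y n))" using B \<Phi>(2) by auto
        ultimately show "norm (norm2 \<sigma> ((\<Phi> \<circ> x) n - (\<Phi> \<circ> y) n)) \<le> C * norm2 \<sigma> (x n - y n)"
          using \<Phi>(3)[OF B] by simp
      qed
    qed
    then show "(\<Phi> \<circ> x, \<Phi> \<circ> y) \<in> L2_rel B \<sigma>"
      using Cau_image[OF \<Phi> C x] Cau_image[OF \<Phi> C y] by (simp add: L2_rel_def)
  qed
  then show ?thesis unfolding L2_ext_def using rel_refl[OF x] by blast
qed

lemma L2_ext_const:
  assumes \<Phi>: "linear_on B \<Phi>" "\<Phi> ` B \<subseteq> B" "\<And>b. b \<in> B \<Longrightarrow> norm2 \<sigma> (\<Phi> b) \<le> C * norm2 \<sigma> b"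
    and C: "0 < C" and b: "b \<in> B"
  shows "L2_ext B \<sigma> \<Phi> (cls (\<lambda>_. b)) = cls (\<lambda>_. \<Phi> b)"
  using L2_ext_cls[OF \<Phi> C Cau_const[OF b]] by (simp add: o_def)

lemma L2_unit_ball_const: "b \<in> B \<Longrightarrow> norm2 \<sigma> b \<le> 1 \<Longrightarrow> cls (\<lambda>_. b) \<in> L2_unit_ball B \<sigma>"
  by (simp add: L2_unit_ball_def L2_norm_const cls_in Cau_const)

lemma L2_ext_norm_le:
  assumes \<Phi>: "linear_on B \<Phi>" "\<Phi> ` B \<subseteq> B" "\<And>b. b \<in> B \<Longrightarrow> norm2 \<sigma> (\<Phi> b) \<le> C * norm2 \<sigma> b"
    and C: "0 < C" and X: "X \<in> L2_unit_ball B \<sigma>"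
  shows "L2_norm \<sigma> (L2_ext B \<sigma> \<Phi> X) \<le> C"
proof -
  from X obtain x where x: "x \<in> Cau" "X = cls x" "L2_norm \<sigma> X \<le> 1"
    unfolding L2_unit_ball_def by (auto elim: L2_spaceE)
  have "L2_norm \<sigma> (cls (\<Phi> \<circ> x)) \<le> C * L2_norm \<sigma> (cls x)"
    by (rule LIMSEQ_le[OF L2_norm_cls[OF Cau_image[OF \<Phi> C x(1)]] tendsto_mult_left[OF L2_norm_cls[OF x(1)]]])
      (auto intro!: \<Phi>(3) Cau_B x)
  also have "\<dots> \<le> C * 1" using C x by (intro mult_left_mono) auto
  finally show ?thesis using L2_ext_cls[OF \<Phi> C x(1)] x(2) by simp
qed

lemma L2_opnorm_leI:
  assumes \<Phi>: "linear_on B \<Phi>" "\<Phi> ` B \<subseteq> B" "\<And>b. b \<in> B \<Longrightarrow> norm2 \<sigma> (\<Phi> b) \<le> C * norm2 \<sigma> b"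
    and C: "0 < C"
  shows "L2_opnorm B \<sigma> \<Phi> \<le> C" "0 \<le> L2_opnorm B \<sigma> \<Phi>"
proof -
  have ne: "cls (\<lambda>_. 0) \<in> L2_unit_ball B \<sigma>" by (rule L2_unit_ball_const) (auto intro: subB)
  then show "L2_opnorm B \<sigma> \<Phi> \<le> C"
    unfolding L2_opnorm_def by (intro cSUP_least L2_ext_norm_le[OF \<Phi> C]) auto
  have "L2_norm \<sigma> (L2_ext B \<sigma> \<Phi> (cls (\<lambda>_. 0))) \<le> L2_opnorm B \<sigma> \<Phi>"
    unfolding L2_opnorm_def
    by (rule cSUP_upper[OF ne]) (auto intro!: bdd_aboveI2 L2_ext_norm_le[OF \<Phi> C])
  then show "0 \<le> L2_opnorm B \<sigma> \<Phi>"
    using L2_ext_const[OF \<Phi> C subB(1)] by (simp add: linear_on_zero[OF \<Phi>(1) sub] L2_norm_const subB(1))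
qed

lemma norm2_le_of_unit_ball:
  assumes \<Phi>: "linear_on B \<Phi>" "\<Phi> ` B \<subseteq> B" and bd: "L2_bounded B \<sigma> \<Phi>"
    and le: "\<And>b. b \<in> B \<Longrightarrow> norm2 \<sigma> b \<le> 1 \<Longrightarrow> norm2 \<sigma> (\<Phi> b) \<le> C" and b: "b \<in> B"
  shows "norm2 \<sigma> (\<Phi> b) \<le> C * norm2 \<sigma> b"
proof (cases "norm2 \<sigma> b = 0")
  case True
  then show ?thesis using bd b unfolding L2_bounded_def by fastforce
next
  case False
  then have r: "norm2 \<sigma> b > 0" using norm2_nonneg[OF b] by linarith
  define c where "c = complex_of_real (1 / norm2 \<sigma> b)"
  have cr: "cmod c = 1 / norm2 \<sigma> b" using r by (simp add: c_def norm_divide)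
  have "norm2 \<sigma> (\<Phi> (c *\<^sub>C b)) \<le> C"
    by (rule le) (use b r in \<open>simp_all add: subB norm2_scaleC cr\<close>)
  moreover have "\<Phi> b \<in> B" using \<Phi>(2) b by auto
  ultimately show ?thesis using r by (simp add: linear_onD(2)[OF \<Phi>(1) b] norm2_scaleC cr field_simps)
qed

lemma norm2_le_opnorm:
  assumes \<Phi>: "linear_on B \<Phi>" "\<Phi> ` B \<subseteq> B" and bd: "L2_bounded B \<sigma> \<Phi>" and b: "b \<in> B"
  shows "norm2 \<sigma> (\<Phi> b) \<le> L2_opnorm B \<sigma> \<Phi> * norm2 \<sigma> b"
proof (rule norm2_le_of_unit_ball[OF \<Phi> bd _ b])
  fix b assume b: "b \<in> B" "norm2 \<sigma> b \<le> 1"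
  obtain C where C: "C > 0" "\<And>b. b \<in> B \<Longrightarrow> norm2 \<sigma> (\<Phi> b) \<le> C * norm2 \<sigma> b"
    using bd unfolding L2_bounded_def by blast
  note \<Phi>' = \<Phi> C(2) C(1)
  have "L2_norm \<sigma> (L2_ext B \<sigma> \<Phi> (cls (\<lambda>_. b))) \<le> L2_opnorm B \<sigma> \<Phi>"
    unfolding L2_opnorm_def
    by (rule cSUP_upper[OF L2_unit_ball_const[OF b]]) (auto intro!: bdd_aboveI2 L2_ext_norm_le[OF \<Phi>'])
  moreover have "\<Phi> b \<in> B" using \<Phi>(2) b by auto
  ultimately show "norm2 \<sigma> (\<Phi> b) \<le> L2_opnorm B \<sigma> \<Phi>"
    by (simp add: L2_ext_const[OF \<Phi>' b(1)] L2_norm_const)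
qed

text \<open>Unlike compactness of the extension, this refers to elements of the algebra only, and so it
  can be transported by Fourier coefficients.\<close>

definition L2_totally_bounded :: "(('h \<Rightarrow>\<^sub>L 'h) \<Rightarrow> ('h \<Rightarrow>\<^sub>L 'h)) \<Rightarrow> bool" where
  "L2_totally_bounded \<Phi> \<longleftrightarrow>
     (\<forall>e>0. \<exists>K. finite K \<and> K \<subseteq> B \<and> (\<forall>b\<in>B. norm2 \<sigma> b \<le> 1 \<longrightarrow> (\<exists>k\<in>K. norm2 \<sigma> (\<Phi> b - k) < e)))"

text \<open>The centres of the balls need not lie in the set: one point of the set is chosen in each ball
  that meets it, and the radius is doubled.\<close>

lemma mtotally_boundedI:
  assumes S: "S \<subseteq> L2_space B \<sigma>"
    and ex: "\<And>e. 0 < e \<Longrightarrow> \<exists>K. finite K \<and> K \<subseteq> L2_space B \<sigma> \<and> S \<subseteq> (\<Union>k\<in>K. L2.mball k e)"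
  shows "L2.mtotally_bounded S"
  unfolding L2.mtotally_bounded_def
proof (intro allI impI)
  fix e :: real assume "0 < e"
  then obtain K where K: "finite K" "K \<subseteq> L2_space B \<sigma>" "S \<subseteq> (\<Union>k\<in>K. L2.mball k (e / 2))"
    using ex[of "e / 2"] by auto
  define K' where "K' = {k \<in> K. L2.mball k (e / 2) \<inter> S \<noteq> {}}"
  define p where "p k = (SOME s. s \<in> L2.mball k (e / 2) \<inter> S)" for k
  have p: "p k \<in> L2.mball k (e / 2)" "p k \<in> S" if "k \<in> K'" for k
    using that someI_ex[of "\<lambda>s. s \<in> L2.mball k (e / 2) \<inter> S"] unfolding K'_def p_def by blast+
  have "S \<subseteq> (\<Union>x\<in>p ` K'. L2.mball x e)"
  proof
    fix s assume s: "s \<in> S"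
    then obtain k where k: "k \<in> K" "s \<in> L2.mball k (e / 2)" using K by blast
    then have k': "k \<in> K'" using s by (auto simp: K'_def)
    have "L2_dist B \<sigma> (p k) s \<le> L2_dist B \<sigma> (p k) k + L2_dist B \<sigma> k s"
      using p[OF k'] k s S K by (intro L2.triangle) auto
    also have "\<dots> < e" using p(1)[OF k'] k(2) L2.commute[of "p k" k] by auto
    finally show "s \<in> (\<Union>x\<in>p ` K'. L2.mball x e)" using k' p[OF k'] s S by auto
  qed
  moreover have "finite (p ` K')" using K by (auto simp: K'_def)
  moreover have "p ` K' \<subseteq> S" using p by auto
  ultimately show "\<exists>K. finite K \<and> K \<subseteq> S \<and> S \<subseteq> (\<Union>x\<in>K. L2.mball x e)" by blast
qed

text \<open>Since the completion is complete, relative compactness is total boundedness, and constant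
  sequences are dense in the completion.\<close>

lemma L2_compact_iff:
  assumes \<Phi>: "linear_on B \<Phi>" "\<Phi> ` B \<subseteq> B"
  shows "L2_compact B \<sigma> \<Phi> \<longleftrightarrow> L2_bounded B \<sigma> \<Phi> \<and> L2_totally_bounded \<Phi>"
proof (cases "L2_bounded B \<sigma> \<Phi>")
  case True
  then obtain C where C: "C > 0" "\<And>b. b \<in> B \<Longrightarrow> norm2 \<sigma> (\<Phi> b) \<le> C * norm2 \<sigma> b"
    unfolding L2_bounded_def by blast
  note \<Phi>' = \<Phi> C(2) C(1)
  let ?T = "L2_ext B \<sigma> \<Phi>" and ?U = "L2_unit_ball B \<sigma>" and ?c = "\<lambda>b. cls (\<lambda>_. b)"
  have TU: "?T ` ?U \<subseteq> L2_space B \<sigma>"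
    by (auto simp: L2_unit_ball_def L2_ext_cls[OF \<Phi>'] elim!: L2_spaceE intro!: cls_in Cau_image[OF \<Phi>'])
  have \<Phi>B: "\<Phi> b \<in> B" if "b \<in> B" for b using \<Phi>(2) that by auto
  have cM: "?c b \<in> L2_space B \<sigma>" if "b \<in> B" for b using that by (intro cls_in Cau_const)
  have "L2.mtotally_bounded (?T ` ?U) \<longleftrightarrow> L2_totally_bounded \<Phi>"
  proof
    assume tb: "L2.mtotally_bounded (?T ` ?U)"
    show "L2_totally_bounded \<Phi>"
      unfolding L2_totally_bounded_def
    proof (intro allI impI)
      fix e :: real assume e: "0 < e"
      then obtain K where K: "finite K" "K \<subseteq> ?T ` ?U" "?T ` ?U \<subseteq> (\<Union>x\<in>K. L2.mball x (e / 2))"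
        using tb unfolding L2.mtotally_bounded_def by (meson half_gt_zero)
      have "\<exists>b\<in>B. L2_dist B \<sigma> k (?c b) < e / 2" if "k \<in> K" for k
      proof -
        have "k \<in> L2_space B \<sigma>" using that K TU by blast
        then obtain x where x: "x \<in> Cau" "k = cls x" by (rule L2_spaceE)
        show ?thesis using L2_dense[OF x(1), of "e / 2"] e Cau_B[OF x(1)] x(2) by auto
      qed
      then obtain p where p: "\<And>k. k \<in> K \<Longrightarrow> p k \<in> B" "\<And>k. k \<in> K \<Longrightarrow> L2_dist B \<sigma> k (?c (p k)) < e / 2" by metis
      have "\<exists>k\<in>p ` K. norm2 \<sigma> (\<Phi> b - k) < e" if b: "b \<in> B" "norm2 \<sigma> b \<le> 1" for b
      proof -
        have "?T (?c b) \<in> ?T ` ?U" using L2_unit_ball_const[OF b] by blast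
        then obtain k where k: "k \<in> K" "?c (\<Phi> b) \<in> L2.mball k (e / 2)"
          using K(3) L2_ext_const[OF \<Phi>' b(1)] by auto
        have "norm2 \<sigma> (\<Phi> b - p k) = L2_dist B \<sigma> (?c (\<Phi> b)) (?c (p k))"
          by (simp add: L2_dist_const \<Phi>B b p k)
        also have "\<dots> \<le> L2_dist B \<sigma> (?c (\<Phi> b)) k + L2_dist B \<sigma> k (?c (p k))"
          using k p b by (intro L2.triangle cM \<Phi>B) auto
        also have "\<dots> < e" using k(2) p(2)[OF k(1)] L2.commute[of k "?c (\<Phi> b)"] by auto
        finally show ?thesis using k(1) by blast
      qed
      then show "\<exists>K. finite K \<and> K \<subseteq> B \<and> (\<forall>b\<in>B. norm2 \<sigma> b \<le> 1 \<longrightarrow> (\<exists>k\<in>K. norm2 \<sigma> (\<Phi> b - k) < e))"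
        using K(1) p(1) by (intro exI[of _ "p ` K"]) auto
    qed
  next
    assume tb: "L2_totally_bounded \<Phi>"
    show "L2.mtotally_bounded (?T ` ?U)"
    proof (rule mtotally_boundedI[OF TU])
      fix e :: real assume e: "0 < e"
      have "\<exists>K. finite K \<and> K \<subseteq> B \<and> (\<forall>b\<in>B. norm2 \<sigma> b \<le> 1 \<longrightarrow> (\<exists>k\<in>K. norm2 \<sigma> (\<Phi> b - k) < e / 3))"
        by (rule tb[unfolded L2_totally_bounded_def, rule_format]) (use e in simp)
      then obtain K where K: "finite K" "K \<subseteq> B"
        "\<And>b. b \<in> B \<Longrightarrow> norm2 \<sigma> b \<le> 1 \<Longrightarrow> \<exists>k\<in>K. norm2 \<sigma> (\<Phi> b - k) < e / 3" by blast
      have "?T X \<in> (\<Union>k\<in>?c ` K. L2.mball k e)" if X: "X \<in> ?U" for X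
      proof -
        from X obtain x where x: "x \<in> Cau" "X = cls x" "L2_norm \<sigma> X \<le> 1"
          unfolding L2_unit_ball_def by (auto elim: L2_spaceE)
        have y: "\<Phi> \<circ> x \<in> Cau" by (rule Cau_image[OF \<Phi>' x(1)])
        \<comment> \<open>A representative of a class of norm at most \<open>1\<close> may have terms of slightly larger
          seminorm, and these have to be scaled back into the unit ball of the algebra.\<close>
        define \<delta> where "\<delta> = e / (3 * C)"
        have \<delta>: "\<delta> > 0" "C * \<delta> = e / 3" using e C by (simp_all add: \<delta>_def)
        obtain N where N: "\<And>n. n \<ge> N \<Longrightarrow> L2_dist B \<sigma> (cls (\<Phi> \<circ> x)) (?c ((\<Phi> \<circ> x) n)) < e / 3"
          using L2_dense[OF y, of "e / 3"] e by auto
        have "\<forall>\<^sub>F n in sequentially. norm2 \<sigma> (x n) < 1 + \<delta>"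
          using L2_norm_cls[OF x(1)] by (rule order_tendstoD) (use x \<delta> in simp)
        then obtain n where n: "n \<ge> N" "norm2 \<sigma> (x n) < 1 + \<delta>"
          unfolding eventually_sequentially by (meson nat_le_linear order_refl order_trans)
        define c where "c = complex_of_real (1 / (1 + \<delta>))"
        have cc: "cmod c = 1 / (1 + \<delta>)" "cmod (1 - c) = \<delta> / (1 + \<delta>)"
        proof -
          show "cmod c = 1 / (1 + \<delta>)" using \<delta> by (simp only: c_def norm_of_real) simp
          have "1 - c = complex_of_real (1 - 1 / (1 + \<delta>))" by (simp only: c_def of_real_diff of_real_1)
          also have "1 - 1 / (1 + \<delta>) = \<delta> / (1 + \<delta>)" using \<delta> by (simp add: field_simps)
          finally have "1 - c = complex_of_real (\<delta> / (1 + \<delta>))" .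
          then show "cmod (1 - c) = \<delta> / (1 + \<delta>)" using \<delta> by (simp only: norm_of_real) simp
        qed
        have xn: "x n \<in> B" by (rule Cau_B[OF x(1)])
        have b: "c *\<^sub>C x n \<in> B" "norm2 \<sigma> (c *\<^sub>C x n) \<le> 1"
          using xn n(2) \<delta> by (simp_all add: subB norm2_scaleC cc)
        have "x n - c *\<^sub>C x n = (1 - c) *\<^sub>C x n"
          using scaleC_add_left[of "1 - c" c "x n"] by (simp add: algebra_simps)
        then have "norm2 \<sigma> (x n - c *\<^sub>C x n) = \<delta> * (norm2 \<sigma> (x n) / (1 + \<delta>))"
          using xn by (simp add: norm2_scaleC cc)
        also have "\<dots> \<le> \<delta> * 1" using n(2) \<delta> by (intro mult_left_mono) auto
        finally have "norm2 \<sigma> (\<Phi> (x n - c *\<^sub>C x n)) \<le> e / 3"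
          using C(2)[OF subB(4)[OF xn b(1)]] C(1) \<delta>(2)
          by (smt (verit) mult_left_mono)
        then have 1: "norm2 \<sigma> (\<Phi> (x n) - \<Phi> (c *\<^sub>C x n)) \<le> e / 3"
          by (simp add: linear_on_diff[OF \<Phi>(1) sub xn b(1)])
        obtain k where k: "k \<in> K" "norm2 \<sigma> (\<Phi> (c *\<^sub>C x n) - k) < e / 3" using K(3)[OF b] by blast
        have kB: "k \<in> B" using k K by auto
        have "L2_dist B \<sigma> (?c k) (?T X) = L2_dist B \<sigma> (cls (\<Phi> \<circ> x)) (?c k)"
          by (simp add: x(2) L2_ext_cls[OF \<Phi>' x(1)] L2.commute)
        also have "\<dots> \<le> L2_dist B \<sigma> (cls (\<Phi> \<circ> x)) (?c (\<Phi> (x n))) + L2_dist B \<sigma> (?c (\<Phi> (x n))) (?c k)"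
          using xn kB y by (intro L2.triangle cM cls_in \<Phi>B) auto
        finally have 2: "L2_dist B \<sigma> (?c k) (?T X)
          \<le> L2_dist B \<sigma> (cls (\<Phi> \<circ> x)) (?c (\<Phi> (x n))) + L2_dist B \<sigma> (?c (\<Phi> (x n))) (?c k)" .
        have 3: "L2_dist B \<sigma> (?c (\<Phi> (x n))) (?c k) = norm2 \<sigma> (\<Phi> (x n) - k)"
          by (simp add: L2_dist_const \<Phi>B xn kB)
        have 4: "norm2 \<sigma> (\<Phi> (x n) - k) \<le> norm2 \<sigma> (\<Phi> (x n) - \<Phi> (c *\<^sub>C x n)) + norm2 \<sigma> (\<Phi> (c *\<^sub>C x n) - k)"
          by (intro norm2_triangle_diff \<Phi>B xn b kB)
        have "(\<Phi> \<circ> x) n = \<Phi> (x n)" by simp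
        note N' = N[OF n(1), unfolded this]
        have "L2_dist B \<sigma> (?c k) (?T X) < e" using N' 1 2 3 4 k(2) by linarith
        then show ?thesis using k(1) kB TU X cM[OF kB] by auto
      qed
      then show "\<exists>K. finite K \<and> K \<subseteq> L2_space B \<sigma> \<and> ?T ` ?U \<subseteq> (\<Union>k\<in>K. L2.mball k e)"
        using K(1,2) cM by (intro exI[of _ "?c ` K"]) auto
    qed
  qed
  then show ?thesis
    unfolding L2_compact_def Let_def using True TU
    by (simp add: L2.mtotally_bounded_eq_compact_closure_of[OF L2_complete])
qed (simp add: L2_compact_def)

end

section \<open>Fourier coefficients in the \<open>L\<^sup>2\<close>-seminorm\<close>

locale trace_preserving_dynamics = dynamics A \<alpha>
  for A :: "('h :: chilbert_space \<Rightarrow>\<^sub>L 'h) set"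
    and \<alpha> :: "'g :: group_add \<Rightarrow> ('h \<Rightarrow>\<^sub>L 'h) \<Rightarrow> ('h \<Rightarrow>\<^sub>L 'h)" +
  fixes \<tau> :: "('h \<Rightarrow>\<^sub>L 'h) \<Rightarrow> complex"
  assumes tracial: "faithful_tracial_state A \<tau>"
    and invariant: "\<And>t a. a \<in> A \<Longrightarrow> \<tau> (\<alpha> t a) = \<tau> a"
begin

abbreviation "\<tau>' \<equiv> induced_trace A \<alpha> \<tau>"

lemma \<tau>'_fcoeff: "x \<in> B \<Longrightarrow> \<tau>' x = \<tau> (fcoeff x 0)"
  by (simp add: induced_trace_def cond_expectation_fcoeff)

sublocale base: cstar_state A \<tau>
  using tracial A_alg by unfold_locales (auto simp: faithful_tracial_state_def)

lemma fcoeff_0_positive: assumes "positive_op x" shows "positive_op (fcoeff x 0)"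
  unfolding positive_op_def fcoeff_def
proof
  fix h
  have "cinner (entry x 0 (- 0) h) h = cinner (x (point 0 h)) (point 0 h)"
    by (simp add: cinner_point_right ell2_apply_entry)
  then show "cinner (entry x 0 (- 0) h) h \<in> \<real>\<^sub>\<ge>\<^sub>0" using assms by (simp add: positive_op_def)
qed

sublocale cross: cstar_state B \<tau>'
proof
  show "unital_cstar_algebra B" by (rule B_alg)
  fix a b assume a: "a \<in> B"
  show "\<tau>' (c *\<^sub>C a) = c * \<tau>' a" for c
    using a by (simp add: \<tau>'_fcoeff complex_subspaceD[OF B_sub] fcoeff_scaleC base.\<sigma>_scaleC fcoeff_A)
  show "\<tau>' a \<in> \<real>\<^sub>\<ge>\<^sub>0" if "positive_op a"
    using a by (simp add: \<tau>'_fcoeff base.\<sigma>_pos fcoeff_A fcoeff_0_positive that)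
  assume b: "b \<in> B"
  show "\<tau>' (a + b) = \<tau>' a + \<tau>' b"
    using a b by (simp add: \<tau>'_fcoeff complex_subspaceD[OF B_sub] fcoeff_add base.\<sigma>_add fcoeff_A)
next
  show "\<tau>' id_blinfun = 1"
    using fcoeff_monomial[OF A_id, of 0 0] by (simp add: \<tau>'_fcoeff B_id monomial_id base.\<sigma>_id)
qed

text \<open>Monomials with different group elements are orthogonal, since the product of one with the
  adjoint of the other has vanishing coefficient at the unit; those with the same group element
  reproduce the inner product of the base algebra because the trace is invariant.\<close>

lemma ip_monomial:
  assumes a: "a \<in> A" and b: "b \<in> A"
  shows "cross.ip (monomial a s) (monomial b t) = (if s = t then base.ip a b else 0)"
proof -
  have "adj (monomial a s) = monomial (\<alpha> (- s) (adj a)) (- s)" by (rule adj_eqI[OF monomial_adjoint[OF a]])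
  then have "adj (monomial a s) o\<^sub>L monomial b t = monomial (\<alpha> (- s) (adj a) o\<^sub>L \<alpha> (- s) b) (- s + t)"
    using a b by (simp add: monomial_mult \<alpha>_in A_adj)
  also have "\<alpha> (- s) (adj a) o\<^sub>L \<alpha> (- s) b = \<alpha> (- s) (adj a o\<^sub>L b)"
    using a b by (simp add: \<alpha>_mult A_adj)
  finally have *: "adj (monomial a s) o\<^sub>L monomial b t = monomial (\<alpha> (- s) (adj a o\<^sub>L b)) (- s + t)" .
  have "- s + t = 0 \<longleftrightarrow> s = t" by (metis add_0_right add_minus_cancel right_minus left_minus)
  moreover have "\<tau> 0 = 0" using base.\<sigma>_scaleC[OF base.subB(1), of 0] by simp
  ultimately show ?thesis
    using a b unfolding cross.ip_def base.ip_def *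
    by (simp add: \<tau>'_fcoeff monomial_B \<alpha>_in A_mult A_adj fcoeff_monomial invariant)
qed

lemma norm2_monomial: assumes a: "a \<in> A" shows "norm2 \<tau>' (monomial a s) = norm2 \<tau> a"
proof -
  have "complex_of_real ((norm2 \<tau>' (monomial a s))\<^sup>2) = complex_of_real ((norm2 \<tau> a)\<^sup>2)"
    using ip_monomial[OF a a, of s s] cross.ip_self[OF monomial_B[OF a]] base.ip_self[OF a] by simp
  then have "(norm2 \<tau>' (monomial a s))\<^sup>2 = (norm2 \<tau> a)\<^sup>2" using of_real_eq_iff by blast
  then show ?thesis using a by (simp add: monomial_B)
qed

text \<open>Thus \<open>L\<^sup>2\<close> of the crossed product is the orthogonal sum over the group of copies of \<open>L\<^sup>2\<close> of
  the base algebra.\<close>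

lemma parseval:
  assumes K: "finite K" and f: "\<And>s. s \<in> K \<Longrightarrow> f s \<in> A"
  shows "(norm2 \<tau>' (\<Sum>s\<in>K. monomial (f s) s))\<^sup>2 = (\<Sum>s\<in>K. (norm2 \<tau> (f s))\<^sup>2)"
proof -
  have ip_sum_right: "cross.ip x (\<Sum>t\<in>L. monomial (f t) t) = (\<Sum>t\<in>L. cross.ip x (monomial (f t) t))"
    if x: "x \<in> B" and L: "L \<subseteq> K" for x L
    using finite_subset[OF L K] L
  proof (induction L rule: finite_induct)
    case empty
    then show ?case using cross.ip_scaleC_right[OF x cross.subB(1), of 0] by simp
  next
    case (insert t L)
    then show ?case
      by (simp add: cross.ip_add_right x monomial_B f complex_subspace_sum[OF B_sub] subset_iff)
  qed
  have ip_sum_left: "cross.ip (\<Sum>t\<in>L. monomial (f t) t) x = (\<Sum>t\<in>L. cross.ip (monomial (f t) t) x)"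
    if x: "x \<in> B" and L: "L \<subseteq> K" for x L
    using finite_subset[OF L K] L
  proof (induction L rule: finite_induct)
    case empty
    then show ?case using cross.ip_scaleC_left[OF cross.subB(1) x, of 0] by simp
  next
    case (insert t L)
    then show ?case
      by (simp add: cross.ip_add_left x monomial_B f complex_subspace_sum[OF B_sub] subset_iff)
  qed
  let ?x = "\<Sum>s\<in>K. monomial (f s) s"
  have x: "?x \<in> B" by (intro complex_subspace_sum[OF B_sub] monomial_B f)
  have "complex_of_real ((norm2 \<tau>' ?x)\<^sup>2) = (\<Sum>s\<in>K. \<Sum>t\<in>K. cross.ip (monomial (f s) s) (monomial (f t) t))"
    unfolding cross.ip_self[OF x, symmetric] ip_sum_left[OF x order_refl]
    by (rule sum.cong) (auto intro!: ip_sum_right monomial_B f)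
  also have "\<dots> = (\<Sum>s\<in>K. \<Sum>t\<in>K. if s = t then complex_of_real ((norm2 \<tau> (f s))\<^sup>2) else 0)"
    by (intro sum.cong refl) (simp add: ip_monomial f base.ip_self)
  also have "\<dots> = complex_of_real (\<Sum>s\<in>K. (norm2 \<tau> (f s))\<^sup>2)" using K by simp
  finally show ?thesis using of_real_eq_iff by blast
qed

text \<open>Parseval's identity gives this for finite sums, and both sides are continuous in \<open>x\<close>.\<close>

lemma bessel:
  assumes x: "x \<in> B" and K: "finite K"
  shows "(\<Sum>s\<in>K. (norm2 \<tau> (fcoeff x s))\<^sup>2) \<le> (norm2 \<tau>' x)\<^sup>2"
proof -
  have fin: "(\<Sum>s\<in>K. (norm2 \<tau> (fcoeff y s))\<^sup>2) \<le> (norm2 \<tau>' y)\<^sup>2" if y: "y \<in> finsums" for y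
  proof -
    from y obtain L where L: "finite L" "y = (\<Sum>s\<in>L. monomial (fcoeff y s) s)" "\<And>s. s \<notin> L \<Longrightarrow> fcoeff y s = 0"
      by (rule finsums_fcoeff) blast
    have "(\<Sum>s\<in>K. (norm2 \<tau> (fcoeff y s))\<^sup>2) = (\<Sum>s\<in>K \<inter> L. (norm2 \<tau> (fcoeff y s))\<^sup>2)"
      by (rule sum.mono_neutral_right) (use K L(3) in auto)
    also have "\<dots> \<le> (\<Sum>s\<in>L. (norm2 \<tau> (fcoeff y s))\<^sup>2)" by (rule sum_mono2) (use L(1) in auto)
    also have "\<dots> = (norm2 \<tau>' (\<Sum>s\<in>L. monomial (fcoeff y s) s))\<^sup>2"
      by (rule parseval[symmetric]) (simp_all add: L(1) fcoeff_A finsums_B y)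
    finally show ?thesis unfolding L(2)[symmetric] .
  qed
  obtain f where f: "\<And>n. f n \<in> finsums" "f \<longlonglongrightarrow> x" using B_sequence[OF x] by blast
  show ?thesis
  proof (rule LIMSEQ_le)
    show "(\<lambda>n. \<Sum>s\<in>K. (norm2 \<tau> (fcoeff (f n) s))\<^sup>2) \<longlonglongrightarrow> (\<Sum>s\<in>K. (norm2 \<tau> (fcoeff x s))\<^sup>2)"
      by (intro tendsto_intros base.norm2_tendsto fcoeff_A finsums_B f x fcoeff_tendsto)
    show "(\<lambda>n. (norm2 \<tau>' (f n))\<^sup>2) \<longlonglongrightarrow> (norm2 \<tau>' x)\<^sup>2"
      by (intro tendsto_intros cross.norm2_tendsto finsums_B f x)
    show "\<exists>N. \<forall>n\<ge>N. (\<Sum>s\<in>K. (norm2 \<tau> (fcoeff (f n) s))\<^sup>2) \<le> (norm2 \<tau>' (f n))\<^sup>2"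
      using fin[OF f(1)] by blast
  qed
qed

lemma norm2_fcoeff_le: assumes "x \<in> B" shows "norm2 \<tau> (fcoeff x s) \<le> norm2 \<tau>' x"
proof (rule power2_le_imp_le)
  show "(norm2 \<tau> (fcoeff x s))\<^sup>2 \<le> (norm2 \<tau>' x)\<^sup>2" using bessel[OF assms, of "{s}"] by simp
qed (simp add: assms)

end

section \<open>Herz--Schur multipliers\<close>

lemma linear_on_subset: "linear_on V \<Phi> \<Longrightarrow> U \<subseteq> V \<Longrightarrow> linear_on U \<Phi>"
  by (auto simp: linear_on_def subset_iff)

lemma cb_norm_le_subset: "cb_norm_le V \<Phi> C \<Longrightarrow> U \<subseteq> V \<Longrightarrow> cb_norm_le U \<Phi> C"
  by (auto simp: cb_norm_le_def opmat_in_def subset_iff)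

text \<open>The extension is a pointwise limit, and the norm of a matrix of fixed size is continuous in the
  entries, so the complete bound survives.\<close>

lemma completely_bounded_closure:
  fixes V :: "('h :: chilbert_space \<Rightarrow>\<^sub>L 'h) set"
  assumes V: "complex_subspace V" and lin: "linear_on V S" and im: "S ` V \<subseteq> V" and cb: "cb_norm_le V S C"
  obtains S' where "linear_on (closure V) S'" "S' ` closure V \<subseteq> closure V"
    "\<And>x. x \<in> V \<Longrightarrow> S' x = S x" "cb_norm_le (closure V) S' (max C 0)"
proof -
  define C' where "C' = max C 0"
  have C': "0 \<le> C'" "cb_norm_le V S C'" using cb_norm_le_mono[OF cb] by (auto simp: C'_def)
  have SV: "S x \<in> V" if "x \<in> V" for x using im that by auto
  have lip: "norm (S x - S y) \<le> C' * norm (x - y)" if "x \<in> V" "y \<in> V" for x y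
    using cb_norm_le_norm[OF C'(2) complex_subspace_diff[OF V that]] linear_on_diff[OF lin V that] by simp
  have "\<exists>f. (\<forall>n. f n \<in> V) \<and> f \<longlonglongrightarrow> x" if "x \<in> closure V" for x
    using that by (simp add: closure_sequential)
  then obtain q where q: "\<And>x n. x \<in> closure V \<Longrightarrow> q x n \<in> V" "\<And>x. x \<in> closure V \<Longrightarrow> q x \<longlonglongrightarrow> x" by metis
  define S' where "S' x = lim (\<lambda>n. S (q x n))" for x
  have conv: "(\<lambda>n. S (q x n)) \<longlonglongrightarrow> S' x" if x: "x \<in> closure V" for x
  proof -
    have "Cauchy (\<lambda>n. S (q x n))"
    proof (rule metric_CauchyI)
      fix e :: real assume e: "0 < e"
      have "0 < e / (C' + 1)" using e C' by simp
      then obtain N where N: "\<And>m n. m \<ge> N \<Longrightarrow> n \<ge> N \<Longrightarrow> norm (q x m - q x n) < e / (C' + 1)"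
        using LIMSEQ_imp_Cauchy[OF q(2)[OF x]] unfolding Cauchy_def dist_norm by blast
      have "dist (S (q x m)) (S (q x n)) < e" if "m \<ge> N" "n \<ge> N" for m n
      proof -
        have "norm (S (q x m) - S (q x n)) \<le> C' * norm (q x m - q x n)" by (intro lip q x)
        also have "\<dots> \<le> C' * (e / (C' + 1))" using N[OF that] C' by (intro mult_left_mono) auto
        also have "\<dots> < e" using C' e by (simp add: field_simps)
        finally show ?thesis by (simp add: dist_norm)
      qed
      then show "\<exists>M. \<forall>m\<ge>M. \<forall>n\<ge>M. dist (S (q x m)) (S (q x n)) < e" by blast
    qed
    then show ?thesis unfolding S'_def by (simp add: Cauchy_convergent_iff convergent_LIMSEQ_iff)
  qed
  have S'lim: "(\<lambda>n. S (f n)) \<longlonglongrightarrow> S' x" if x: "x \<in> closure V" and f: "\<And>n. f n \<in> V" "f \<longlonglongrightarrow> x" for f x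
  proof -
    have "(\<lambda>n. C' * norm (f n - q x n)) \<longlonglongrightarrow> C' * norm (x - x)" by (intro tendsto_intros f q x)
    then have "(\<lambda>n. C' * norm (f n - q x n)) \<longlonglongrightarrow> 0" by simp
    then have "(\<lambda>n. S (f n) - S (q x n)) \<longlonglongrightarrow> 0"
      by (rule Lim_null_comparison[rotated]) (intro always_eventually allI lip f q x)
    from tendsto_add[OF this conv[OF x]] show ?thesis by simp
  qed
  have ext: "S' x = S x" if "x \<in> V" for x
    using S'lim[of x "\<lambda>_. x"] that closure_subset[of V] by (auto simp: LIMSEQ_const_iff)
  note cV = closure_complex_subspace[OF V]
  have "linear_on (closure V) S'"
    unfolding linear_on_def
  proof (intro conjI ballI allI)
    fix x y assume xy: "x \<in> closure V" "y \<in> closure V"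
    have "(\<lambda>n. S (q x n + q y n)) \<longlonglongrightarrow> S' (x + y)"
      by (intro S'lim complex_subspaceD[OF cV] complex_subspaceD[OF V] tendsto_intros q xy)
    moreover have "(\<lambda>n. S (q x n + q y n)) \<longlonglongrightarrow> S' x + S' y"
      unfolding linear_onD(1)[OF lin q(1)[OF xy(1)] q(1)[OF xy(2)]] by (intro tendsto_intros conv xy)
    ultimately show "S' (x + y) = S' x + S' y" by (rule LIMSEQ_unique)
  next
    fix c x assume x: "x \<in> closure V"
    have "(\<lambda>n. S (c *\<^sub>C q x n)) \<longlonglongrightarrow> S' (c *\<^sub>C x)"
      by (intro S'lim complex_subspaceD[OF cV] complex_subspaceD[OF V] q x
          bounded_linear.tendsto[OF bounded_linear_scaleC_blinfun])
    moreover have "(\<lambda>n. S (c *\<^sub>C q x n)) \<longlonglongrightarrow> c *\<^sub>C S' x"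
      unfolding linear_onD(2)[OF lin q(1)[OF x]]
      by (intro bounded_linear.tendsto[OF bounded_linear_scaleC_blinfun] conv x)
    ultimately show "S' (c *\<^sub>C x) = c *\<^sub>C S' x" by (rule LIMSEQ_unique)
  qed
  moreover have "S' ` closure V \<subseteq> closure V"
  proof clarify
    fix x assume x: "x \<in> closure V"
    have "S (q x n) \<in> closure V" for n by (intro subsetD[OF closure_subset] SV q x)
    then show "S' x \<in> closure V" by (rule closed_sequentially[OF closed_closure _ conv[OF x]])
  qed
  moreover have "cb_norm_le (closure V) S' C'"
    unfolding cb_norm_le_def
  proof (intro allI impI)
    fix n b assume b: "opmat_in n (closure V) b"
    then have bV: "b i j \<in> closure V" if "i < n" "j < n" for i j using that by (simp add: opmat_in_def)
    have "opmat_norm n (\<lambda>i j. S' (b i j)) \<le> C' * opmat_norm n b"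
    proof (rule LIMSEQ_le_const)
      let ?c = "\<lambda>k i j. q (b i j) k"
      let ?r = "\<lambda>k. C' * (opmat_norm n b + (\<Sum>i<n. \<Sum>j<n. norm (?c k i j - b i j)))
        + (\<Sum>i<n. \<Sum>j<n. norm (S' (b i j) - S (?c k i j)))"
      have "?r \<longlonglongrightarrow> C' * (opmat_norm n b + (\<Sum>i<n. \<Sum>j<n. norm (b i j - b i j)))
        + (\<Sum>i<n. \<Sum>j<n. norm (S' (b i j) - S' (b i j)))"
        by (intro tendsto_intros q conv bV) auto
      then show "?r \<longlonglongrightarrow> C' * opmat_norm n b" by simp
      have "opmat_norm n (\<lambda>i j. S' (b i j)) \<le> ?r k" for k
      proof -
        have "opmat_norm n (\<lambda>i j. S' (b i j))
          \<le> opmat_norm n (\<lambda>i j. S (?c k i j)) + (\<Sum>i<n. \<Sum>j<n. norm (S' (b i j) - S (?c k i j)))"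
          by (rule opmat_norm_triangle)
        moreover have "opmat_norm n (\<lambda>i j. S (?c k i j)) \<le> C' * opmat_norm n (?c k)"
          using C'(2)[unfolded cb_norm_le_def, rule_format, of n "?c k"] bV q(1) by (simp add: opmat_in_def)
        moreover have "C' * opmat_norm n (?c k) \<le> C' * (opmat_norm n b + (\<Sum>i<n. \<Sum>j<n. norm (?c k i j - b i j)))"
          by (intro mult_left_mono opmat_norm_triangle C')
        ultimately show ?thesis by linarith
      qed
      then show "\<exists>N. \<forall>k\<ge>N. opmat_norm n (\<lambda>i j. S' (b i j)) \<le> ?r k" by blast
    qed
    then show "opmat_norm n (\<lambda>i j. S' (b i j)) \<le> C' * opmat_norm n b" .
  qed
  ultimately show thesis using that ext unfolding C'_def by blast
qed

context dynamics
begin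

text \<open>The properties of a multiplier that concern single coefficients, shared by Herz--Schur
  multipliers and by the candidates obtained from maps of the crossed product.\<close>

definition coefficient_maps :: "('g \<Rightarrow> ('h \<Rightarrow>\<^sub>L 'h) \<Rightarrow> ('h \<Rightarrow>\<^sub>L 'h)) \<Rightarrow> bool" where
  "coefficient_maps F \<longleftrightarrow> (\<forall>t. linear_on A (F t) \<and> F t ` A \<subseteq> A) \<and>
     (\<exists>M. \<forall>t. \<forall>a\<in>A. norm (F t a) \<le> M * norm a)"

lemma coefficient_mapsD:
  assumes "coefficient_maps F"
  shows "linear_on A (F t)" "a \<in> A \<Longrightarrow> F t a \<in> A" "F t 0 = 0"
  using assms linear_on_zero[OF _ A_sub, of "F t"] by (auto simp: coefficient_maps_def)

lemma coefficient_maps_bound: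
  assumes "coefficient_maps F"
  obtains M where "0 \<le> M" "\<And>t a. a \<in> A \<Longrightarrow> norm (F t a) \<le> M * norm a"
proof -
  obtain M where M: "\<And>t a. a \<in> A \<Longrightarrow> norm (F t a) \<le> M * norm a"
    using assms unfolding coefficient_maps_def by blast
  have "norm (F t a) \<le> max M 0 * norm a" if "a \<in> A" for t a
    by (rule order_trans[OF M[OF that] mult_right_mono]) auto
  then show thesis using that[of "max M 0"] by auto
qed

lemma coefficient_maps_tendsto:
  assumes F: "coefficient_maps F" and f: "\<And>n :: nat. f n \<in> A" "f \<longlonglongrightarrow> a"
  shows "(\<lambda>n. F t (f n)) \<longlonglongrightarrow> F t a"
proof -
  obtain M where M: "0 \<le> M" "\<And>t a. a \<in> A \<Longrightarrow> norm (F t a) \<le> M * norm a"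
    using coefficient_maps_bound[OF F] by blast
  have a: "a \<in> A" using closed_sequentially[OF A_closed] f by blast
  show ?thesis by (rule linear_on_tendsto[OF coefficient_mapsD(1)[OF F] M(2) A_sub f(1) a f(2)])
qed

lemma coefficient_maps_l1:
  assumes F: "coefficient_maps F" and f: "f \<in> l1_functions A"
  shows "(\<lambda>t. F t (f t)) \<in> l1_functions A"
proof -
  obtain M where M: "0 \<le> M" "\<And>t a. a \<in> A \<Longrightarrow> norm (F t a) \<le> M * norm a"
    using coefficient_maps_bound[OF F] by blast
  have fA: "f s \<in> A" for s using f by (auto simp: l1_functions_def)
  have "(\<lambda>t. M * norm (f t)) summable_on UNIV"
    using f by (intro summable_on_cmult_right) (simp add: l1_functions_def)
  then have "(\<lambda>t. norm (F t (f t))) summable_on UNIV"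
    by (rule summable_on_comparison_test) (auto intro: M fA)
  then show ?thesis using coefficient_mapsD(2)[OF F fA] by (auto simp: l1_functions_def)
qed

text \<open>This holds on the algebraic crossed product by definition and extends by continuity. It
  describes the induced map on elements that are not absolutely convergent sums.\<close>

lemma multiplier_fcoeff:
  assumes F: "coefficient_maps F" and S: "multiplies_by A \<alpha> F S" "completely_bounded B S" and x: "x \<in> B"
  shows "fcoeff (S x) s = F s (fcoeff x s)"
proof -
  have fin: "fcoeff (S y) s = F s (fcoeff y s)" if y: "y \<in> finsums" for y
  proof -
    obtain f where f: "f \<in> l1_functions A" "y = pi_tilde \<alpha> f" using y by (rule finsums_pi_tilde) blast
    then have "S y = pi_tilde \<alpha> (\<lambda>t. F t (f t))" using S(1) by (simp add: multiplies_by_def)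
    then show ?thesis using f by (simp add: pi_tilde_fcoeff coefficient_maps_l1[OF F])
  qed
  obtain f where f: "\<And>n. f n \<in> finsums" "f \<longlonglongrightarrow> x" using B_sequence[OF x] by blast
  have lin: "linear_on B S" using S(2) by (simp add: completely_bounded_def)
  obtain C where C: "cb_norm_le B S C" using S(2) by (auto simp: completely_bounded_def)
  have "(\<lambda>n. S (f n)) \<longlonglongrightarrow> S x"
    by (rule linear_on_tendsto[OF lin cb_norm_le_norm[OF C] B_sub finsums_B[OF f(1)] x f(2)])
  from fcoeff_tendsto[OF this, of s]
  have "(\<lambda>n. F s (fcoeff (f n) s)) \<longlonglongrightarrow> fcoeff (S x) s" by (simp add: fin f(1))
  moreover have "(\<lambda>n. F s (fcoeff (f n) s)) \<longlonglongrightarrow> F s (fcoeff x s)"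
    by (intro coefficient_maps_tendsto[OF F] fcoeff_A finsums_B f fcoeff_tendsto)
  ultimately show ?thesis by (rule LIMSEQ_unique)
qed

lemma multiplier_monomial:
  assumes F: "coefficient_maps F" and S: "multiplies_by A \<alpha> F S" and a: "a \<in> A"
  shows "S (monomial a s) = monomial (F s a) s"
proof -
  define f where "f t = (if t = s then a else 0)" for t
  have f: "f \<in> l1_functions A" "pi_tilde \<alpha> f = monomial a s"
    using pi_tilde_finite[of "{s}" f] a complex_subspaceD(1)[OF A_sub] by (auto simp: f_def)
  have "pi_tilde \<alpha> (\<lambda>t. F t (f t)) = monomial (F s a) s"
    using pi_tilde_finite[of "{s}" "\<lambda>t. F t (f t)"] a complex_subspaceD(1)[OF A_sub]
    by (auto simp: f_def coefficient_mapsD[OF F])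
  then show ?thesis using S f unfolding multiplies_by_def by metis
qed

text \<open>The map is extended to the closure by complete boundedness. An absolutely convergent sum is
  the norm limit of its finite partial sums, so the multiplier formula survives the limit.\<close>

lemma multiplier_extension:
  assumes F: "coefficient_maps F" and S: "linear_on finsums S" "cb_norm_le finsums S C"
    and SF: "\<And>a s. a \<in> A \<Longrightarrow> S (monomial a s) = monomial (F s a) s"
  obtains S' where "multiplies_by A \<alpha> F S'" "completely_bounded B S'"
proof -
  have SFsum: "S (\<Sum>s\<in>K. monomial (f s) s) = (\<Sum>s\<in>K. monomial (F s (f s)) s)"
    if "\<And>s. f s \<in> A" for K f
    by (subst linear_on_sum[OF S(1) finsums_subspace]) (simp_all add: finsums_monomial that SF)
  have im: "S ` finsums \<subseteq> finsums"
  proof clarify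
    fix x assume "x \<in> finsums"
    then obtain K f where K: "finite K" "\<And>s. f s \<in> A" "x = (\<Sum>s\<in>K. monomial (f s) s)"
      by (rule finsumsE) blast
    show "S x \<in> finsums" unfolding K(3) SFsum[OF K(2)] by (intro finsumsI coefficient_mapsD(2)[OF F] K)
  qed
  obtain S' where S': "linear_on B S'" "S' ` B \<subseteq> B" "\<And>x. x \<in> finsums \<Longrightarrow> S' x = S x"
    "cb_norm_le B S' (max C 0)"
    using completely_bounded_closure[OF finsums_subspace S(1) im S(2)] unfolding B_closure by blast
  have "S' (pi_tilde \<alpha> f) = pi_tilde \<alpha> (\<lambda>t. F t (f t))" if f: "f \<in> l1_functions A" for f
  proof -
    have fA: "f s \<in> A" for s using f by (auto simp: l1_functions_def)
    define P where "P K = (\<Sum>s\<in>K. monomial (f s) s)" for K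
    have P: "(P \<longlongrightarrow> pi_tilde \<alpha> f) (finite_subsets_at_top UNIV)"
      using pi_tilde_has_sum[OF f] by (simp add: has_sum_def P_def[abs_def])
    have PB: "P K \<in> B" for K unfolding P_def by (intro complex_subspace_sum[OF B_sub] monomial_B fA)
    have 1: "((\<lambda>K. S' (P K)) \<longlongrightarrow> S' (pi_tilde \<alpha> f)) (finite_subsets_at_top UNIV)"
      by (rule linear_on_tendsto[OF S'(1) cb_norm_le_norm[OF S'(4)] B_sub PB pi_tilde_B[OF f] P])
    have "((\<lambda>K. \<Sum>s\<in>K. monomial (F s (f s)) s) \<longlongrightarrow> S' (pi_tilde \<alpha> f)) (finite_subsets_at_top UNIV)"
    proof (rule Lim_transform_eventually[OF 1], rule eventually_finite_subsets_at_top_weakI)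
      fix K :: "'g set" assume "finite K"
      then have "P K \<in> finsums" unfolding P_def by (intro finsumsI fA)
      then show "S' (P K) = (\<Sum>s\<in>K. monomial (F s (f s)) s)"
        using S'(3) SFsum[OF fA] by (simp add: P_def)
    qed
    then show ?thesis
      using has_sum_unique[OF _ pi_tilde_has_sum[OF coefficient_maps_l1[OF F f]]] by (simp add: has_sum_def)
  qed
  then have "multiplies_by A \<alpha> F S'" by (simp add: multiplies_by_def)
  moreover have "completely_bounded B S'" using S' by (auto simp: completely_bounded_def)
  ultimately show thesis by (rule that)
qed

lemma herz_schur_coefficient_maps:
  assumes "herz_schur_multiplier A \<alpha> F" shows "coefficient_maps F"
proof -
  obtain C where C: "\<And>t. cb_norm_le A (F t) C" using assms unfolding herz_schur_multiplier_def by blast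
  have "\<forall>t. \<forall>a\<in>A. norm (F t a) \<le> C * norm a" using cb_norm_le_norm[OF C] by blast
  then show ?thesis
    using assms by (auto simp: herz_schur_multiplier_def completely_bounded_def coefficient_maps_def)
qed

text \<open>The induced map is given by a choice operator, so these properties rest on the existence
  of the extension to the whole crossed product.\<close>

lemma herz_schur_map_multiplies:
  assumes F: "herz_schur_multiplier A \<alpha> F"
  shows "multiplies_by A \<alpha> F (herz_schur_map A \<alpha> F)" "completely_bounded B (herz_schur_map A \<alpha> F)"
proof -
  have cm: "coefficient_maps F" by (rule herz_schur_coefficient_maps[OF F])
  obtain S where S: "multiplies_by A \<alpha> F S" "completely_bounded (pi_tilde \<alpha> ` l1_functions A) S"
    using F by (auto simp: herz_schur_multiplier_def)
  have sub: "finsums \<subseteq> pi_tilde \<alpha> ` l1_functions A" by (blast elim: finsums_pi_tilde)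
  have lin: "linear_on finsums S"
    by (rule linear_on_subset[OF _ sub]) (use S(2) in \<open>simp add: completely_bounded_def\<close>)
  obtain C where "cb_norm_le (pi_tilde \<alpha> ` l1_functions A) S C" using S(2) by (auto simp: completely_bounded_def)
  then have "cb_norm_le finsums S C" by (rule cb_norm_le_subset[OF _ sub])
  from multiplier_extension[OF cm lin this multiplier_monomial[OF cm S(1)]]
  have "\<exists>S. multiplies_by A \<alpha> F S \<and> completely_bounded B S" by blast
  from someI_ex[OF this]
  show "multiplies_by A \<alpha> F (herz_schur_map A \<alpha> F)" "completely_bounded B (herz_schur_map A \<alpha> F)"
    unfolding herz_schur_map_def by blast+
qed

end

section \<open>From multipliers to maps on the crossed product\<close>

context cstar_state
begin

text \<open>The Kadison--Schwarz inequality \<open>\<Phi>(b)\<^sup>* \<Phi>(b) \<le> \<Phi>(b\<^sup>* b)\<close> is evaluated at the state, which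
  \<open>\<Phi>\<close> does not increase on \<open>b\<^sup>* b\<close>.\<close>

lemma L2_contraction:
  assumes cp: "completely_positive B \<Phi>" and un: "unital_map \<Phi>" and td: "trace_decreasing B \<sigma> \<Phi>"
    and b: "b \<in> B"
  shows "norm2 \<sigma> (\<Phi> b) \<le> norm2 \<sigma> b"
proof -
  have \<Phi>B: "\<Phi> a \<in> B" if "a \<in> B" for a using cp that by (auto simp: completely_positive_def)
  define x where "x = adj b o\<^sub>L b"
  have x: "x \<in> B" "positive_op x" unfolding x_def using b by (auto intro: mult adjB positive_op_square)
  define c where "c = \<Phi> x - (adj (\<Phi> b) o\<^sub>L \<Phi> b)"
  have c: "c \<in> B" unfolding c_def by (intro subB mult adjB \<Phi>B b x)
  have "positive_op c"
    unfolding positive_op_def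
  proof
    fix h
    have "complex_of_real ((norm (\<Phi> b h))\<^sup>2) \<le> cinner (\<Phi> x h) h"
      unfolding x_def
      by (rule completely_positive_Schwarz[OF unital_cstar_algebra_operator_system[OF alg] cp un b])
        (auto intro: mult adjB b)
    moreover have "cinner (c h) h = cinner (\<Phi> x h) h - complex_of_real ((norm (\<Phi> b h))\<^sup>2)"
      by (simp add: c_def blinfun.diff_left cinner.diff_left is_adjointD[OF adjB(2)[OF \<Phi>B[OF b]]] cinner_self)
    ultimately show "cinner (c h) h \<in> \<real>\<^sub>\<ge>\<^sub>0" by (simp add: less_eq_complex_def complex_nonneg_Reals_iff)
  qed
  then have "\<sigma> c \<in> \<real>\<^sub>\<ge>\<^sub>0" by (rule \<sigma>_pos[OF c])
  moreover have "\<sigma> c = \<sigma> (\<Phi> x) - ip (\<Phi> b) (\<Phi> b)"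
    unfolding c_def ip_def by (intro \<sigma>_diff \<Phi>B x mult adjB b)
  ultimately have "Re (ip (\<Phi> b) (\<Phi> b)) \<le> Re (\<sigma> (\<Phi> x))" by (simp add: complex_nonneg_Reals_iff)
  also have "\<dots> \<le> Re (\<sigma> x)" using td x by (simp add: trace_decreasing_def)
  also have "\<sigma> x = ip b b" by (simp add: x_def ip_def)
  finally have "(norm2 \<sigma> (\<Phi> b))\<^sup>2 \<le> (norm2 \<sigma> b)\<^sup>2"
    unfolding ip_self[OF b] ip_self[OF \<Phi>B[OF b]] Re_complex_of_real .
  then show ?thesis by (rule power2_le_imp_le) (simp add: b)
qed

lemma L2_bounded_contraction:
  assumes "completely_positive B \<Phi>" "unital_map \<Phi>" "trace_decreasing B \<sigma> \<Phi>"
  shows "L2_bounded B \<sigma> \<Phi>"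
  unfolding L2_bounded_def using L2_contraction[OF assms] by (intro exI[of _ 1]) auto

end

text \<open>Both Haagerup properties prescribe the type of the indices of the net. A net that comes from
  the other property is indexed differently and has to be re-indexed.\<close>

lemma cstar_haagerupI:
  fixes I :: "'i set" and B :: "('h :: chilbert_space \<Rightarrow>\<^sub>L 'h) set"
  assumes dir: "directed_set I le"
    and \<Phi>: "\<And>i. i \<in> I \<Longrightarrow> completely_positive B (\<Phi> i) \<and> unital_map (\<Phi> i) \<and>
           trace_decreasing B \<sigma> (\<Phi> i) \<and> L2_compact B \<sigma> (\<Phi> i)"
    and lim: "\<And>x. x \<in> B \<Longrightarrow> ((\<lambda>i. norm2 \<sigma> (\<Phi> i x - x)) \<longlongrightarrow> 0) (net_filter I le)"
  shows "cstar_haagerup B \<sigma>"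
proof -
  obtain J :: "(('h \<Rightarrow>\<^sub>L 'h) \<Rightarrow> ('h \<Rightarrow>\<^sub>L 'h)) net_index set" and le' \<Psi> where J: "directed_set J le'"
    "\<Psi> ` J = \<Phi> ` I" "filtermap \<Psi> (net_filter J le') = filtermap \<Phi> (net_filter I le)"
    by (rule net_index_universal[OF dir])
  have "((\<lambda>i. norm2 \<sigma> (\<Psi> i x - x)) \<longlongrightarrow> 0) (net_filter J le')" if "x \<in> B" for x
    using lim[OF that] J(3) filterlim_filtermap[of "\<lambda>\<phi>. norm2 \<sigma> (\<phi> x - x)"] by metis
  moreover have "completely_positive B (\<Psi> i) \<and> unital_map (\<Psi> i) \<and>
      trace_decreasing B \<sigma> (\<Psi> i) \<and> L2_compact B \<sigma> (\<Psi> i)" if i: "i \<in> J" for i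
  proof -
    have "\<Psi> i \<in> \<Phi> ` I" using J(2) i by blast
    then show ?thesis using \<Phi> by auto
  qed
  ultimately show ?thesis unfolding cstar_haagerup_def using J(1) by blast
qed

lemma system_haagerupI:
  fixes I :: "'i set" and A :: "('h :: chilbert_space \<Rightarrow>\<^sub>L 'h) set"
    and \<alpha> :: "'g :: group_add \<Rightarrow> ('h \<Rightarrow>\<^sub>L 'h) \<Rightarrow> ('h \<Rightarrow>\<^sub>L 'h)"
  assumes dir: "directed_set I le"
    and F: "\<And>i. i \<in> I \<Longrightarrow> cp_herz_schur_multiplier A \<alpha> (F i) \<and>
           unital_map (F i 0) \<and> trace_decreasing A \<tau> (F i 0) \<and>
           (\<forall>t. L2_compact A \<tau> (F i t)) \<and>
           ((\<lambda>s. L2_opnorm A \<tau> (F i s)) \<longlongrightarrow> 0) cofinite"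
    and lim: "\<And>t a. a \<in> A \<Longrightarrow> ((\<lambda>i. norm2 \<tau> (F i t a - a)) \<longlongrightarrow> 0) (net_filter I le)"
  shows "system_haagerup A \<alpha> \<tau>"
proof -
  obtain J :: "('g \<Rightarrow> ('h \<Rightarrow>\<^sub>L 'h) \<Rightarrow> ('h \<Rightarrow>\<^sub>L 'h)) net_index set" and le' \<Psi> where J: "directed_set J le'"
    "\<Psi> ` J = F ` I" "filtermap \<Psi> (net_filter J le') = filtermap F (net_filter I le)"
    by (rule net_index_universal[OF dir])
  have "((\<lambda>i. norm2 \<tau> (\<Psi> i t a - a)) \<longlongrightarrow> 0) (net_filter J le')" if "a \<in> A" for t a
    using lim[OF that, of t] J(3) filterlim_filtermap[of "\<lambda>f. norm2 \<tau> (f t a - a)"] by metis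
  moreover have "cp_herz_schur_multiplier A \<alpha> (\<Psi> i) \<and>
           unital_map (\<Psi> i 0) \<and> trace_decreasing A \<tau> (\<Psi> i 0) \<and>
           (\<forall>t. L2_compact A \<tau> (\<Psi> i t)) \<and>
           ((\<lambda>s. L2_opnorm A \<tau> (\<Psi> i s)) \<longlongrightarrow> 0) cofinite" if i: "i \<in> J" for i
  proof -
    have "\<Psi> i \<in> F ` I" using J(2) i by blast
    then obtain j where "j \<in> I" "\<Psi> i = F j" by blast
    then show ?thesis using F[of j] by simp
  qed
  ultimately show ?thesis unfolding system_haagerup_def using J(1) by blast
qed

lemma eventually_in_net:
  assumes "directed_set I le" shows "\<forall>\<^sub>F i in net_filter I le. i \<in> I"
proof -
  have "I \<noteq> {}" using assms by (simp add: directed_set_def)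
  then show ?thesis unfolding eventually_net_filter[OF assms] by blast
qed

context trace_preserving_dynamics
begin

context
  fixes F :: "'g \<Rightarrow> ('h \<Rightarrow>\<^sub>L 'h) \<Rightarrow> ('h \<Rightarrow>\<^sub>L 'h)" and S
  assumes F: "cp_herz_schur_multiplier A \<alpha> F" and F_unital: "unital_map (F 0)"
    and F_trace: "trace_decreasing A \<tau> (F 0)"
  defines "S \<equiv> herz_schur_map A \<alpha> F"
begin

lemma F_herz_schur: "herz_schur_multiplier A \<alpha> F" and S_cp: "completely_positive B S"
  using F by (simp_all add: cp_herz_schur_multiplier_def S_def)

lemma F_maps: "coefficient_maps F"
  by (rule herz_schur_coefficient_maps[OF F_herz_schur])

lemma S_mult: "multiplies_by A \<alpha> F S" and S_cb: "completely_bounded B S"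
  using herz_schur_map_multiplies[OF F_herz_schur] by (simp_all add: S_def)

lemma S_fcoeff: "x \<in> B \<Longrightarrow> fcoeff (S x) s = F s (fcoeff x s)"
  by (rule multiplier_fcoeff[OF F_maps S_mult S_cb])

lemma S_monomial: "a \<in> A \<Longrightarrow> S (monomial a s) = monomial (F s a) s"
  by (rule multiplier_monomial[OF F_maps S_mult])

lemma S_lin: "linear_on B S" and S_B: "S ` B \<subseteq> B"
  using S_cp by (auto simp: completely_positive_def)

lemma S_unital: "unital_map S"
  using S_monomial[OF A_id, of 0] F_unital by (simp add: unital_map_def monomial_id)

lemma S_trace: "trace_decreasing B \<tau>' S"
  using F_trace S_B
  by (auto simp: trace_decreasing_def \<tau>'_fcoeff S_fcoeff fcoeff_A fcoeff_0_positive image_subset_iff)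

lemma S_contraction: "x \<in> B \<Longrightarrow> norm2 \<tau>' (S x) \<le> norm2 \<tau>' x"
  by (rule cross.L2_contraction[OF S_cp S_unital S_trace])

lemma S_norm: "x \<in> B \<Longrightarrow> norm (S x) \<le> norm x"
  by (rule completely_positive_contractive[OF unital_cstar_algebra_operator_system[OF B_alg] S_cp S_unital])

lemma S_tendsto:
  assumes f: "\<And>n. f n \<in> B" "f \<longlonglongrightarrow> x" "x \<in> B" shows "(\<lambda>n. S (f n)) \<longlonglongrightarrow> S x"
  by (rule linear_on_tendsto[OF S_lin _ B_sub f(1,3,2), where C = 1]) (simp add: S_norm)

text \<open>On \<open>L\<^sup>2\<close> the map is the orthogonal sum of the maps \<open>F s\<close>, so outside a finite set of group
  elements it is as small as they are.\<close>

lemma S_tail: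
  assumes K: "finite K" and e: "0 \<le> e"
    and small: "\<And>s a. s \<notin> K \<Longrightarrow> a \<in> A \<Longrightarrow> norm2 \<tau> (F s a) \<le> e * norm2 \<tau> a" and x: "x \<in> B"
  shows "norm2 \<tau>' (S x - (\<Sum>s\<in>K. monomial (F s (fcoeff x s)) s)) \<le> e * norm2 \<tau>' x"
proof -
  let ?D = "\<lambda>y. S y - (\<Sum>s\<in>K. monomial (F s (fcoeff y s)) s)"
  have FA: "F s a \<in> A" if "a \<in> A" for s a by (rule coefficient_mapsD(2)[OF F_maps that])
  have DB: "?D y \<in> B" if "y \<in> B" for y
    using S_B that by (intro cross.subB complex_subspace_sum[OF B_sub] monomial_B FA fcoeff_A) auto
  have fin: "norm2 \<tau>' (?D y) \<le> e * norm2 \<tau>' y" if y: "y \<in> finsums" for y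
  proof -
    define c where "c s = fcoeff y s" for s
    from y obtain L where L: "finite L" "y = (\<Sum>s\<in>L. monomial (c s) s)" "\<And>s. s \<notin> L \<Longrightarrow> c s = 0"
      unfolding c_def by (rule finsums_fcoeff) blast
    have cA: "c s \<in> A" for s unfolding c_def by (rule fcoeff_A[OF finsums_B[OF y]])
    have "S y = (\<Sum>s\<in>L. monomial (F s (c s)) s)"
      unfolding L(2) by (subst linear_on_sum[OF S_lin B_sub]) (simp_all add: monomial_B cA S_monomial)
    moreover have "(\<Sum>s\<in>K. monomial (F s (c s)) s) = (\<Sum>s\<in>L \<inter> K. monomial (F s (c s)) s)"
    proof (rule sum.mono_neutral_right[OF K])
      show "\<forall>s\<in>K - L \<inter> K. monomial (F s (c s)) s = 0"
      proof
        fix s assume "s \<in> K - L \<inter> K"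
        then have "c s = 0" by (intro L(3)) auto
        then show "monomial (F s (c s)) s = 0" by (simp add: coefficient_mapsD(3)[OF F_maps])
      qed
    qed simp
    moreover have "(\<Sum>s\<in>L. monomial (F s (c s)) s)
        = (\<Sum>s\<in>L \<inter> K. monomial (F s (c s)) s) + (\<Sum>s\<in>L - K. monomial (F s (c s)) s)"
      using sum.Int_Diff[OF L(1)] by blast
    ultimately have D: "?D y = (\<Sum>s\<in>L - K. monomial (F s (c s)) s)" unfolding c_def[symmetric] by simp
    have "(norm2 \<tau>' (?D y))\<^sup>2 = (\<Sum>s\<in>L - K. (norm2 \<tau> (F s (c s)))\<^sup>2)"
      unfolding D by (rule parseval) (use L(1) FA cA in auto)
    also have "\<dots> \<le> (\<Sum>s\<in>L - K. (e * norm2 \<tau> (c s))\<^sup>2)"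
      by (intro sum_mono power_mono small) (auto simp: cA FA)
    also have "\<dots> \<le> (\<Sum>s\<in>L. (e * norm2 \<tau> (c s))\<^sup>2)"
      by (rule sum_mono2) (use L(1) in auto)
    also have "\<dots> = e\<^sup>2 * (\<Sum>s\<in>L. (norm2 \<tau> (c s))\<^sup>2)" by (simp add: power_mult_distrib sum_distrib_left)
    also have "(\<Sum>s\<in>L. (norm2 \<tau> (c s))\<^sup>2) = (norm2 \<tau>' y)\<^sup>2"
      unfolding L(2) by (rule parseval[symmetric]) (use L(1) cA in auto)
    finally have "(norm2 \<tau>' (?D y))\<^sup>2 \<le> (e * norm2 \<tau>' y)\<^sup>2" by (simp add: power_mult_distrib)
    then show ?thesis by (rule power2_le_imp_le) (simp add: e finsums_B y)
  qed
  obtain f where f: "\<And>n. f n \<in> finsums" "f \<longlonglongrightarrow> x" using B_sequence[OF x] by blast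
  have mt: "(\<lambda>n. monomial (F s (fcoeff (f n) s)) s) \<longlonglongrightarrow> monomial (F s (fcoeff x s)) s" for s
  proof -
    have fA: "fcoeff (f n) s \<in> A" for n by (rule fcoeff_A[OF finsums_B[OF f(1)]])
    have "(\<lambda>n. F s (fcoeff (f n) s)) \<longlonglongrightarrow> F s (fcoeff x s)"
      by (rule coefficient_maps_tendsto[OF F_maps fA fcoeff_tendsto[OF f(2)]])
    from linear_on_tendsto[OF linear_on_monomial _ A_sub FA[OF fA] FA[OF fcoeff_A[OF x]] this, where C = 1]
    show ?thesis by (simp add: norm_monomial_le)
  qed
  show ?thesis
  proof (rule LIMSEQ_le)
    show "(\<lambda>n. norm2 \<tau>' (?D (f n))) \<longlonglongrightarrow> norm2 \<tau>' (?D x)"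
      by (intro cross.norm2_tendsto DB finsums_B f x tendsto_diff S_tendsto tendsto_sum mt)
    show "(\<lambda>n. e * norm2 \<tau>' (f n)) \<longlonglongrightarrow> e * norm2 \<tau>' x"
      by (intro tendsto_intros cross.norm2_tendsto finsums_B f x)
    show "\<exists>N. \<forall>n\<ge>N. norm2 \<tau>' (?D (f n)) \<le> e * norm2 \<tau>' (f n)" using fin[OF f(1)] by blast
  qed
qed

text \<open>Up to a small error the image of the unit ball lies in a finite orthogonal sum of totally
  bounded sets.\<close>

lemma S_L2_compact:
  assumes cpt: "\<And>t. L2_compact A \<tau> (F t)" and van: "((\<lambda>s. L2_opnorm A \<tau> (F s)) \<longlongrightarrow> 0) cofinite"
  shows "L2_compact B \<tau>' S"
proof -
  have FA: "F s a \<in> A" if "a \<in> A" for s a by (rule coefficient_mapsD(2)[OF F_maps that])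
  have Flin: "linear_on A (F s)" and FA': "F s ` A \<subseteq> A" for s
    using coefficient_mapsD(1)[OF F_maps] FA by auto
  have Fb: "L2_bounded A \<tau> (F s)" and Ft: "base.L2_totally_bounded (F s)" for s
    using cpt[of s] base.L2_compact_iff[OF Flin FA'] by auto
  have "cross.L2_totally_bounded S"
    unfolding cross.L2_totally_bounded_def
  proof (intro allI impI)
    fix e :: real assume e: "0 < e"
    define K where "K = {s. \<not> L2_opnorm A \<tau> (F s) < e / 3}"
    have "\<forall>\<^sub>F s in cofinite. L2_opnorm A \<tau> (F s) < e / 3"
      using van by (rule order_tendstoD) (use e in simp)
    then have K: "finite K" by (simp add: K_def eventually_cofinite)
    \<comment> \<open>The errors of the finitely many blocks add up to at most \<open>e / 3\<close>; the summand \<open>1\<close> covers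
      the case that there are none.\<close>
    define d where "d = e / (3 * (real (card K) + 1))"
    have d: "0 < d" "card K * d \<le> e / 3"
      using e by (simp_all add: d_def field_simps)
    have small: "norm2 \<tau> (F s a) \<le> e / 3 * norm2 \<tau> a" if "s \<notin> K" "a \<in> A" for s a
    proof -
      have "norm2 \<tau> (F s a) \<le> L2_opnorm A \<tau> (F s) * norm2 \<tau> a"
        by (rule base.norm2_le_opnorm[OF Flin FA' Fb that(2)])
      also have "\<dots> \<le> e / 3 * norm2 \<tau> a" using that by (intro mult_right_mono) (auto simp: K_def)
      finally show ?thesis .
    qed
    have "\<exists>k. finite k \<and> k \<subseteq> A \<and> (\<forall>a\<in>A. norm2 \<tau> a \<le> 1 \<longrightarrow> (\<exists>c\<in>k. norm2 \<tau> (F s a - c) < d))" for s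
      using Ft[of s] d(1) unfolding base.L2_totally_bounded_def by blast
    then obtain k where k: "\<And>s. finite (k s)" "\<And>s. k s \<subseteq> A"
      "\<And>s a. a \<in> A \<Longrightarrow> norm2 \<tau> a \<le> 1 \<Longrightarrow> \<exists>c\<in>k s. norm2 \<tau> (F s a - c) < d" by metis
    define N where "N = (\<lambda>g. \<Sum>s\<in>K. monomial (g s) s) ` (PiE K k)"
    have "finite N" unfolding N_def using K k(1) by (intro finite_imageI finite_PiE) auto
    moreover have "N \<subseteq> B"
      unfolding N_def using k(2)
      by (auto intro!: complex_subspace_sum[OF B_sub] monomial_B dest!: PiE_mem)
    moreover have "\<exists>z\<in>N. norm2 \<tau>' (S x - z) < e" if x: "x \<in> B" "norm2 \<tau>' x \<le> 1" for x
    proof -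
      have "\<exists>c\<in>k s. norm2 \<tau> (F s (fcoeff x s) - c) < d" for s
        by (rule k(3)[OF fcoeff_A[OF x(1)] order_trans[OF norm2_fcoeff_le[OF x(1)] x(2)]])
      then obtain g where g: "\<And>s. g s \<in> k s" "\<And>s. norm2 \<tau> (F s (fcoeff x s) - g s) < d" by metis
      have gA: "g s \<in> A" for s using g k by blast
      have FxA: "F s (fcoeff x s) \<in> A" for s by (intro FA fcoeff_A x)
      define z where "z = (\<Sum>s\<in>K. monomial (g s) s)"
      define y where "y = (\<Sum>s\<in>K. monomial (F s (fcoeff x s)) s)"
      have zN: "z \<in> N"
        unfolding N_def z_def by (rule image_eqI[of _ _ "restrict g K"]) (auto simp: g)
      have B: "S x \<in> B" "y \<in> B" "z \<in> B"
        using S_B x(1) unfolding y_def z_def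
        by (auto intro!: complex_subspace_sum[OF B_sub] monomial_B FxA gA)
      have "norm2 \<tau>' (S x - y) \<le> e / 3 * norm2 \<tau>' x"
        unfolding y_def by (rule S_tail[OF K _ small x(1)]) (use e in auto)
      also have "\<dots> \<le> e / 3 * 1" using e x(2) by (intro mult_left_mono) auto
      finally have 1: "norm2 \<tau>' (S x - y) \<le> e / 3" by simp
      have "y - z = (\<Sum>s\<in>K. monomial (F s (fcoeff x s) - g s) s)"
        by (simp add: y_def z_def monomial_diff FxA gA sum_subtractf)
      also have "norm2 \<tau>' \<dots> \<le> (\<Sum>s\<in>K. norm2 \<tau>' (monomial (F s (fcoeff x s) - g s) s))"
        by (intro cross.norm2_sum_le monomial_B base.subB FxA gA)
      also have "\<dots> = (\<Sum>s\<in>K. norm2 \<tau> (F s (fcoeff x s) - g s))"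
        by (intro sum.cong refl norm2_monomial base.subB FxA gA)
      also have "\<dots> \<le> (\<Sum>s\<in>K. d)" by (intro sum_mono less_imp_le g)
      also have "\<dots> \<le> e / 3" using d(2) by simp
      finally have 2: "norm2 \<tau>' (y - z) \<le> e / 3" .
      have "norm2 \<tau>' (S x - z) \<le> norm2 \<tau>' (S x - y) + norm2 \<tau>' (y - z)"
        by (rule cross.norm2_triangle_diff[OF B])
      also have "\<dots> < e" using 1 2 e by linarith
      finally show ?thesis using zN by blast
    qed
    ultimately show "\<exists>K. finite K \<and> K \<subseteq> B \<and> (\<forall>b\<in>B. norm2 \<tau>' b \<le> 1 \<longrightarrow> (\<exists>k\<in>K. norm2 \<tau>' (S b - k) < e))"
      by blast
  qed
  then show ?thesis
    using cross.L2_compact_iff[OF S_lin S_B] cross.L2_bounded_contraction[OF S_cp S_unital S_trace] by blast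
qed

end

text \<open>On finite sums, convergence is that of finitely many coefficients. It extends to the closure
  because all maps of the net are contractions for the \<open>L\<^sup>2\<close>-seminorm.\<close>

lemma crossed_product_haagerup:
  assumes sys: "system_haagerup A \<alpha> \<tau>" shows "cstar_haagerup B \<tau>'"
proof -
  from sys obtain I :: "('g \<Rightarrow> ('h \<Rightarrow>\<^sub>L 'h) \<Rightarrow> ('h \<Rightarrow>\<^sub>L 'h)) net_index set" and le F
    where dir: "directed_set I le"
      and F: "\<And>i. i \<in> I \<Longrightarrow> cp_herz_schur_multiplier A \<alpha> (F i)" "\<And>i. i \<in> I \<Longrightarrow> unital_map (F i 0)"
        "\<And>i. i \<in> I \<Longrightarrow> trace_decreasing A \<tau> (F i 0)" "\<And>i t. i \<in> I \<Longrightarrow> L2_compact A \<tau> (F i t)"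
        "\<And>i. i \<in> I \<Longrightarrow> ((\<lambda>s. L2_opnorm A \<tau> (F i s)) \<longlongrightarrow> 0) cofinite"
      and lim: "\<And>t a. a \<in> A \<Longrightarrow> ((\<lambda>i. norm2 \<tau> (F i t a - a)) \<longlongrightarrow> 0) (net_filter I le)"
    unfolding system_haagerup_def by blast
  define S where "S i = herz_schur_map A \<alpha> (F i)" for i
  note fs = F(1-3)
  show ?thesis
  proof (rule cstar_haagerupI[OF dir, where \<Phi> = S])
    fix i assume i: "i \<in> I"
    show "completely_positive B (S i) \<and> unital_map (S i) \<and> trace_decreasing B \<tau>' (S i) \<and> L2_compact B \<tau>' (S i)"
      unfolding S_def
      by (intro conjI S_cp[OF fs] S_unital[OF fs] S_trace[OF fs] S_L2_compact[OF fs] F(4,5) i)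
  next
    fix x assume x: "x \<in> B"
    have Sx: "S i y \<in> B" if "i \<in> I" "y \<in> B" for i y
      using S_B[OF fs] that unfolding S_def by blast
    have fin: "((\<lambda>i. norm2 \<tau>' (S i y - y)) \<longlongrightarrow> 0) (net_filter I le)" if y: "y \<in> finsums" for y
    proof -
      obtain K f where K: "finite K" "\<And>s. f s \<in> A" "y = (\<Sum>s\<in>K. monomial (f s) s)"
        using y by (rule finsumsE) blast
      have "((\<lambda>i. \<Sum>s\<in>K. norm2 \<tau> (F i s (f s) - f s)) \<longlongrightarrow> (\<Sum>s\<in>K. 0)) (net_filter I le)"
        by (intro tendsto_sum lim K)
      then have l: "((\<lambda>i. \<Sum>s\<in>K. norm2 \<tau> (F i s (f s) - f s)) \<longlongrightarrow> 0) (net_filter I le)" by simp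
      show ?thesis
      proof (rule Lim_null_comparison[OF _ l])
        show "\<forall>\<^sub>F i in net_filter I le. norm (norm2 \<tau>' (S i y - y)) \<le> (\<Sum>s\<in>K. norm2 \<tau> (F i s (f s) - f s))"
          using eventually_in_net[OF dir]
        proof (rule eventually_mono)
          fix i assume i: "i \<in> I"
          have FA: "F i s (f s) \<in> A" for s
            by (rule coefficient_mapsD(2)[OF F_maps[OF F(1)[OF i] F(2)[OF i] F(3)[OF i]] K(2)])
          have "S i y = (\<Sum>s\<in>K. S i (monomial (f s) s))"
            unfolding K(3) S_def
            by (rule linear_on_sum[OF S_lin[OF F(1)[OF i] F(2)[OF i] F(3)[OF i]] B_sub]) (rule monomial_B[OF K(2)])
          also have "\<dots> = (\<Sum>s\<in>K. monomial (F i s (f s)) s)"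
            unfolding S_def by (intro sum.cong refl S_monomial fs i K)
          finally have "S i y - y = (\<Sum>s\<in>K. monomial (F i s (f s) - f s) s)"
            by (simp add: K(3) monomial_diff FA K(2) sum_subtractf)
          then have "norm2 \<tau>' (S i y - y) \<le> (\<Sum>s\<in>K. norm2 \<tau>' (monomial (F i s (f s) - f s) s))"
            by (simp add: cross.norm2_sum_le monomial_B base.subB FA K(2))
          also have "\<dots> = (\<Sum>s\<in>K. norm2 \<tau> (F i s (f s) - f s))"
            by (intro sum.cong refl norm2_monomial base.subB FA K)
          finally show "norm (norm2 \<tau>' (S i y - y)) \<le> (\<Sum>s\<in>K. norm2 \<tau> (F i s (f s) - f s))"
            using i y by (simp add: Sx finsums_B cross.subB)
        qed
      qed
    qed
    show "((\<lambda>i. norm2 \<tau>' (S i x - x)) \<longlongrightarrow> 0) (net_filter I le)"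
    proof (rule tendstoI)
      fix e :: real assume e: "0 < e"
      obtain f where f: "\<And>n. f n \<in> finsums" "f \<longlonglongrightarrow> x" using B_sequence[OF x] by blast
      obtain n where n: "norm (f n - x) < e / 3"
        using LIMSEQ_D[OF f(2), of "e / 3"] e by auto
      define y where "y = f n"
      have y: "y \<in> finsums" "y \<in> B" using f(1) finsums_B by (auto simp: y_def)
      have xy: "norm2 \<tau>' (y - x) < e / 3"
        using cross.norm2_le_norm[OF cross.subB(4)[OF y(2) x]] n by (simp add: y_def)
      have "\<forall>\<^sub>F i in net_filter I le. norm2 \<tau>' (S i y - y) < e / 3"
        using fin[OF y(1)] by (rule order_tendstoD) (use e in simp)
      with eventually_in_net[OF dir]
      show "\<forall>\<^sub>F i in net_filter I le. dist (norm2 \<tau>' (S i x - x)) 0 < e"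
      proof eventually_elim
        fix i assume i: "i \<in> I" and sy: "norm2 \<tau>' (S i y - y) < e / 3"
        have "S i x - S i y = S i (x - y)"
          unfolding S_def by (rule linear_on_diff[OF S_lin[OF F(1)[OF i] F(2)[OF i] F(3)[OF i]] B_sub x y(2), symmetric])
        then have "norm2 \<tau>' (S i x - S i y) \<le> norm2 \<tau>' (x - y)"
          unfolding S_def using S_contraction[OF F(1)[OF i] F(2)[OF i] F(3)[OF i] cross.subB(4)[OF x y(2)]] by simp
        moreover have "norm2 \<tau>' (S i x - x) \<le> norm2 \<tau>' (S i x - S i y) + norm2 \<tau>' (S i y - x)"
          by (intro cross.norm2_triangle_diff Sx i x y)
        moreover have "norm2 \<tau>' (S i y - x) \<le> norm2 \<tau>' (S i y - y) + norm2 \<tau>' (y - x)"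
          by (intro cross.norm2_triangle_diff Sx i x y)
        ultimately have "norm2 \<tau>' (S i x - x) < e"
          using sy xy cross.norm2_minus_commute[OF x y(2)] by linarith
        then show "dist (norm2 \<tau>' (S i x - x)) 0 < e"
          using i x by (simp add: Sx cross.subB)
      qed
    qed
  qed
qed

end

section \<open>From maps on the crossed product to multipliers\<close>

lemma opmat_norm_entry_le:
  fixes b :: "nat \<Rightarrow> nat \<Rightarrow> ('i, 'h :: chilbert_space) ell2 \<Rightarrow>\<^sub>L ('i, 'h) ell2"
  shows "opmat_norm n (\<lambda>i j. entry (b i j) r s) \<le> opmat_norm n b"
proof (rule opmat_norm_leI)
  fix x :: "nat \<Rightarrow> 'h"
  have "(\<Sum>i<n. (norm (\<Sum>j<n. entry (b i j) r s (x j)))\<^sup>2)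
    \<le> (\<Sum>i<n. (norm (\<Sum>j<n. b i j (point s (x j))))\<^sup>2)"
    unfolding ell2_apply_entry[symmetric] ell2_apply_sum[symmetric]
    by (intro sum_mono power_mono norm_ell2_apply_le) simp
  also have "\<dots> \<le> (opmat_norm n b)\<^sup>2 * (\<Sum>j<n. (norm (point s (x j) :: ('i, 'h) ell2))\<^sup>2)"
    by (rule opmat_norm_bound)
  finally show "(\<Sum>i<n. (norm (\<Sum>j<n. entry (b i j) r s (x j)))\<^sup>2)
    \<le> (opmat_norm n b)\<^sup>2 * (\<Sum>j<n. (norm (x j))\<^sup>2)" by simp
qed simp

lemma has_sum_nonneg_Reals:
  fixes f :: "'a \<Rightarrow> complex"
  assumes "(f has_sum S) X" "\<And>x. x \<in> X \<Longrightarrow> f x \<in> \<real>\<^sub>\<ge>\<^sub>0" shows "S \<in> \<real>\<^sub>\<ge>\<^sub>0"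
proof -
  have "0 \<le> Re S" by (rule has_sum_nonneg[OF has_sum_Re[OF assms(1)]]) (use assms(2) in \<open>simp add: complex_nonneg_Reals_iff\<close>)
  moreover have "((\<lambda>x. 0) has_sum Im S) X"
    using has_sum_Im[OF assms(1)] by (rule has_sum_cong[THEN iffD1, rotated])
      (use assms(2) in \<open>simp add: complex_nonneg_Reals_iff\<close>)
  then have "Im S = 0" using has_sum_unique[OF _ has_sum_0_simp] by blast
  ultimately show ?thesis by (simp add: complex_nonneg_Reals_iff)
qed

context dynamics
begin

lemma monomial_0_positive: assumes a: "a \<in> A" "positive_op a" shows "positive_op (monomial a 0)"
  unfolding positive_op_def
proof
  fix \<xi>
  have "positive_op (\<alpha> (- r) a)" for r by (rule star_automorphism_positive(1)[OF A_alg aut a])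
  then have "cinner (ell2_apply (monomial a 0 \<xi>) r) (ell2_apply \<xi> r) \<in> \<real>\<^sub>\<ge>\<^sub>0" for r
    by (simp add: monomial_apply a positive_op_def)
  then show "cinner (monomial a 0 \<xi>) \<xi> \<in> \<real>\<^sub>\<ge>\<^sub>0"
    by (intro has_sum_nonneg_Reals[OF cinner_ell2_has_sum]) auto
qed

text \<open>The operator \<open>dual x s t\<close> is the \<open>(s, t)\<close> entry of the image of \<open>x\<close> under the
  dual coaction, the homomorphism of the crossed product into its tensor product with the
  group algebra that sends \<open>\<pi>(a) \<lambda>\<^sub>s\<close> to \<open>\<pi>(a) \<lambda>\<^sub>s \<otimes> \<lambda>\<^sub>s\<close>.\<close>

definition dual :: "(('g, 'h) ell2 \<Rightarrow>\<^sub>L ('g, 'h) ell2) \<Rightarrow> 'g \<Rightarrow> 'g \<Rightarrow> (('g, 'h) ell2 \<Rightarrow>\<^sub>L ('g, 'h) ell2)" where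
  "dual x s t = monomial (fcoeff x (s - t)) (s - t)"

lemma dual_B: "x \<in> B \<Longrightarrow> dual x s t \<in> B"
  by (simp add: dual_def monomial_B fcoeff_A)

lemma dual_has_sum:
  assumes x: "x \<in> B"
  shows "((\<lambda>g. cinner (entry x (s + g) (t + g) (ell2_apply \<zeta> (t + g))) (ell2_apply \<omega> (s + g)))
    has_sum cinner (dual x s t \<zeta>) \<omega>) UNIV"
proof -
  have "((\<lambda>u. cinner (ell2_apply (dual x s t \<zeta>) u) (ell2_apply \<omega> u)) has_sum cinner (dual x s t \<zeta>) \<omega>) UNIV"
    by (rule cinner_ell2_has_sum)
  then have *: "((\<lambda>g. cinner (ell2_apply (dual x s t \<zeta>) (s + g)) (ell2_apply \<omega> (s + g)))
      has_sum cinner (dual x s t \<zeta>) \<omega>) UNIV"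
    by (subst has_sum_translate)
  have "ell2_apply (dual x s t \<zeta>) (s + g) = entry x (s + g) (t + g) (ell2_apply \<zeta> (t + g))" for g
  proof -
    have "s + g - (t + g) = s - t"
      by (simp only: diff_conv_add_uminus minus_add add.assoc add_minus_cancel)
    moreover have "- (s - t) + (s + g) = t + g"
      by (simp only: diff_conv_add_uminus minus_add minus_minus add.assoc minus_add_cancel)
    ultimately show ?thesis by (simp add: dual_def monomial_apply fcoeff_A x entry_B)
  qed
  with * show ?thesis by simp
qed

text \<open>Fell's absorption principle. The \<open>(s + g, t + g)\<close> entries of the \<open>(s, t)\<close> entry of the image
  are those of the given operator, and all its other entries vanish. Hence the quadratic form
  splits into a sum over \<open>g\<close> of values of the quadratic form of the given matrix. The vectors at
  which these values are taken collect the coordinates \<open>t + g\<close> of the \<open>t\<close>-th components.\<close>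

lemma dual_positive:
  fixes b :: "nat \<Rightarrow> nat \<Rightarrow> ('g, 'h) ell2 \<Rightarrow>\<^sub>L ('g, 'h) ell2" and v :: "nat \<times> 'g \<Rightarrow> ('g, 'h) ell2"
  assumes b: "opmat_in n B b" "opmat_positive n b" and K: "finite K"
  defines "J \<equiv> {..<n} \<times> K"
  shows "(\<Sum>p\<in>J. cinner (\<Sum>q\<in>J. dual (b (fst p) (fst q)) (snd p) (snd q) (v q)) (v p)) \<in> \<real>\<^sub>\<ge>\<^sub>0"
proof (rule has_sum_nonneg_Reals)
  have bB: "b i j \<in> B" if "i < n" "j < n" for i j using b(1) that by (simp add: opmat_in_def)
  let ?e = "\<lambda>p q g. cinner (entry (b (fst p) (fst q)) (snd p + g) (snd q + g) (ell2_apply (v q) (snd q + g)))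
      (ell2_apply (v p) (snd p + g))"
  show "((\<lambda>g. \<Sum>p\<in>J. \<Sum>q\<in>J. ?e p q g) has_sum
      (\<Sum>p\<in>J. cinner (\<Sum>q\<in>J. dual (b (fst p) (fst q)) (snd p) (snd q) (v q)) (v p))) UNIV"
    unfolding cinner.sum_left
    by (intro has_sum_sum dual_has_sum bB) (auto simp: J_def)
  fix g
  define w where "w j = (\<Sum>t\<in>K. point (t + g) (ell2_apply (v (j, t)) (t + g)))" for j
  have "(\<Sum>i<n. cinner (\<Sum>j<n. b i j (w j)) (w i))
    = (\<Sum>i<n. \<Sum>j<n. \<Sum>s\<in>K. \<Sum>t\<in>K. ?e (i, s) (j, t) g)"
  proof (intro sum.cong refl)
    fix i
    have "cinner (\<Sum>j<n. b i j (w j)) (w i) = (\<Sum>j<n. cinner (b i j (w j)) (w i))"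
      by (rule cinner.sum_left)
    also have "\<dots> = (\<Sum>j<n. \<Sum>s\<in>K. \<Sum>t\<in>K. ?e (i, s) (j, t) g)"
      by (simp add: w_def blinfun.sum_right cinner.sum_left cinner.sum_right cinner_point_right ell2_apply_entry)
    finally show "cinner (\<Sum>j<n. b i j (w j)) (w i) = (\<Sum>j<n. \<Sum>s\<in>K. \<Sum>t\<in>K. ?e (i, s) (j, t) g)" .
  qed
  also have "\<dots> = (\<Sum>i<n. \<Sum>s\<in>K. \<Sum>j<n. \<Sum>t\<in>K. ?e (i, s) (j, t) g)"
    by (intro sum.cong refl sum.swap)
  also have "\<dots> = (\<Sum>p\<in>J. \<Sum>q\<in>J. ?e p q g)"
    unfolding J_def sum.cartesian_product' by (simp add: sum.cartesian_product)
  finally have eq: "(\<Sum>i<n. cinner (\<Sum>j<n. b i j (w j)) (w i)) = (\<Sum>p\<in>J. \<Sum>q\<in>J. ?e p q g)" .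
  show "(\<Sum>p\<in>J. \<Sum>q\<in>J. ?e p q g) \<in> \<real>\<^sub>\<ge>\<^sub>0"
    using b(2)[unfolded opmat_positive_def, rule_format, of w] unfolding eq .
qed

end

context trace_preserving_dynamics
begin

context
  fixes \<Phi> :: "(('g, 'h) ell2 \<Rightarrow>\<^sub>L ('g, 'h) ell2) \<Rightarrow> (('g, 'h) ell2 \<Rightarrow>\<^sub>L ('g, 'h) ell2)"
  assumes \<Phi>_cp: "completely_positive B \<Phi>" and \<Phi>_unital: "unital_map \<Phi>"
    and \<Phi>_trace: "trace_decreasing B \<tau>' \<Phi>"
begin

text \<open>This is \<open>\<E>(\<Phi>(\<pi>(a) \<lambda>\<^sub>t) \<lambda>\<^sub>t\<^sup>*)\<close>. The map induced by this multiplier is what averaging makes of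
  \<open>\<Phi>\<close> to let it commute with the dual coaction; on \<open>L\<^sup>2\<close> it is the block diagonal part of \<open>\<Phi>\<close>.\<close>

definition coeff_map :: "'g \<Rightarrow> ('h \<Rightarrow>\<^sub>L 'h) \<Rightarrow> ('h \<Rightarrow>\<^sub>L 'h)" where
  "coeff_map t a = fcoeff (\<Phi> (monomial a t)) t"

lemma \<Phi>_B: "x \<in> B \<Longrightarrow> \<Phi> x \<in> B" and \<Phi>_lin: "linear_on B \<Phi>"
  using \<Phi>_cp by (auto simp: completely_positive_def)

lemma \<Phi>_cb: "cb_norm_le B \<Phi> 1"
  by (rule completely_positive_unital_contractive[OF unital_cstar_algebra_operator_system[OF B_alg] \<Phi>_cp \<Phi>_unital])

lemma coeff_map_A: "a \<in> A \<Longrightarrow> coeff_map t a \<in> A"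
  by (simp add: coeff_map_def fcoeff_A \<Phi>_B monomial_B)

lemma coeff_map_lin: "linear_on A (coeff_map t)"
  unfolding linear_on_def coeff_map_def
  by (simp add: monomial_add monomial_scaleC linear_onD[OF \<Phi>_lin] monomial_B fcoeff_add fcoeff_scaleC)

lemma coeff_map_cb: "cb_norm_le A (coeff_map t) 1"
  unfolding cb_norm_le_def mult_1
proof (intro allI impI)
  fix n b assume b: "opmat_in n A b"
  have "opmat_norm n (\<lambda>i j. coeff_map t (b i j)) \<le> opmat_norm n (\<lambda>i j. \<Phi> (monomial (b i j) t))"
    unfolding coeff_map_def fcoeff_def by (rule opmat_norm_entry_le)
  also have "\<dots> \<le> opmat_norm n (\<lambda>i j. monomial (b i j) t)"
    using \<Phi>_cb[unfolded cb_norm_le_def, rule_format, of n "\<lambda>i j. monomial (b i j) t"] b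
    by (simp add: opmat_in_def monomial_B)
  also have "\<dots> \<le> opmat_norm n b" by (rule monomial_completely_contractive[OF b])
  finally show "opmat_norm n (\<lambda>i j. coeff_map t (b i j)) \<le> opmat_norm n b" .
qed

lemma coeff_map_maps: "coefficient_maps coeff_map"
  unfolding coefficient_maps_def using coeff_map_lin coeff_map_A cb_norm_le_norm[OF coeff_map_cb] by blast

lemma coeff_map_unital: "unital_map (coeff_map 0)"
  using \<Phi>_unital fcoeff_monomial[OF A_id, of 0 0] by (simp add: unital_map_def coeff_map_def monomial_id)

text \<open>The matrix entries of the multiplied operator are entries of \<open>\<Phi>\<close> applied to the dual
  coaction. Its compression to finitely many group elements is therefore a compression of the
  amplification of \<open>\<Phi>\<close> at the positive matrix given by the dual coaction.\<close>

lemma coeff_map_positive: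
  assumes V: "V \<subseteq> B" and T: "\<And>x. x \<in> V \<Longrightarrow> T x \<in> B"
    and TF: "\<And>x s. x \<in> V \<Longrightarrow> fcoeff (T x) s = coeff_map s (fcoeff x s)"
    and b: "opmat_in n V b" "opmat_positive n b"
  shows "opmat_positive n (\<lambda>i j. T (b i j))"
  unfolding opmat_positive_def
proof
  fix y :: "nat \<Rightarrow> ('g, 'h) ell2"
  have bV: "b i j \<in> V" if "i < n" "j < n" for i j using b(1) that by (simp add: opmat_in_def)
  have bB: "opmat_in n B b" using b(1) V by (auto simp: opmat_in_def)
  have entry_T: "entry (T x) s t = entry (\<Phi> (dual x s t)) s t" if x: "x \<in> V" for x s t
  proof -
    have xB: "x \<in> B" using x V by auto
    then show ?thesis
      by (simp add: entry_B T x TF \<Phi>_B dual_B) (simp add: coeff_map_def dual_def)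
  qed
  define P where "P K \<xi> = (\<Sum>s\<in>K. point s (ell2_apply \<xi> s))" for K and \<xi> :: "('g, 'h) ell2"
  let ?q = "\<lambda>K. \<Sum>i<n. cinner (\<Sum>j<n. T (b i j) (P K (y j))) (P K (y i))"
  have fin: "?q K \<in> \<real>\<^sub>\<ge>\<^sub>0" if K: "finite K" for K
  proof -
    define J where "J = {..<n} \<times> K"
    define v where "v p = (point (snd p) (ell2_apply (y (fst p)) (snd p)) :: ('g, 'h) ell2)" for p
    let ?m = "\<lambda>p q. dual (b (fst p) (fst q)) (snd p) (snd q)"
    have "(\<Sum>p\<in>J. cinner (\<Sum>q\<in>J. \<Phi> (?m p q) (v q)) (v p)) \<in> \<real>\<^sub>\<ge>\<^sub>0"
    proof (rule completely_positive_finite[OF \<Phi>_cp])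
      show "finite J" using K by (simp add: J_def)
      show "?m p q \<in> B" if "p \<in> J" "q \<in> J" for p q
        using that bB by (intro dual_B) (auto simp: J_def opmat_in_def)
      show "(\<Sum>p\<in>J. cinner (\<Sum>q\<in>J. ?m p q (w q)) (w p)) \<in> \<real>\<^sub>\<ge>\<^sub>0" for w
        unfolding J_def by (rule dual_positive[OF bB b(2) K])
    qed
    also have "(\<Sum>p\<in>J. cinner (\<Sum>q\<in>J. \<Phi> (?m p q) (v q)) (v p))
      = (\<Sum>p\<in>J. \<Sum>q\<in>J. cinner (entry (\<Phi> (?m p q)) (snd p) (snd q) (ell2_apply (y (fst q)) (snd q)))
          (ell2_apply (y (fst p)) (snd p)))"
      by (simp add: cinner.sum_left v_def cinner_point_right ell2_apply_entry)
    also have "\<dots> = (\<Sum>p\<in>J. \<Sum>q\<in>J. cinner (entry (T (b (fst p) (fst q))) (snd p) (snd q)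
        (ell2_apply (y (fst q)) (snd q))) (ell2_apply (y (fst p)) (snd p)))"
      by (intro sum.cong refl) (auto simp: J_def entry_T bV)
    also have "\<dots> = (\<Sum>i<n. \<Sum>s\<in>K. \<Sum>j<n. \<Sum>t\<in>K. cinner (entry (T (b i j)) s t
        (ell2_apply (y j) t)) (ell2_apply (y i) s))"
      unfolding J_def sum.cartesian_product' by (simp add: sum.cartesian_product)
    also have "\<dots> = ?q K"
      by (simp add: P_def blinfun.sum_right cinner.sum_left cinner.sum_right cinner_point_right ell2_apply_entry)
    finally show ?thesis .
  qed
  have P: "((\<lambda>K. P K \<xi>) \<longlongrightarrow> \<xi>) (finite_subsets_at_top UNIV)" for \<xi>
    using points_has_sum[of \<xi>] by (simp add: has_sum_def P_def)
  have "(?q \<longlongrightarrow> (\<Sum>i<n. cinner (\<Sum>j<n. T (b i j) (y j)) (y i))) (finite_subsets_at_top UNIV)"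
    by (intro tendsto_sum cinner.tendsto blinfun.tendsto tendsto_const P)
  then show "(\<Sum>i<n. cinner (\<Sum>j<n. T (b i j) (y j)) (y i)) \<in> \<real>\<^sub>\<ge>\<^sub>0"
  proof (rule Lim_in_closed_set[rotated -1])
    show "closed (\<real>\<^sub>\<ge>\<^sub>0 :: complex set)" by (rule closed_nonneg_Reals_complex)
    show "\<forall>\<^sub>F K in finite_subsets_at_top UNIV. ?q K \<in> \<real>\<^sub>\<ge>\<^sub>0"
      by (rule eventually_finite_subsets_at_top_weakI) (rule fin)
  qed simp
qed

text \<open>The induced map exists a priori only on the algebraic crossed product. There it is
  completely positive and unital, hence completely contractive, and so it extends. Positivity of
  the extension follows from the same lemma again.\<close>

lemma coeff_map_multiplier: "cp_herz_schur_multiplier A \<alpha> coeff_map"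
proof -
  define S where "S x = (\<Sum>s\<in>{s. fcoeff x s \<noteq> 0}. monomial (coeff_map s (fcoeff x s)) s)" for x
  note zero = coefficient_mapsD(3)[OF coeff_map_maps]
  have S: "S x = (\<Sum>s\<in>K. monomial (coeff_map s (fcoeff x s)) s)"
    if "finite K" "\<And>s. s \<notin> K \<Longrightarrow> fcoeff x s = 0" for x K
    unfolding S_def by (rule sum.mono_neutral_left) (use that zero in auto)
  have supp: "\<exists>K. finite K \<and> (\<forall>s. s \<notin> K \<longrightarrow> fcoeff x s = 0)" if "x \<in> finsums" for x
    using that by (rule finsums_fcoeff) blast
  have cA: "coeff_map s (fcoeff x s) \<in> A" if "x \<in> finsums" for x s
    by (intro coeff_map_A fcoeff_A finsums_B that)
  have S_fin: "S x \<in> finsums" if x: "x \<in> finsums" for x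
  proof -
    obtain K where K: "finite K" "\<And>s. s \<notin> K \<Longrightarrow> fcoeff x s = 0" using supp[OF x] by blast
    have "S x = (\<Sum>s\<in>K. monomial (coeff_map s (fcoeff x s)) s)" using K by (rule S)
    then show ?thesis using finsumsI[OF K(1) cA[OF x]] by simp
  qed
  have S_lin: "linear_on finsums S"
    unfolding linear_on_def
  proof (intro conjI ballI allI)
    fix x y assume x: "x \<in> finsums" and y: "y \<in> finsums"
    obtain K where K: "finite K" "\<And>s. s \<notin> K \<Longrightarrow> fcoeff x s = 0" using supp[OF x] by blast
    obtain L where L: "finite L" "\<And>s. s \<notin> L \<Longrightarrow> fcoeff y s = 0" using supp[OF y] by blast
    have "S x = (\<Sum>s\<in>K \<union> L. monomial (coeff_map s (fcoeff x s)) s)"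
      "S y = (\<Sum>s\<in>K \<union> L. monomial (coeff_map s (fcoeff y s)) s)"
      "S (x + y) = (\<Sum>s\<in>K \<union> L. monomial (coeff_map s (fcoeff (x + y) s)) s)"
      by (rule S; use K L in \<open>auto simp: fcoeff_add\<close>)+
    then show "S (x + y) = S x + S y"
      by (simp add: fcoeff_add linear_onD(1)[OF coeff_map_lin] fcoeff_A finsums_B x y monomial_add cA sum.distrib)
  next
    fix c x assume x: "x \<in> finsums"
    obtain K where K: "finite K" "\<And>s. s \<notin> K \<Longrightarrow> fcoeff x s = 0" using supp[OF x] by blast
    have "S x = (\<Sum>s\<in>K. monomial (coeff_map s (fcoeff x s)) s)"
      "S (c *\<^sub>C x) = (\<Sum>s\<in>K. monomial (coeff_map s (fcoeff (c *\<^sub>C x) s)) s)"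
      by (rule S; use K in \<open>auto simp: fcoeff_scaleC\<close>)+
    then show "S (c *\<^sub>C x) = c *\<^sub>C S x"
      by (simp add: fcoeff_scaleC linear_onD(2)[OF coeff_map_lin] fcoeff_A finsums_B x monomial_scaleC cA scaleC_sum_right)
  qed
  have S_monomial: "S (monomial a s) = monomial (coeff_map s a) s" if a: "a \<in> A" for a s
    using S[of "{s}" "monomial a s"] by (simp add: fcoeff_monomial a)
  have S_fcoeff: "fcoeff (S x) s = coeff_map s (fcoeff x s)" if x: "x \<in> finsums" for x s
  proof -
    obtain K where K: "finite K" "\<And>s. s \<notin> K \<Longrightarrow> fcoeff x s = 0" using supp[OF x] by blast
    have "S x = (\<Sum>s\<in>K. monomial (coeff_map s (fcoeff x s)) s)" using K by (rule S)
    then show ?thesis using fcoeff_finsum[OF K(1) cA[OF x]] K(2) by (simp add: zero)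
  qed
  have "completely_positive finsums S"
    unfolding completely_positive_def
  proof (intro conjI allI impI)
    show "S ` finsums \<subseteq> finsums" using S_fin by auto
    fix n b assume b: "opmat_in n finsums b \<and> opmat_positive n b"
    show "opmat_positive n (\<lambda>i j. S (b i j))"
      by (rule coeff_map_positive[of finsums]) (use b S_fin finsums_B S_fcoeff in auto)
  qed (rule S_lin)
  moreover have "operator_system finsums"
    using finsums_bo finsums_subspace finsums_id finsums_adjoint by (simp add: operator_system_def)
  moreover have "unital_map S"
    using S_monomial[OF A_id, of 0] coeff_map_unital by (simp add: unital_map_def monomial_id)
  ultimately have "cb_norm_le finsums S 1" by (intro completely_positive_unital_contractive)
  from multiplier_extension[OF coeff_map_maps S_lin this S_monomial]
  obtain S' where S': "multiplies_by A \<alpha> coeff_map S'" "completely_bounded B S'" by blast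
  let ?V = "pi_tilde \<alpha> ` l1_functions A"
  have VB: "?V \<subseteq> B" using pi_tilde_B by auto
  have "S' ` ?V \<subseteq> ?V"
    using S'(1) coefficient_maps_l1[OF coeff_map_maps] by (auto simp: multiplies_by_def)
  moreover have "linear_on ?V S'"
    by (rule linear_on_subset[OF _ VB]) (use S'(2) in \<open>simp add: completely_bounded_def\<close>)
  moreover obtain C where "cb_norm_le B S' C" using S'(2) by (auto simp: completely_bounded_def)
  then have "cb_norm_le ?V S' C" by (rule cb_norm_le_subset[OF _ VB])
  ultimately have "completely_bounded ?V S'" by (auto simp: completely_bounded_def)
  moreover have "completely_bounded A (coeff_map t)" for t
    using coeff_map_A coeff_map_lin coeff_map_cb by (auto simp: completely_bounded_def intro!: exI[of _ 1])
  ultimately have hs: "herz_schur_multiplier A \<alpha> coeff_map"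
    using S'(1) coeff_map_cb unfolding herz_schur_multiplier_def by blast
  define T where "T = herz_schur_map A \<alpha> coeff_map"
  have T: "multiplies_by A \<alpha> coeff_map T" "completely_bounded B T"
    unfolding T_def by (rule herz_schur_map_multiplies[OF hs])+
  have TB: "T ` B \<subseteq> B" "linear_on B T" using T(2) by (auto simp: completely_bounded_def)
  have "completely_positive B T"
    unfolding completely_positive_def
  proof (intro conjI allI impI)
    fix n b assume b: "opmat_in n B b \<and> opmat_positive n b"
    show "opmat_positive n (\<lambda>i j. T (b i j))"
      by (rule coeff_map_positive[of B]) (use b TB multiplier_fcoeff[OF coeff_map_maps T] in auto)
  qed (use TB in auto)
  then show ?thesis using hs unfolding cp_herz_schur_multiplier_def T_def by blast
qed

lemma coeff_map_norm2: assumes a: "a \<in> A" shows "norm2 \<tau> (coeff_map t a) \<le> norm2 \<tau> a"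
proof -
  have "norm2 \<tau> (coeff_map t a) \<le> norm2 \<tau>' (\<Phi> (monomial a t))"
    unfolding coeff_map_def by (intro norm2_fcoeff_le \<Phi>_B monomial_B a)
  also have "\<dots> \<le> norm2 \<tau>' (monomial a t)"
    by (intro cross.L2_contraction[OF \<Phi>_cp \<Phi>_unital \<Phi>_trace] monomial_B a)
  finally show ?thesis by (simp add: norm2_monomial a)
qed

lemma coeff_map_L2_bounded: "L2_bounded A \<tau> (coeff_map t)"
  unfolding L2_bounded_def using coeff_map_norm2 by (intro exI[of _ 1]) auto

lemma coeff_map_trace: "trace_decreasing A \<tau> (coeff_map 0)"
  unfolding trace_decreasing_def
proof (intro ballI impI)
  fix a assume a: "a \<in> A" "positive_op a"
  have m: "monomial a 0 \<in> B" by (rule monomial_B[OF a(1)])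
  have "Re (\<tau>' (\<Phi> (monomial a 0))) \<le> Re (\<tau>' (monomial a 0))"
    using \<Phi>_trace m monomial_0_positive[OF a] by (simp add: trace_decreasing_def)
  then show "Re (\<tau> (coeff_map 0 a)) \<le> Re (\<tau> a)"
    using m a by (simp add: \<tau>'_fcoeff \<Phi>_B fcoeff_monomial coeff_map_def)
qed

lemma coeff_map_L2_compact:
  assumes cpt: "L2_compact B \<tau>' \<Phi>" shows "L2_compact A \<tau> (coeff_map t)"
proof -
  have im: "\<Phi> ` B \<subseteq> B" "coeff_map t ` A \<subseteq> A" using \<Phi>_B coeff_map_A by auto
  have tb: "cross.L2_totally_bounded \<Phi>" using cpt cross.L2_compact_iff[OF \<Phi>_lin im(1)] by blast
  have "base.L2_totally_bounded (coeff_map t)"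
    unfolding base.L2_totally_bounded_def
  proof (intro allI impI)
    fix e :: real assume e: "0 < e"
    from tb[unfolded cross.L2_totally_bounded_def, rule_format, OF e]
    obtain K where K: "finite K" "K \<subseteq> B"
      "\<And>x. x \<in> B \<Longrightarrow> norm2 \<tau>' x \<le> 1 \<Longrightarrow> \<exists>k\<in>K. norm2 \<tau>' (\<Phi> x - k) < e" by blast
    have "\<exists>k\<in>(\<lambda>k. fcoeff k t) ` K. norm2 \<tau> (coeff_map t a - k) < e" if a: "a \<in> A" "norm2 \<tau> a \<le> 1" for a
    proof -
      have m: "monomial a t \<in> B" by (rule monomial_B[OF a(1)])
      obtain k where k: "k \<in> K" "norm2 \<tau>' (\<Phi> (monomial a t) - k) < e"
        using K(3)[OF m] a by (auto simp: norm2_monomial)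
      have "norm2 \<tau> (fcoeff (\<Phi> (monomial a t) - k) t) \<le> norm2 \<tau>' (\<Phi> (monomial a t) - k)"
        using k K(2) by (intro norm2_fcoeff_le cross.subB \<Phi>_B m) auto
      then have "norm2 \<tau> (coeff_map t a - fcoeff k t) < e"
        using k(2) by (simp add: fcoeff_diff coeff_map_def)
      then show ?thesis using k(1) by blast
    qed
    then show "\<exists>K. finite K \<and> K \<subseteq> A \<and> (\<forall>b\<in>A. norm2 \<tau> b \<le> 1 \<longrightarrow> (\<exists>k\<in>K. norm2 \<tau> (coeff_map t b - k) < e))"
      using K(1,2) fcoeff_A by (intro exI[of _ "(\<lambda>k. fcoeff k t) ` K"]) auto
  qed
  then show ?thesis using base.L2_compact_iff[OF coeff_map_lin im(2)] coeff_map_L2_bounded by blast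
qed

text \<open>The image of the unit ball under \<open>\<Phi>\<close> is close to finitely many elements, and by Bessel's
  inequality the coefficients of these are small outside a finite set of group elements.\<close>

lemma coeff_map_vanishes:
  assumes cpt: "L2_compact B \<tau>' \<Phi>"
  shows "((\<lambda>s. L2_opnorm A \<tau> (coeff_map s)) \<longlongrightarrow> 0) cofinite"
proof (rule tendstoI)
  fix e :: real assume e: "0 < e"
  have im: "\<Phi> ` B \<subseteq> B" using \<Phi>_B by auto
  have imA: "coeff_map t ` A \<subseteq> A" for t using coeff_map_A by auto
  have tb: "cross.L2_totally_bounded \<Phi>" using cpt cross.L2_compact_iff[OF \<Phi>_lin im] by blast
  have "0 < e / 4" using e by simp
  from tb[unfolded cross.L2_totally_bounded_def, rule_format, OF this]
  obtain K where K: "finite K" "K \<subseteq> B"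
    "\<And>x. x \<in> B \<Longrightarrow> norm2 \<tau>' x \<le> 1 \<Longrightarrow> \<exists>k\<in>K. norm2 \<tau>' (\<Phi> x - k) < e / 4" by blast
  \<comment> \<open>More than \<open>(\<parallel>k\<parallel>\<^sub>2 / (e / 4))\<^sup>2\<close> large coefficients would contradict Bessel's inequality.\<close>
  have large: "finite {s. e / 4 \<le> norm2 \<tau> (fcoeff k s)}" if k: "k \<in> B" for k
  proof (rule ccontr)
    assume inf: "infinite {s. e / 4 \<le> norm2 \<tau> (fcoeff k s)}"
    obtain N :: nat where N: "(norm2 \<tau>' k)\<^sup>2 / (e / 4)\<^sup>2 < N" using reals_Archimedean2 by blast
    obtain L where L: "finite L" "card L = N" "L \<subseteq> {s. e / 4 \<le> norm2 \<tau> (fcoeff k s)}"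
      using infinite_arbitrarily_large[OF inf] by blast
    have "real N * (e / 4)\<^sup>2 = (\<Sum>s\<in>L. (e / 4)\<^sup>2)" using L by simp
    also have "\<dots> \<le> (\<Sum>s\<in>L. (norm2 \<tau> (fcoeff k s))\<^sup>2)"
      using L(3) e by (intro sum_mono power_mono) auto
    also have "\<dots> \<le> (norm2 \<tau>' k)\<^sup>2" by (rule bessel[OF k L(1)])
    finally show False using N e by (simp add: field_simps)
  qed
  define X where "X = (\<Union>k\<in>K. {s. e / 4 \<le> norm2 \<tau> (fcoeff k s)})"
  have X: "finite X" unfolding X_def using K large by auto
  have "dist (L2_opnorm A \<tau> (coeff_map s)) 0 < e" if s: "s \<notin> X" for s
  proof -
    have "norm2 \<tau> (coeff_map s a) \<le> e / 2" if a: "a \<in> A" "norm2 \<tau> a \<le> 1" for a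
    proof -
      have m: "monomial a s \<in> B" by (rule monomial_B[OF a(1)])
      obtain k where k: "k \<in> K" "norm2 \<tau>' (\<Phi> (monomial a s) - k) < e / 4"
        using K(3)[OF m] a by (auto simp: norm2_monomial)
      have kB: "k \<in> B" using k K by auto
      have "norm2 \<tau> (coeff_map s a) = norm2 \<tau> (fcoeff (\<Phi> (monomial a s) - k) s + fcoeff k s)"
        by (simp add: coeff_map_def fcoeff_diff)
      also have "\<dots> \<le> norm2 \<tau> (fcoeff (\<Phi> (monomial a s) - k) s) + norm2 \<tau> (fcoeff k s)"
        by (intro base.norm2_triangle fcoeff_A cross.subB \<Phi>_B m kB)
      also have "norm2 \<tau> (fcoeff (\<Phi> (monomial a s) - k) s) \<le> norm2 \<tau>' (\<Phi> (monomial a s) - k)"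
        by (intro norm2_fcoeff_le cross.subB \<Phi>_B m kB)
      finally have "norm2 \<tau> (coeff_map s a) \<le> norm2 \<tau>' (\<Phi> (monomial a s) - k) + norm2 \<tau> (fcoeff k s)" by simp
      moreover have "norm2 \<tau> (fcoeff k s) < e / 4" using s k(1) by (auto simp: X_def not_le)
      ultimately show ?thesis using k(2) by linarith
    qed
    then have le: "norm2 \<tau> (coeff_map s a) \<le> e / 2 * norm2 \<tau> a" if "a \<in> A" for a
      using base.norm2_le_of_unit_ball[OF coeff_map_lin imA coeff_map_L2_bounded _ that] by blast
    have "0 < e / 2" using e by simp
    from base.L2_opnorm_leI[OF coeff_map_lin imA le this] show ?thesis using e by simp
  qed
  then have "{s. \<not> dist (L2_opnorm A \<tau> (coeff_map s)) 0 < e} \<subseteq> X" by blast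
  then show "\<forall>\<^sub>F s in cofinite. dist (L2_opnorm A \<tau> (coeff_map s)) 0 < e"
    unfolding eventually_cofinite using X finite_subset by blast
qed

end

lemma dynamical_system_haagerup:
  assumes cs: "cstar_haagerup B \<tau>'" shows "system_haagerup A \<alpha> \<tau>"
proof -
  from cs obtain I :: "((('g, 'h) ell2 \<Rightarrow>\<^sub>L ('g, 'h) ell2) \<Rightarrow> (('g, 'h) ell2 \<Rightarrow>\<^sub>L ('g, 'h) ell2)) net_index set" and le \<Phi>
    where dir: "directed_set I le"
      and \<Phi>: "\<And>i. i \<in> I \<Longrightarrow> completely_positive B (\<Phi> i)" "\<And>i. i \<in> I \<Longrightarrow> unital_map (\<Phi> i)"
        "\<And>i. i \<in> I \<Longrightarrow> trace_decreasing B \<tau>' (\<Phi> i)" "\<And>i. i \<in> I \<Longrightarrow> L2_compact B \<tau>' (\<Phi> i)"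
      and lim: "\<And>x. x \<in> B \<Longrightarrow> ((\<lambda>i. norm2 \<tau>' (\<Phi> i x - x)) \<longlongrightarrow> 0) (net_filter I le)"
    unfolding cstar_haagerup_def by blast
  show ?thesis
  proof (rule system_haagerupI[OF dir, where F = "\<lambda>i. coeff_map (\<Phi> i)"])
    fix i assume i: "i \<in> I"
    note p = \<Phi>(1)[OF i] \<Phi>(2)[OF i] \<Phi>(3)[OF i]
    show "cp_herz_schur_multiplier A \<alpha> (coeff_map (\<Phi> i)) \<and> unital_map (coeff_map (\<Phi> i) 0) \<and>
        trace_decreasing A \<tau> (coeff_map (\<Phi> i) 0) \<and> (\<forall>t. L2_compact A \<tau> (coeff_map (\<Phi> i) t)) \<and>
        ((\<lambda>s. L2_opnorm A \<tau> (coeff_map (\<Phi> i) s)) \<longlongrightarrow> 0) cofinite"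
      using coeff_map_multiplier[OF p] coeff_map_unital[OF p] coeff_map_trace[OF p]
        coeff_map_L2_compact[OF p \<Phi>(4)[OF i]] coeff_map_vanishes[OF p \<Phi>(4)[OF i]] by blast
  next
    fix t a assume a: "a \<in> A"
    have m: "monomial a t \<in> B" by (rule monomial_B[OF a])
    show "((\<lambda>i. norm2 \<tau> (coeff_map (\<Phi> i) t a - a)) \<longlongrightarrow> 0) (net_filter I le)"
    proof (rule Lim_null_comparison[OF _ lim[OF m]])
      show "\<forall>\<^sub>F i in net_filter I le. norm (norm2 \<tau> (coeff_map (\<Phi> i) t a - a))
          \<le> norm2 \<tau>' (\<Phi> i (monomial a t) - monomial a t)"
        using eventually_in_net[OF dir]
      proof (rule eventually_mono)
        fix i assume i: "i \<in> I"
        have \<Phi>m: "\<Phi> i (monomial a t) \<in> B" using \<Phi>(1)[OF i] m by (auto simp: completely_positive_def)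
        have eq: "coeff_map (\<Phi> i) t a - a = fcoeff (\<Phi> i (monomial a t) - monomial a t) t"
          by (simp add: coeff_map_def[OF \<Phi>(1)[OF i] \<Phi>(2)[OF i] \<Phi>(3)[OF i]] fcoeff_diff fcoeff_monomial a)
        have d: "\<Phi> i (monomial a t) - monomial a t \<in> B" by (intro cross.subB \<Phi>m m)
        show "norm (norm2 \<tau> (coeff_map (\<Phi> i) t a - a)) \<le> norm2 \<tau>' (\<Phi> i (monomial a t) - monomial a t)"
          unfolding eq using norm2_fcoeff_le[OF d] base.norm2_nonneg[OF fcoeff_A[OF d]] by simp
      qed
    qed
  qed
qed

end

theorem theorem3p8:
  fixes A :: "('h :: chilbert_space \<Rightarrow>\<^sub>L 'h) set"
    and \<alpha> :: "'g :: group_add \<Rightarrow> ('h \<Rightarrow>\<^sub>L 'h) \<Rightarrow> ('h \<Rightarrow>\<^sub>L 'h)"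
    and \<tau> :: "('h \<Rightarrow>\<^sub>L 'h) \<Rightarrow> complex"
  assumes "cstar_dynamical_system A \<alpha>"
    and "faithful_tracial_state A \<tau>"
    and "\<forall>t. \<forall>a\<in>A. \<tau> (\<alpha> t a) = \<tau> a"
  shows "system_haagerup A \<alpha> \<tau> \<longleftrightarrow>
    cstar_haagerup (crossed_product A \<alpha>) (induced_trace A \<alpha> \<tau>)"
proof -
  interpret trace_preserving_dynamics A \<alpha> \<tau>
    using assms by unfold_locales auto
  show ?thesis using crossed_product_haagerup dynamical_system_haagerup by blast
qed

end
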